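(* Let $H$ be a Koszul--Vinberg structure on a left-symmetric algebroid $(\mathcal{A},\ast_{\mathcal{A}},a_{\mathcal{A}})$. Then there is a one-to-one correspondence between equivalence classes of infinitesimal deformations of the Koszul--Vinberg structure $H$ and the second cohomology group $\tilde{H}^2_{\mathrm{KV}}(\mathcal{A}^* )$.
   Context: Vector bundles are smooth real vector bundles over a smooth manifold $M$. A left-symmetric algebroid $(\mathcal{A},\ast_{\mathcal{A}},a_{\mathcal{A}})$ is a vector bundle $\mathcal{A}\to M$ with an $\mathbb{R}$-bilinear product $\ast_{\mathcal{A}}$ on $\Gamma(\mathcal{A})$ satisfying $x\ast(y\ast z)-(x\ast y)\ast z=y\ast(x\ast z)-(y\ast x)\ast z$ and a bundle map $a_{\mathcal{A}}:\mathcal{A}\to TM$ with $x\ast_{\mathcal{A}}(fy)=f(x\ast_{\mathcal{A}}y)+a_{\mathcal{A}}(x)(f)y$, $(fx)\ast_{\mathcal{A}}y=f(x\ast_{\mathcal{A}}y)$. Its sub-adjacent Lie algebroid $\mathcal{A}^c$ has bracket $[x,y]_{\mathcal{A}}=x\ast_{\mathcal{A}}y-y\ast_{\mathcal{A}}x$ and anchor $a_{\mathcal{A}}$. On $\Gamma(\mathcal{A}^* )$: $\langle L_x\xi,y\rangle=a_{\mathcal{A}}(x)\langle\xi,y\rangle-\langle\xi,x\ast_{\mathcal{A}}y\rangle$ and $\langle R_x\xi,y\rangle=-\langle\xi,y\ast_{\mathcal{A}}x\rangle$. $\mathrm{Sym}^2(\mathcal{A})$ is the set of (sections) $H$ of $\mathcal{A}\otimes\mathcal{A}$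 with $H(\alpha,\beta)=H(\beta,\alpha)$; $H^\sharp:\mathcal{A}^*\to\mathcal{A}$ is $\langle H^\sharp(\alpha),\beta\rangle=H(\alpha,\beta)$. Define $$\begin{aligned}[][H,H](\alpha_1,\alpha_2,\alpha_3)={}&a_{\mathcal{A}}(H^\sharp(\alpha_1))\langle H^\sharp(\alpha_2),\alpha_3\rangle-a_{\mathcal{A}}(H^\sharp(\alpha_2))\langle H^\sharp(\alpha_1),\alpha_3\rangle+\langle\alpha_1,H^\sharp(\alpha_2)\ast_{\mathcal{A}}H^\sharp(\alpha_3)\rangle\\&-\langle\alpha_2,H^\sharp(\alpha_1)\ast_{\mathcal{A}}H^\sharp(\alpha_3)\rangle-\langle\alpha_3,[H^\sharp(\alpha_1),H^\sharp(\alpha_2)]_{\mathcal{A}}\rangle.\end{aligned}$$ $H$ is a Koszul--Vinberg structure if $[H,H]=0$. Let $\mathcal{C}^k(\mathcal{A}^*,\mathcal{A})=\Gamma(\mathrm{Hom}(\wedge^k\mathcal{A}^*,\mathcal{A}))$, $k\ge0$. For $P\in \mathcal{C}^n(\mathcal{A}^*,\mathcal{A})$, $Q\in \mathcal{C}^m(\mathcal{A}^*,\mathcal{A})$, $$\begin{aligned} [\![P,Q]\!](\alpha_1,\dots,\alpha_{m+n})={}&\sum_{\sigma\in\mathbb{S}_{(m,1,n-1)}} (-1)^\sigma P(L_{Q(\alpha_{\sigma(1)},\dots,\alpha_{\sigma(m)})}\alpha_{\sigma(m+1)},\alpha_{\sigma(m+2)},\dots,\alpha_{\sigma(m+n)})\\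 &-(-1)^{mn}\sum_{\sigma\in\mathbb{S}_{(n,1,m-1)}} (-1)^\sigma Q(L_{P(\alpha_{\sigma(1)},\dots,\alpha_{\sigma(n)})}\alpha_{\sigma(n+1)},\alpha_{\sigma(n+2)},\dots,\alpha_{\sigma(m+n)})\\ &+(-1)^{mn}\sum_{\sigma\in\mathbb{S}_{(n,m)}} (-1)^\sigma [P(\alpha_{\sigma(1)},\dots,\alpha_{\sigma(n)}),Q(\alpha_{\sigma(n+1)},\dots,\alpha_{\sigma(m+n)})]_{\mathcal{A}}, \end{aligned}$$ where $\mathbb{S}_{(i_1,\dots,i_k)}$ is the set of unshuffles (permutations increasing on consecutive blocks of lengths $i_1,\dots,i_k$) and a sum involving a block of length $-1$ is zero. $\Psi:\Gamma(\wedge^k\mathcal{A}\otimes\mathcal{A})\to\mathcal{C}^k(\mathcal{A}^*,\mathcal{A})$, $\langle\Psi(\varphi)(\alpha_1,\dots,\alpha_k),\alpha_{k+1}\rangle=\varphi(\alpha_1,\dots,\alpha_{k+1})$, is bijective; put $C^k_{\mathrm{KV}}(\mathcal{A}^* )=\Gamma(\wedge^{k-1}\mathcal{A}\otimes\mathcal{A})$ ($k\ge1$) and $[\![\varphi,\phi]\!]_{\mathrm{KV}}=\Psi^{-1}[\![\Psi(\varphi),\Psi(\phi)]\!]$, a graded Lie bracket with $C^{k}_{\mathrm{KV}}$ in degree $k-1$. For a Koszul--Vinberg structure $H$, $\delta_{\mathcal{A}^*}\varphi=(-1)^{k-1}[\![H,\varphi]\!]_{\mathrm{KV}}$ for $\varphi\in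 C^k_{\mathrm{KV}}(\mathcal{A}^* )$ is a differential on $C^*_{\mathrm{KV}}(\mathcal{A}^* )$. The subcomplex $\tilde C^*_{\mathrm{KV}}(\mathcal{A}^* )$ is given by $\tilde C^1_{\mathrm{KV}}=\{x\in C^1_{\mathrm{KV}}=\Gamma(\mathcal{A}): H(R_x\alpha_1,\alpha_2)=H(\alpha_1,R_x\alpha_2)\ \forall\alpha_1,\alpha_2\in\Gamma(\mathcal{A}^* )\}$; $\tilde C^2_{\mathrm{KV}}=\{\varphi\in C^2_{\mathrm{KV}}:\varphi(\alpha_1,\alpha_2)=\varphi(\alpha_2,\alpha_1)\}$; $\tilde C^3_{\mathrm{KV}}=\{\varphi\in C^3_{\mathrm{KV}}:\varphi(\alpha_1,\alpha_2,\alpha_3)+\text{cyclic permutations}=0\}$; $\tilde C^k_{\mathrm{KV}}=C^k_{\mathrm{KV}}$ for $k\ge4$. Its $k$-th cohomology group is $\tilde H^k_{\mathrm{KV}}(\mathcal{A}^* )$. Extend all structures $\mathbb{R}[[t]]$-linearly. An order $n$ deformation of $H$ is $H_{(n)}=\sum_{i=0}^n\mathcal{H}_it^i$ with $\mathcal{H}_0=H$, $\mathcal{H}_i\in\mathrm{Sym}^2(\mathcal{A})$, which is a Koszul--Vinberg structure over $\mathbb{R}[[t]]/(t^{n+1})$, i.e. $[H_{(n)},H_{(n)}]=0$ modulo $t^{n+1}$. An infinitesimal deformation is an order $1$ deformation. Order $n$ deformations $H_t,H_t'$ are equivalent if there is $\mathcal{X}_t=\sum_{i\ge1}x_it^i$,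 $x_i\in\Gamma(\mathcal{A})$, with $\exp(\mathrm{ad}_{\mathcal{X}_t})H_t=H'_t$ modulo $t^{n+1}$, where $\exp(\mathrm{ad}_{\mathcal{X}_t})=\sum_{k\ge0}\frac1{k!}\mathrm{ad}_{\mathcal{X}_t}^k$ and $\mathrm{ad}_{\mathcal{X}_t}=[\![\mathcal{X}_t,\cdot]\!]_{\mathrm{KV}}$. *)

theory Defs
  imports "HOL-Analysis.Analysis" "HOL-Library.Function_Algebras"
begin

(* Sections, covectors, tensor fields and tangent vectors are all functions; with this instance
   the sums and real multiples below are the pointwise ones. *)
instantiation "fun" :: (type, real_vector) real_vector
begin

definition scaleR_fun :: "real \<Rightarrow> ('a \<Rightarrow> 'b) \<Rightarrow> 'a \<Rightarrow> 'b"
  where "scaleR_fun c f = (\<lambda>x. c *\<^sub>R f x)"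

instance
  by standard (auto simp: scaleR_fun_def fun_eq_iff scaleR_add_right scaleR_add_left)

end


section \<open>Smooth manifolds\<close>

(* R^n is the topological space Euclidean_space n, whose points are the maps nat => real that
   vanish from n on. Dimension 0 is included: a left-symmetric algebroid over a point is a
   left-symmetric algebra. *)

definition partial :: "nat \<Rightarrow> ((nat \<Rightarrow> real) \<Rightarrow> real) \<Rightarrow> (nat \<Rightarrow> real) \<Rightarrow> real"
  where "partial i f x = deriv (\<lambda>s. f (x(i := s))) (x i)"

primrec C_on :: "nat \<Rightarrow> nat \<Rightarrow> (nat \<Rightarrow> real) set \<Rightarrow> ((nat \<Rightarrow> real) \<Rightarrow> real) \<Rightarrow> bool"
  where
    "C_on n 0 S f \<longleftrightarrow> continuous_map (subtopology (Euclidean_space n) S) euclideanreal f"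
  | "C_on n (Suc k) S f \<longleftrightarrow> continuous_map (subtopology (Euclidean_space n) S) euclideanreal f \<and>
       (\<forall>i<n. (\<forall>x\<in>S. (\<lambda>s. f (x(i := s))) differentiable (at (x i))) \<and> C_on n k S (partial i f))"

(* C^infinity on an open subset S of R^n: all iterated partial derivatives exist and are
   continuous. *)
definition C_inf_on :: "nat \<Rightarrow> (nat \<Rightarrow> real) set \<Rightarrow> ((nat \<Rightarrow> real) \<Rightarrow> real) \<Rightarrow> bool"
  where "C_inf_on n S f \<longleftrightarrow> (\<forall>k. C_on n k S f)"

(* The points of the manifold are all elements of 'm; a chart is its domain with a coordinate
   map. *)
record 'm smooth_atlas =
  mdim :: nat
  charts :: "('m set \<times> ('m \<Rightarrow> nat \<Rightarrow> real)) set"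

definition smooth_manifold ::
    "'m::{t2_space, second_countable_topology} smooth_atlas \<Rightarrow> bool"
  where "smooth_manifold M \<longleftrightarrow>
    (\<forall>(U, x)\<in>charts M. open U \<and> openin (Euclidean_space (mdim M)) (x ` U) \<and>
       homeomorphic_map (top_of_set U) (subtopology (Euclidean_space (mdim M)) (x ` U)) x) \<and>
    (\<Union>(U, x)\<in>charts M. U) = UNIV \<and>
    (\<forall>(U, x)\<in>charts M. \<forall>(V, y)\<in>charts M. \<forall>i<mdim M.
       C_inf_on (mdim M) (x ` (U \<inter> V)) (\<lambda>c. y (inv_into U x c) i))"

definition smooth_fun_on :: "'m smooth_atlas \<Rightarrow> 'm set \<Rightarrow> ('m \<Rightarrow> real) \<Rightarrow> bool"
  where "smooth_fun_on M W f \<longleftrightarrow>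
    (\<forall>(U, x)\<in>charts M. C_inf_on (mdim M) (x ` (U \<inter> W)) (f \<circ> inv_into U x))"

abbreviation smooth_funs :: "'m smooth_atlas \<Rightarrow> ('m \<Rightarrow> real) set"
  where "smooth_funs M \<equiv> {f. smooth_fun_on M UNIV f}"


section \<open>Smooth vector bundles\<close>

(* The total space is the disjoint union of the fibres, which are subspaces of 'v. A local
   trivialisation over U is given by the frame e, i.e. by
   (p, c) |-> c_0 e_0(p) + ... + c_(r-1) e_(r-1)(p) from U x R^r to the restriction to U. *)
record ('m, 'v) vbundle =
  base :: "'m smooth_atlas"
  vrank :: nat
  fibre :: "'m \<Rightarrow> 'v set"
  frames :: "('m set \<times> (nat \<Rightarrow> 'm \<Rightarrow> 'v)) set"

definition smooth_section_on ::
    "('m, 'v::real_vector, 'z) vbundle_scheme \<Rightarrow> 'm set \<Rightarrow> ('m \<Rightarrow> 'v) \<Rightarrow> bool"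
  where "smooth_section_on E W s \<longleftrightarrow>
    (\<forall>p\<in>W. s p \<in> fibre E p) \<and>
    (\<forall>(U, e)\<in>frames E. \<exists>c. (\<forall>i<vrank E. smooth_fun_on (base E) (U \<inter> W) (c i)) \<and>
       (\<forall>p\<in>U \<inter> W. s p = (\<Sum>i<vrank E. c i p *\<^sub>R e i p)))"

definition vector_bundle ::
    "('m::{t2_space, second_countable_topology}, 'v::real_vector, 'z) vbundle_scheme \<Rightarrow> bool"
  where "vector_bundle E \<longleftrightarrow> smooth_manifold (base E) \<and>
    (\<forall>p. subspace (fibre E p)) \<and>
    (\<Union>(U, e)\<in>frames E. U) = UNIV \<and>
    (\<forall>(U, e)\<in>frames E. open U \<and>
       (\<forall>p\<in>U. inj_on (\<lambda>i. e i p) {..<vrank E} \<and> independent ((\<lambda>i. e i p) ` {..<vrank E}) \<and>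
              span ((\<lambda>i. e i p) ` {..<vrank E}) = fibre E p) \<and>
       (\<forall>i<vrank E. smooth_section_on E U (e i)))"

definition sections :: "('m, 'v::real_vector, 'z) vbundle_scheme \<Rightarrow> ('m \<Rightarrow> 'v) set"
  where "sections E = {s. smooth_section_on E UNIV s}"

definition fun_scale :: "('m \<Rightarrow> real) \<Rightarrow> ('m \<Rightarrow> 'v::real_vector) \<Rightarrow> 'm \<Rightarrow> 'v"
  where "fun_scale f s = (\<lambda>p. f p *\<^sub>R s p)"

definition bundle_map ::
    "('m, 'v::real_vector, 'y) vbundle_scheme \<Rightarrow> ('m, 'w::real_vector, 'z) vbundle_scheme \<Rightarrow>
     ('m \<Rightarrow> 'v \<Rightarrow> 'w) \<Rightarrow> bool"
  where "bundle_map E F a \<longleftrightarrow>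
    (\<forall>p. \<forall>u\<in>fibre E p. a p u \<in> fibre F p \<and> (\<forall>c. a p (c *\<^sub>R u) = c *\<^sub>R a p u) \<and>
         (\<forall>v\<in>fibre E p. a p (u + v) = a p u + a p v)) \<and>
    (\<forall>(U, e)\<in>frames E. \<forall>i<vrank E. smooth_section_on F U (\<lambda>p. a p (e i p)))"

(* Tangent vectors act on smooth functions; coord_vec M U x i p is the i-th coordinate vector at p
   in the chart (U, x). The value 0 off the smooth functions makes the fibres of the tangent
   bundle subspaces of the right dimension. *)
definition coord_vec ::
    "'m smooth_atlas \<Rightarrow> 'm set \<Rightarrow> ('m \<Rightarrow> nat \<Rightarrow> real) \<Rightarrow> nat \<Rightarrow> 'm \<Rightarrow> ('m \<Rightarrow> real) \<Rightarrow> real"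
  where "coord_vec M U x i p = (\<lambda>f.
    if f \<in> smooth_funs M then partial i (f \<circ> inv_into U x) (x p) else 0)"

definition tangent_bundle :: "'m smooth_atlas \<Rightarrow> ('m, ('m \<Rightarrow> real) \<Rightarrow> real) vbundle"
  where "tangent_bundle M = \<lparr>
    base = M,
    vrank = mdim M,
    fibre = (\<lambda>p. span {coord_vec M U x i p | U x i. (U, x) \<in> charts M \<and> p \<in> U \<and> i < mdim M}),
    frames = (\<lambda>(U, x). (U, coord_vec M U x)) ` charts M\<rparr>"

(* Covectors at p are extended by 0 outside the fibre. *)
definition dual_fibre :: "('m, 'v::real_vector, 'z) vbundle_scheme \<Rightarrow> 'm \<Rightarrow> ('v \<Rightarrow> real) set"
  where "dual_fibre E p = {\<xi>.
    (\<forall>u\<in>fibre E p. (\<forall>c. \<xi> (c *\<^sub>R u) = c * \<xi> u) \<and> (\<forall>v\<in>fibre E p. \<xi> (u + v) = \<xi> u + \<xi> v)) \<and>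
    (\<forall>v. v \<notin> fibre E p \<longrightarrow> \<xi> v = 0)}"

definition coframe ::
    "('m, 'v::real_vector, 'z) vbundle_scheme \<Rightarrow> (nat \<Rightarrow> 'm \<Rightarrow> 'v) \<Rightarrow> nat \<Rightarrow> 'm \<Rightarrow> 'v \<Rightarrow> real"
  where "coframe E e i p =
    (THE \<xi>. \<xi> \<in> dual_fibre E p \<and> (\<forall>j<vrank E. \<xi> (e j p) = (if i = j then 1 else 0)))"

definition dual_bundle ::
    "('m, 'v::real_vector, 'z) vbundle_scheme \<Rightarrow> ('m, 'v \<Rightarrow> real) vbundle"
  where "dual_bundle E = \<lparr>
    base = base E,
    vrank = vrank E,
    fibre = dual_fibre E,
    frames = (\<lambda>(U, e). (U, coframe E e)) ` frames E\<rparr>"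

definition pairing :: "('m \<Rightarrow> 'v \<Rightarrow> real) \<Rightarrow> ('m \<Rightarrow> 'v) \<Rightarrow> 'm \<Rightarrow> real"
  where "pairing \<xi> s = (\<lambda>p. \<xi> p (s p))"


section \<open>Tensor fields on the dual bundle\<close>

(* A field T takes a point p and a list of covectors at p. It is 0 on all other lists, so that
   equality of fields is equality of functions. *)
definition covecs ::
    "('m, 'v::real_vector, 'z) vbundle_scheme \<Rightarrow> nat \<Rightarrow> 'm \<Rightarrow> ('v \<Rightarrow> real) list set"
  where "covecs E k p = {\<alpha>s. length \<alpha>s = k \<and> set \<alpha>s \<subseteq> dual_fibre E p}"

(* Multilinear in k covectors and skew in the first j of them. *)
definition multilinear_field ::
    "('m, 'v::real_vector, 'z) vbundle_scheme \<Rightarrow> nat \<Rightarrow> nat \<Rightarrow>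
     ('m \<Rightarrow> ('v \<Rightarrow> real) list \<Rightarrow> 'w::real_vector) \<Rightarrow> bool"
  where "multilinear_field E k j T \<longleftrightarrow>
    (\<forall>p \<alpha>s. \<alpha>s \<notin> covecs E k p \<longrightarrow> T p \<alpha>s = 0) \<and>
    (\<forall>p. \<forall>\<alpha>s\<in>covecs E k p.
       (\<forall>i<k. \<forall>c. T p (\<alpha>s[i := c *\<^sub>R \<alpha>s ! i]) = c *\<^sub>R T p \<alpha>s) \<and>
       (\<forall>i<k. \<forall>\<xi>\<in>dual_fibre E p. T p (\<alpha>s[i := \<alpha>s ! i + \<xi>]) = T p \<alpha>s + T p (\<alpha>s[i := \<xi>])) \<and>
       (\<forall>i l. i < l \<and> l < j \<longrightarrow> T p (\<alpha>s[i := \<alpha>s ! l, l := \<alpha>s ! i]) = - T p \<alpha>s))"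

(* C^k_KV, the sections of (wedge^(k-1) E) tensor E *)
definition kv_cochains ::
    "('m, 'v::real_vector, 'z) vbundle_scheme \<Rightarrow> nat \<Rightarrow> ('m \<Rightarrow> ('v \<Rightarrow> real) list \<Rightarrow> real) set"
  where "kv_cochains E k = {\<phi>. multilinear_field E k (k - 1) \<phi> \<and>
    (\<forall>(U, e)\<in>frames E. \<forall>is. length is = k \<and> set is \<subseteq> {..<vrank E} \<longrightarrow>
       smooth_fun_on (base E) U (\<lambda>p. \<phi> p (map (\<lambda>i. coframe E e i p) is)))}"

(* C^k(E*, E), the sections of Hom(wedge^k E*, E) *)
definition hom_cochains ::
    "('m, 'v::real_vector, 'z) vbundle_scheme \<Rightarrow> nat \<Rightarrow> ('m \<Rightarrow> ('v \<Rightarrow> real) list \<Rightarrow> 'v) set"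
  where "hom_cochains E k = {P. multilinear_field E k k P \<and> (\<forall>p \<alpha>s. P p \<alpha>s \<in> fibre E p) \<and>
    (\<forall>(U, e)\<in>frames E. \<forall>is. length is = k \<and> set is \<subseteq> {..<vrank E} \<longrightarrow>
       smooth_section_on E U (\<lambda>p. P p (map (\<lambda>i. coframe E e i p) is)))}"

definition eval_field ::
    "('m \<Rightarrow> ('v \<Rightarrow> real) list \<Rightarrow> 'w) \<Rightarrow> ('m \<Rightarrow> 'v \<Rightarrow> real) list \<Rightarrow> 'm \<Rightarrow> 'w"
  where "eval_field T \<alpha>s = (\<lambda>p. T p (map (\<lambda>\<alpha>. \<alpha> p) \<alpha>s))"

definition Psi ::
    "('m, 'v::real_vector, 'z) vbundle_scheme \<Rightarrow> ('m \<Rightarrow> ('v \<Rightarrow> real) list \<Rightarrow> real) \<Rightarrow>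
     'm \<Rightarrow> ('v \<Rightarrow> real) list \<Rightarrow> 'v"
  where "Psi E \<phi> = (\<lambda>p \<alpha>s. THE v. v \<in> fibre E p \<and> (\<forall>\<beta>\<in>dual_fibre E p. \<beta> v = \<phi> p (\<alpha>s @ [\<beta>])))"

(* For H in C^2_KV, Psi H takes one covector and is the map H^sharp. *)
definition sharp ::
    "('m, 'v::real_vector, 'z) vbundle_scheme \<Rightarrow> ('m \<Rightarrow> ('v \<Rightarrow> real) list \<Rightarrow> real) \<Rightarrow>
     ('m \<Rightarrow> 'v \<Rightarrow> real) \<Rightarrow> 'm \<Rightarrow> 'v"
  where "sharp E H \<alpha> = eval_field (Psi E H) [\<alpha>]"

definition Sym2 ::
    "('m, 'v::real_vector, 'z) vbundle_scheme \<Rightarrow> ('m \<Rightarrow> ('v \<Rightarrow> real) list \<Rightarrow> real) set"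
  where "Sym2 E = {H \<in> kv_cochains E 2. \<forall>p \<alpha> \<beta>. H p [\<alpha>, \<beta>] = H p [\<beta>, \<alpha>]}"


section \<open>Left-symmetric algebroids\<close>

record ('m, 'v) lsalgebroid = "('m, 'v) vbundle" +
  lprod :: "('m \<Rightarrow> 'v) \<Rightarrow> ('m \<Rightarrow> 'v) \<Rightarrow> 'm \<Rightarrow> 'v"
  anchor :: "'m \<Rightarrow> 'v \<Rightarrow> ('m \<Rightarrow> real) \<Rightarrow> real"

definition anchor_act :: "('m, 'v) lsalgebroid \<Rightarrow> ('m \<Rightarrow> 'v) \<Rightarrow> ('m \<Rightarrow> real) \<Rightarrow> 'm \<Rightarrow> real"
  where "anchor_act A x f = (\<lambda>p. anchor A p (x p) f)"

definition left_symmetric_algebroid ::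
    "('m::{t2_space, second_countable_topology}, 'v::real_vector) lsalgebroid \<Rightarrow> bool"
  where "left_symmetric_algebroid A \<longleftrightarrow>
    vector_bundle A \<and> bundle_map A (tangent_bundle (base A)) (anchor A) \<and>
    (\<forall>x\<in>sections A. \<forall>y\<in>sections A. lprod A x y \<in> sections A \<and>
       (\<forall>c. lprod A (c *\<^sub>R x) y = c *\<^sub>R lprod A x y \<and> lprod A x (c *\<^sub>R y) = c *\<^sub>R lprod A x y) \<and>
       (\<forall>z\<in>sections A. lprod A (x + y) z = lprod A x z + lprod A y z \<and>
          lprod A z (x + y) = lprod A z x + lprod A z y \<and>
          lprod A x (lprod A y z) - lprod A (lprod A x y) z =
          lprod A y (lprod A x z) - lprod A (lprod A y x) z) \<and>
       (\<forall>f\<in>smooth_funs (base A).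
          lprod A x (fun_scale f y) =
            fun_scale f (lprod A x y) + fun_scale (anchor_act A x f) y \<and>
          lprod A (fun_scale f x) y = fun_scale f (lprod A x y)))"

definition sub_adj_bracket ::
    "('m, 'v::real_vector) lsalgebroid \<Rightarrow> ('m \<Rightarrow> 'v) \<Rightarrow> ('m \<Rightarrow> 'v) \<Rightarrow> 'm \<Rightarrow> 'v"
  where "sub_adj_bracket A x y = lprod A x y - lprod A y x"

definition L_op ::
    "('m, 'v::real_vector) lsalgebroid \<Rightarrow> ('m \<Rightarrow> 'v) \<Rightarrow> ('m \<Rightarrow> 'v \<Rightarrow> real) \<Rightarrow> 'm \<Rightarrow> 'v \<Rightarrow> real"
  where "L_op A x \<xi> = (THE \<eta>. \<eta> \<in> sections (dual_bundle A) \<and>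
    (\<forall>y\<in>sections A. pairing \<eta> y = anchor_act A x (pairing \<xi> y) - pairing \<xi> (lprod A x y)))"

definition R_op ::
    "('m, 'v::real_vector) lsalgebroid \<Rightarrow> ('m \<Rightarrow> 'v) \<Rightarrow> ('m \<Rightarrow> 'v \<Rightarrow> real) \<Rightarrow> 'm \<Rightarrow> 'v \<Rightarrow> real"
  where "R_op A x \<xi> = (THE \<eta>. \<eta> \<in> sections (dual_bundle A) \<and>
    (\<forall>y\<in>sections A. pairing \<eta> y = - pairing \<xi> (lprod A y x)))"


section \<open>Koszul-Vinberg structures\<close>

(* The expression [H, H], with the first and the second occurrence of H in each term made
   independent. Only [H, H] is a notion of its own; the polarisation serves to extend [H, H] to
   formal power series. *)
definition KV_expr ::
    "('m, 'v::real_vector) lsalgebroid \<Rightarrow> ('m \<Rightarrow> ('v \<Rightarrow> real) list \<Rightarrow> real) \<Rightarrow>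
     ('m \<Rightarrow> ('v \<Rightarrow> real) list \<Rightarrow> real) \<Rightarrow>
     ('m \<Rightarrow> 'v \<Rightarrow> real) \<Rightarrow> ('m \<Rightarrow> 'v \<Rightarrow> real) \<Rightarrow> ('m \<Rightarrow> 'v \<Rightarrow> real) \<Rightarrow> 'm \<Rightarrow> real"
  where "KV_expr A H K \<alpha>1 \<alpha>2 \<alpha>3 =
      anchor_act A (sharp A H \<alpha>1) (pairing \<alpha>3 (sharp A K \<alpha>2))
    - anchor_act A (sharp A H \<alpha>2) (pairing \<alpha>3 (sharp A K \<alpha>1))
    + pairing \<alpha>1 (lprod A (sharp A H \<alpha>2) (sharp A K \<alpha>3))
    - pairing \<alpha>2 (lprod A (sharp A H \<alpha>1) (sharp A K \<alpha>3))
    - pairing \<alpha>3 (sub_adj_bracket A (sharp A H \<alpha>1) (sharp A K \<alpha>2))"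

definition koszul_vinberg ::
    "('m, 'v::real_vector) lsalgebroid \<Rightarrow> ('m \<Rightarrow> ('v \<Rightarrow> real) list \<Rightarrow> real) \<Rightarrow> bool"
  where "koszul_vinberg A H \<longleftrightarrow> H \<in> Sym2 A \<and>
    (\<forall>\<alpha>1\<in>sections (dual_bundle A). \<forall>\<alpha>2\<in>sections (dual_bundle A). \<forall>\<alpha>3\<in>sections (dual_bundle A).
       KV_expr A H H \<alpha>1 \<alpha>2 \<alpha>3 = 0)"


section \<open>The graded Lie bracket and the cohomology\<close>

(* ns lists the block lengths; everything is indexed from 0. *)
definition unshuffles :: "nat list \<Rightarrow> (nat \<Rightarrow> nat) set"
  where "unshuffles ns = {\<sigma>. \<sigma> permutes {..<sum_list ns} \<and>
    (\<forall>b<length ns. strict_mono_on {sum_list (take b ns)..<sum_list (take (Suc b) ns)} \<sigma>)}"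

(* The right-hand side of the formula for [[P, Q]], P in C^n(A*, A), Q in C^m(A*, A), on a list of
   m + n sections of A*. The two tests for 0 are the convention on blocks of length -1. *)
definition hom_bracket_expr ::
    "('m, 'v::real_vector) lsalgebroid \<Rightarrow> nat \<Rightarrow> ('m \<Rightarrow> ('v \<Rightarrow> real) list \<Rightarrow> 'v) \<Rightarrow>
     nat \<Rightarrow> ('m \<Rightarrow> ('v \<Rightarrow> real) list \<Rightarrow> 'v) \<Rightarrow> ('m \<Rightarrow> 'v \<Rightarrow> real) list \<Rightarrow> 'm \<Rightarrow> 'v"
  where "hom_bracket_expr A n P m Q \<alpha>s =
    (let args = (\<lambda>\<sigma> i j. map (\<lambda>l. \<alpha>s ! \<sigma> l) [i..<j]) in
      (if n = 0 then 0 else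
         \<Sum>\<sigma>\<in>unshuffles [m, 1, n - 1]. of_int (sign \<sigma>) *\<^sub>R
           eval_field P (L_op A (eval_field Q (args \<sigma> 0 m)) (\<alpha>s ! \<sigma> m) # args \<sigma> (m + 1) (m + n)))
    - (-1) ^ (m * n) *\<^sub>R
      (if m = 0 then 0 else
         \<Sum>\<sigma>\<in>unshuffles [n, 1, m - 1]. of_int (sign \<sigma>) *\<^sub>R
           eval_field Q (L_op A (eval_field P (args \<sigma> 0 n)) (\<alpha>s ! \<sigma> n) # args \<sigma> (n + 1) (m + n)))
    + (-1) ^ (m * n) *\<^sub>R
      (\<Sum>\<sigma>\<in>unshuffles [n, m]. of_int (sign \<sigma>) *\<^sub>R
         sub_adj_bracket A (eval_field P (args \<sigma> 0 n)) (eval_field Q (args \<sigma> n (m + n)))))"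

definition hom_bracket ::
    "('m, 'v::real_vector) lsalgebroid \<Rightarrow> nat \<Rightarrow> ('m \<Rightarrow> ('v \<Rightarrow> real) list \<Rightarrow> 'v) \<Rightarrow>
     nat \<Rightarrow> ('m \<Rightarrow> ('v \<Rightarrow> real) list \<Rightarrow> 'v) \<Rightarrow> 'm \<Rightarrow> ('v \<Rightarrow> real) list \<Rightarrow> 'v"
  where "hom_bracket A n P m Q = (THE S. S \<in> hom_cochains A (m + n) \<and>
    (\<forall>\<alpha>s. length \<alpha>s = m + n \<and> set \<alpha>s \<subseteq> sections (dual_bundle A) \<longrightarrow>
       eval_field S \<alpha>s = hom_bracket_expr A n P m Q \<alpha>s))"

(* Here n and m are degrees: phi is in C^(n+1)_KV and psi is in C^(m+1)_KV. *)
definition kv_bracket ::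
    "('m, 'v::real_vector) lsalgebroid \<Rightarrow> nat \<Rightarrow> ('m \<Rightarrow> ('v \<Rightarrow> real) list \<Rightarrow> real) \<Rightarrow>
     nat \<Rightarrow> ('m \<Rightarrow> ('v \<Rightarrow> real) list \<Rightarrow> real) \<Rightarrow> 'm \<Rightarrow> ('v \<Rightarrow> real) list \<Rightarrow> real"
  where "kv_bracket A n \<phi> m \<psi> =
    inv_into (kv_cochains A (m + n + 1)) (Psi A) (hom_bracket A n (Psi A \<phi>) m (Psi A \<psi>))"

definition kv_delta ::
    "('m, 'v::real_vector) lsalgebroid \<Rightarrow> ('m \<Rightarrow> ('v \<Rightarrow> real) list \<Rightarrow> real) \<Rightarrow> nat \<Rightarrow>
     ('m \<Rightarrow> ('v \<Rightarrow> real) list \<Rightarrow> real) \<Rightarrow> 'm \<Rightarrow> ('v \<Rightarrow> real) list \<Rightarrow> real"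
  where "kv_delta A H k \<phi> = (-1) ^ (k - 1) *\<^sub>R kv_bracket A 1 H (k - 1) \<phi>"

(* The identification of sections of A with elements of C^1_KV. *)
definition vec_cochain ::
    "('m, 'v::real_vector) lsalgebroid \<Rightarrow> ('m \<Rightarrow> 'v) \<Rightarrow> 'm \<Rightarrow> ('v \<Rightarrow> real) list \<Rightarrow> real"
  where "vec_cochain A x = (\<lambda>p \<alpha>s. if \<alpha>s \<in> covecs A 1 p then hd \<alpha>s (x p) else 0)"

definition tilde_cochains ::
    "('m, 'v::real_vector) lsalgebroid \<Rightarrow> ('m \<Rightarrow> ('v \<Rightarrow> real) list \<Rightarrow> real) \<Rightarrow> nat \<Rightarrow>
     ('m \<Rightarrow> ('v \<Rightarrow> real) list \<Rightarrow> real) set"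
  where "tilde_cochains A H k =
    (if k = 1 then
       vec_cochain A ` {x \<in> sections A.
         \<forall>\<alpha>1\<in>sections (dual_bundle A). \<forall>\<alpha>2\<in>sections (dual_bundle A).
           eval_field H [R_op A x \<alpha>1, \<alpha>2] = eval_field H [\<alpha>1, R_op A x \<alpha>2]}
     else if k = 2 then {\<phi> \<in> kv_cochains A 2. \<forall>p \<alpha>1 \<alpha>2. \<phi> p [\<alpha>1, \<alpha>2] = \<phi> p [\<alpha>2, \<alpha>1]}
     else if k = 3 then {\<phi> \<in> kv_cochains A 3. \<forall>p \<alpha>1 \<alpha>2 \<alpha>3.
         \<phi> p [\<alpha>1, \<alpha>2, \<alpha>3] + \<phi> p [\<alpha>2, \<alpha>3, \<alpha>1] + \<phi> p [\<alpha>3, \<alpha>1, \<alpha>2] = 0}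
     else kv_cochains A k)"

definition tilde_cocycles ::
    "('m, 'v::real_vector) lsalgebroid \<Rightarrow> ('m \<Rightarrow> ('v \<Rightarrow> real) list \<Rightarrow> real) \<Rightarrow> nat \<Rightarrow>
     ('m \<Rightarrow> ('v \<Rightarrow> real) list \<Rightarrow> real) set"
  where "tilde_cocycles A H k = {\<phi> \<in> tilde_cochains A H k. kv_delta A H k \<phi> = 0}"

(* The complex starts in degree k = 1. *)
definition tilde_coboundaries ::
    "('m, 'v::real_vector) lsalgebroid \<Rightarrow> ('m \<Rightarrow> ('v \<Rightarrow> real) list \<Rightarrow> real) \<Rightarrow> nat \<Rightarrow>
     ('m \<Rightarrow> ('v \<Rightarrow> real) list \<Rightarrow> real) set"
  where "tilde_coboundaries A H k =
    (if k \<le> 1 then {0} else kv_delta A H (k - 1) ` tilde_cochains A H (k - 1))"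

definition cohomologous ::
    "('m, 'v::real_vector) lsalgebroid \<Rightarrow> ('m \<Rightarrow> ('v \<Rightarrow> real) list \<Rightarrow> real) \<Rightarrow> nat \<Rightarrow>
     (('m \<Rightarrow> ('v \<Rightarrow> real) list \<Rightarrow> real) \<times> ('m \<Rightarrow> ('v \<Rightarrow> real) list \<Rightarrow> real)) set"
  where "cohomologous A H k = {(\<phi>, \<psi>). \<phi> \<in> tilde_cocycles A H k \<and> \<psi> \<in> tilde_cocycles A H k \<and>
    \<phi> - \<psi> \<in> tilde_coboundaries A H k}"

definition tilde_cohomology ::
    "('m, 'v::real_vector) lsalgebroid \<Rightarrow> ('m \<Rightarrow> ('v \<Rightarrow> real) list \<Rightarrow> real) \<Rightarrow> nat \<Rightarrow>
     ('m \<Rightarrow> ('v \<Rightarrow> real) list \<Rightarrow> real) set set"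
  where "tilde_cohomology A H k = tilde_cocycles A H k // cohomologous A H k"


section \<open>Deformations\<close>

(* A formal power series is its sequence of coefficients; an order n deformation is a polynomial
   of degree at most n. The sum below is the coefficient of t^k in [Ht, Ht]. *)
definition deformations ::
    "('m, 'v::real_vector) lsalgebroid \<Rightarrow> ('m \<Rightarrow> ('v \<Rightarrow> real) list \<Rightarrow> real) \<Rightarrow> nat \<Rightarrow>
     (nat \<Rightarrow> 'm \<Rightarrow> ('v \<Rightarrow> real) list \<Rightarrow> real) set"
  where "deformations A H n = {Ht. Ht 0 = H \<and> (\<forall>i\<le>n. Ht i \<in> Sym2 A) \<and> (\<forall>i>n. Ht i = 0) \<and>
    (\<forall>k\<le>n. \<forall>\<alpha>1\<in>sections (dual_bundle A). \<forall>\<alpha>2\<in>sections (dual_bundle A).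
       \<forall>\<alpha>3\<in>sections (dual_bundle A).
         (\<Sum>i\<le>k. KV_expr A (Ht i) (Ht (k - i)) \<alpha>1 \<alpha>2 \<alpha>3) = 0)}"

(* ad of a series with coefficients in the sections of A, acting on series with coefficients in
   C^(m+1)_KV *)
definition ad_series ::
    "('m, 'v::real_vector) lsalgebroid \<Rightarrow> (nat \<Rightarrow> 'm \<Rightarrow> 'v) \<Rightarrow> nat \<Rightarrow>
     (nat \<Rightarrow> 'm \<Rightarrow> ('v \<Rightarrow> real) list \<Rightarrow> real) \<Rightarrow> nat \<Rightarrow> 'm \<Rightarrow> ('v \<Rightarrow> real) list \<Rightarrow> real"
  where "ad_series A X m \<Phi> = (\<lambda>k. \<Sum>i\<le>k. kv_bracket A 0 (vec_cochain A (X i)) m (\<Phi> (k - i)))"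

(* For X 0 = 0, ad raises the order in t, so the coefficient of t^k in the exponential series only
   involves the powers ad^j with j <= k. *)
definition exp_ad_series ::
    "('m, 'v::real_vector) lsalgebroid \<Rightarrow> (nat \<Rightarrow> 'm \<Rightarrow> 'v) \<Rightarrow> nat \<Rightarrow>
     (nat \<Rightarrow> 'm \<Rightarrow> ('v \<Rightarrow> real) list \<Rightarrow> real) \<Rightarrow> nat \<Rightarrow> 'm \<Rightarrow> ('v \<Rightarrow> real) list \<Rightarrow> real"
  where "exp_ad_series A X m \<Phi> =
    (\<lambda>k. \<Sum>j\<le>k. (1 / fact j) *\<^sub>R ((ad_series A X m ^^ j) \<Phi>) k)"

definition equivalent_deformations ::
    "('m, 'v::real_vector) lsalgebroid \<Rightarrow> ('m \<Rightarrow> ('v \<Rightarrow> real) list \<Rightarrow> real) \<Rightarrow> nat \<Rightarrow>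
     ((nat \<Rightarrow> 'm \<Rightarrow> ('v \<Rightarrow> real) list \<Rightarrow> real) \<times> (nat \<Rightarrow> 'm \<Rightarrow> ('v \<Rightarrow> real) list \<Rightarrow> real)) set"
  where "equivalent_deformations A H n =
    {(Ht, Ht'). Ht \<in> deformations A H n \<and> Ht' \<in> deformations A H n \<and>
       (\<exists>X. X 0 = 0 \<and> (\<forall>i. X i \<in> sections A) \<and>
            (\<forall>k\<le>n. exp_ad_series A X 1 Ht k = Ht' k))}"

end

(* A deformation of order 1 is determined by its linear term K, and the deformation equation modulo
   t^2 is the polarisation of [H, H] = 0 in the directions H and K. For symmetric H and K this
   polarisation is the pairing of [[H, K]] with a third covector, so it says that delta K = 0.
   Modulo t^2, exp(ad_X) H_t is H + t (K - [[H, x_1]]). The antisymmetric part of [[H, x]] is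
   H(R_x alpha, beta) - H(alpha, R_x beta); hence the x for which [[H, x]] is symmetric are the ones
   that occur in the subcomplex, and equivalent deformations correspond to cohomologous cocycles.

   The brackets, L and R are defined by their values on global sections. That they exist as tensor
   fields is the usual tensoriality argument: an expression that is linear over the smooth functions
   depends on the values of the sections at the point only, by means of bump functions. *)
theory Submission
  imports Defs
begin

section \<open>Smooth functions on open subsets of Euclidean space\<close>

text \<open>The L-terms and the commutator terms of a bracket are not linear over the smooth
  functions one by one. Their defects are terms a(x)(f), and the terms have to be paired so that
  these defects cancel. The cancellation uses that a(x) is a derivation which preserves smooth
  functions, while the anchor is only given as a bundle map. Instead of a computation in charts, the
  derivation rules are read off from x * (f x) and the Leibniz rule of the product, and smoothness
  of a(x)(f) from a coefficient of a section.

  The two sides of the correspondence differ in the admissible x: an equivalence may use any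
  section, a coboundary only those in the subcomplex. The linear terms of two deformations are both
  symmetric, so a relation K - K' = [[H, x]] between them forces [[H, x]] to be symmetric, and x
  lies in the subcomplex automatically.\<close>

text \<open>The product topology on \<open>nat \<Rightarrow> real\<close> is the topology of the
  type class, so \<open>continuous_on\<close> and its rules become available for subsets of
  \<open>Euclidean_space n\<close>.\<close>

lemma Euclidean_space_eq_top_of_set: "Euclidean_space n = top_of_set {x. \<forall>i\<ge>n. x i = 0}"
  by (simp add: Euclidean_space_def euclidean_product_topology)

lemma continuous_map_Euclidean_subspace_iff:
  assumes "openin (Euclidean_space n) S"
  shows "continuous_map (subtopology (Euclidean_space n) S) euclideanreal f \<longleftrightarrow> continuous_on S f"
proof -
  have "S \<subseteq> {x. \<forall>i\<ge>n. x i = 0}"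
    using openin_subset[OF assms] by (simp add: topspace_Euclidean_space)
  then have "subtopology (Euclidean_space n) S = top_of_set S"
    by (simp add: Euclidean_space_eq_top_of_set subtopology_subtopology Int_absorb1)
  then show ?thesis by simp
qed

text \<open>Differentiability in direction i only looks along the line \<open>x(i := s)\<close>.
  Since i < n, this line stays in the Euclidean space, and near x it stays in S.\<close>

lemma eventually_upd_in:
  fixes x :: "nat \<Rightarrow> real"
  assumes "openin (Euclidean_space n) S" "x \<in> S" "i < n"
  shows "eventually (\<lambda>s. x(i := s) \<in> S) (nhds (x i))"
proof -
  obtain T where T: "open T" "S = {x. \<forall>i\<ge>n. x i = 0} \<inter> T"
    using assms(1) by (auto simp: Euclidean_space_eq_top_of_set openin_open)
  have cont: "continuous_on UNIV (\<lambda>s. x(i := s))"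
  proof (rule continuous_on_coordinatewise_then_product)
    fix j show "continuous_on UNIV (\<lambda>s. (x(i := s)) j)"
      by (cases "j = i") (auto intro: continuous_intros)
  qed
  have "open ((\<lambda>s. x(i := s)) -` T)"
    using cont T(1) open_vimage by blast
  moreover have "x i \<in> (\<lambda>s. x(i := s)) -` T" using assms(2) T by simp
  ultimately have "eventually (\<lambda>s. s \<in> (\<lambda>s. x(i := s)) -` T) (nhds (x i))"
    by (rule eventually_nhds_in_open)
  then show ?thesis
    by (rule eventually_mono) (use T assms in auto)
qed

lemma partial_cong:
  assumes "openin (Euclidean_space n) S" "x \<in> S" "i < n" "\<And>y. y \<in> S \<Longrightarrow> f y = g y"
  shows "partial i f x = partial i g x"
  unfolding partial_def
  by (rule deriv_cong_ev) (use eventually_mono[OF eventually_upd_in[OF assms(1-3)]] assms(4) in auto)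

lemma differentiable_upd_cong:
  fixes f g :: "(nat \<Rightarrow> real) \<Rightarrow> real"
  assumes "openin (Euclidean_space n) S" "x \<in> S" "i < n" "\<And>y. y \<in> S \<Longrightarrow> f y = g y"
    "(\<lambda>s. f (x(i := s))) differentiable (at (x i))"
  shows "(\<lambda>s. g (x(i := s))) differentiable (at (x i))"
proof -
  obtain D where D: "((\<lambda>s. f (x(i := s))) has_real_derivative D) (at (x i))"
    using assms(5) by (auto simp: real_differentiable_def)
  have "eventually (\<lambda>s. f (x(i := s)) = g (x(i := s))) (nhds (x i))"
    by (rule eventually_mono[OF eventually_upd_in[OF assms(1-3)]]) (use assms(4) in auto)
  then have "((\<lambda>s. g (x(i := s))) has_real_derivative D) (at (x i))"
    by (rule DERIV_cong_ev[OF refl _ refl, THEN iffD1, OF _ D])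
  then show ?thesis by (auto simp: real_differentiable_def)
qed

text \<open>\<open>partial\<close> differentiates a function on all of
  \<open>nat \<Rightarrow> real\<close>; it is the openness of S that makes the result depend on the
  values on S alone. Local representatives \<open>f \<circ> inv_into U x\<close> carry arbitrary
  values off the chart image.\<close>

lemma C_on_cong:
  assumes "openin (Euclidean_space n) S" "\<And>x. x \<in> S \<Longrightarrow> f x = g x" "C_on n k S f"
  shows "C_on n k S g"
  using assms(2,3)
proof (induction k arbitrary: f g)
  case 0
  have "continuous_on S f = continuous_on S g"
    by (rule continuous_on_cong) (use 0 in auto)
  then show ?case using 0 assms(1) by (simp add: continuous_map_Euclidean_subspace_iff)
next
  case (Suc k)
  have "continuous_on S f = continuous_on S g"
    by (rule continuous_on_cong) (use Suc in auto)
  moreover have "C_on n k S (partial i g)" if "i < n" for i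
  proof (rule Suc.IH)
    show "partial i f x = partial i g x" if "x \<in> S" for x
      using assms(1) that \<open>i < n\<close> Suc.prems(1) by (rule partial_cong)
    show "C_on n k S (partial i f)" using Suc.prems(2) that by simp
  qed
  moreover have "(\<lambda>s. g (x(i := s))) differentiable (at (x i))" if "i < n" "x \<in> S" for i x
  proof (rule differentiable_upd_cong[OF assms(1) that(2,1) Suc.prems(1)])
    show "(\<lambda>s. f (x(i := s))) differentiable (at (x i))"
      using Suc.prems(2) that unfolding C_on.simps by blast
  qed
  ultimately show ?case using Suc.prems assms(1)
    unfolding C_on.simps by (simp only: continuous_map_Euclidean_subspace_iff) blast
qed

lemma C_on_SucD: "C_on n (Suc k) S f \<Longrightarrow> C_on n k S f"
proof (induction k arbitrary: f)
  case (Suc k)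
  then show ?case unfolding C_on.simps(2)[of n "Suc k"] C_on.simps(2)[of n k S f] by blast
qed (simp only: C_on.simps)

lemma C_on_subset: "T \<subseteq> S \<Longrightarrow> C_on n k S f \<Longrightarrow> C_on n k T f"
proof (induction k arbitrary: f)
  case 0
  then show ?case by (simp add: continuous_map_from_subtopology_mono)
next
  case (Suc k)
  then show ?case
    unfolding C_on.simps by (meson continuous_map_from_subtopology_mono subsetD)
qed

lemma C_on_local:
  assumes "openin (Euclidean_space n) S"
    and "\<And>x. x \<in> S \<Longrightarrow> \<exists>T. openin (Euclidean_space n) T \<and> x \<in> T \<and> C_on n k (T \<inter> S) f"
  shows "C_on n k S f"
proof -
  have cont: "continuous_on S f"
    if loc: "\<And>x. x \<in> S \<Longrightarrow> \<exists>T. openin (Euclidean_space n) T \<and> x \<in> T \<and> continuous_on (T \<inter> S) f"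
    for f :: "(nat \<Rightarrow> real) \<Rightarrow> real"
    unfolding continuous_on_eq_continuous_within
  proof
    fix x assume x: "x \<in> S"
    then obtain T where T: "openin (Euclidean_space n) T" "x \<in> T" "continuous_on (T \<inter> S) f"
      using loc by blast
    obtain T' where T': "open T'" "T = {x. \<forall>i\<ge>n. x i = 0} \<inter> T'"
      using T(1) by (auto simp: Euclidean_space_eq_top_of_set openin_open)
    have "S \<subseteq> {x. \<forall>i\<ge>n. x i = 0}"
      using openin_subset[OF assms(1)] by (simp add: topspace_Euclidean_space)
    \<comment> \<open>T is the trace of the open set T' on the Euclidean space, which contains S;
      hence T and T' cut out the same part of S.\<close>
    then have "at x within S = at x within (T \<inter> S)"
      by (intro at_within_nhd[of _ T']) (use T T' in auto)
    then show "continuous (at x within S) f"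
      using T x by (auto simp: continuous_on_eq_continuous_within continuous_within)
  qed
  show ?thesis
    using assms(2)
  proof (induction k arbitrary: f)
    case 0
    have "continuous_on S f"
    proof (rule cont)
      fix x assume "x \<in> S"
      then obtain T where "openin (Euclidean_space n) T" "x \<in> T" "C_on n 0 (T \<inter> S) f"
        using 0 by blast
      then show "\<exists>T. openin (Euclidean_space n) T \<and> x \<in> T \<and> continuous_on (T \<inter> S) f"
        using assms(1) by (auto simp: continuous_map_Euclidean_subspace_iff openin_Int)
    qed
    then show ?case using assms(1) by (simp add: continuous_map_Euclidean_subspace_iff)
  next
    case (Suc k)
    have "C_on n k S f"
    proof (rule Suc.IH)
      fix x assume "x \<in> S"
      then obtain T where "openin (Euclidean_space n) T" "x \<in> T" "C_on n (Suc k) (T \<inter> S) f"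
        using Suc.prems by metis
      then show "\<exists>T. openin (Euclidean_space n) T \<and> x \<in> T \<and> C_on n k (T \<inter> S) f"
        using C_on_SucD[of n k "T \<inter> S" f] by (intro exI[of _ T]) simp
    qed
    then have "continuous_map (subtopology (Euclidean_space n) S) euclideanreal f"
      by (cases k) auto
    moreover have "C_on n k S (partial i f)" if "i < n" for i
    proof (rule Suc.IH)
      fix x assume "x \<in> S"
      then show "\<exists>T. openin (Euclidean_space n) T \<and> x \<in> T \<and> C_on n k (T \<inter> S) (partial i f)"
        using Suc.prems[of x] that unfolding C_on.simps by blast
    qed
    moreover have "(\<lambda>s. f (x(i := s))) differentiable (at (x i))" if "i < n" "x \<in> S" for i x
      using Suc.prems[OF that(2)] that unfolding C_on.simps by blast
    ultimately show ?case unfolding C_on.simps by blast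
  qed
qed

section \<open>Closure of C^k under sums, products and composition\<close>

lemma C_on_const: "openin (Euclidean_space n) S \<Longrightarrow> C_on n k S (\<lambda>_. c)"
proof (induction k arbitrary: c)
  case (Suc k)
  moreover have "partial i (\<lambda>_. c) = (\<lambda>_. 0)" for i by (simp add: partial_def fun_eq_iff)
  ultimately show ?case by simp
qed simp

lemma partial_has_derivative:
  assumes "(\<lambda>s. f (x(i := s))) differentiable (at (x i))"
  shows "((\<lambda>s. f (x(i := s))) has_real_derivative partial i f x) (at (x i))"
  using assms unfolding partial_def
  by (metis DERIV_imp_deriv real_differentiable_def)

lemma C_on_Suc_imp_differentiable:
  "C_on n (Suc k) S f \<Longrightarrow> i < n \<Longrightarrow> x \<in> S \<Longrightarrow>
    (\<lambda>s. f (x(i := s))) differentiable (at (x i))"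
  unfolding C_on.simps by blast

text \<open>The differentiation rules produce a formula D i for the derivative at points of S,
  whereas \<open>C_on\<close> speaks of \<open>partial i f\<close>. The two agree on S, and that
  suffices.\<close>

lemma C_on_SucI:
  assumes S: "openin (Euclidean_space n) S" and "continuous_on S f"
    and der: "\<And>i x. i < n \<Longrightarrow> x \<in> S \<Longrightarrow> ((\<lambda>s. f (x(i := s))) has_real_derivative D i x) (at (x i))"
    and D: "\<And>i. i < n \<Longrightarrow> C_on n k S (D i)"
  shows "C_on n (Suc k) S f"
proof -
  have "C_on n k S (partial i f)" if "i < n" for i
    by (rule C_on_cong[OF S _ D[OF that]])
      (use der[OF that] in \<open>auto simp: partial_def intro!: DERIV_imp_deriv[symmetric]\<close>)
  moreover have "(\<lambda>s. f (x(i := s))) differentiable (at (x i))" if "i < n" "x \<in> S" for i x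
    using der[OF that] unfolding real_differentiable_def by blast
  ultimately show ?thesis using assms(2)
    unfolding C_on.simps continuous_map_Euclidean_subspace_iff[OF S] by blast
qed

lemma C_on_continuous_on:
  assumes "openin (Euclidean_space n) S" "C_on n k S f"
  shows "continuous_on S f"
  using assms by (cases k) (auto simp: continuous_map_Euclidean_subspace_iff)

lemma C_on_add:
  assumes S: "openin (Euclidean_space n) S" and "C_on n k S f" "C_on n k S g"
  shows "C_on n k S (\<lambda>x. f x + g x)"
  using assms(2,3)
proof (induction k arbitrary: f g)
  case 0
  then show ?case using S by (auto simp: continuous_map_Euclidean_subspace_iff intro: continuous_intros)
next
  case (Suc k)
  note d = Suc.prems[THEN C_on_Suc_imp_differentiable, THEN partial_has_derivative]
  show ?case
  proof (rule C_on_SucI[OF S])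
    show "continuous_on S (\<lambda>x. f x + g x)"
      by (intro continuous_intros) (use Suc.prems C_on_continuous_on S in blast)+
    show "((\<lambda>s. f (x(i := s)) + g (x(i := s))) has_real_derivative partial i f x + partial i g x) (at (x i))"
      if "i < n" "x \<in> S" for i x
      by (intro DERIV_add d that)
    show "C_on n k S (\<lambda>x. partial i f x + partial i g x)" if "i < n" for i
      by (rule Suc.IH) (use Suc.prems that in auto)
  qed
qed

lemma C_on_mult:
  assumes S: "openin (Euclidean_space n) S" and "C_on n k S f" "C_on n k S g"
  shows "C_on n k S (\<lambda>x. f x * g x)"
  using assms(2,3)
proof (induction k arbitrary: f g)
  case 0
  then show ?case using S by (auto simp: continuous_map_Euclidean_subspace_iff intro: continuous_intros)
next
  case (Suc k)
  note d = Suc.prems[THEN C_on_Suc_imp_differentiable, THEN partial_has_derivative]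
  show ?case
  proof (rule C_on_SucI[OF S])
    show "continuous_on S (\<lambda>x. f x * g x)"
      by (intro continuous_intros) (use Suc.prems C_on_continuous_on S in blast)+
    show "((\<lambda>s. f (x(i := s)) * g (x(i := s))) has_real_derivative
        partial i f x * g x + partial i g x * f x) (at (x i))"
      if "i < n" "x \<in> S" for i x
      \<comment> \<open>The rule leaves the base point in the form \<open>x(i := x i)\<close>, which
        \<open>fun_upd_triv\<close> reduces to x.\<close>
      using DERIV_mult[OF d(1)[OF that] d(2)[OF that]] by (simp only: fun_upd_triv)
    show "C_on n k S (\<lambda>x. partial i f x * g x + partial i g x * f x)" if "i < n" for i
      by (intro C_on_add[OF S] Suc.IH) (use Suc.prems that C_on_SucD in auto)
  qed
qed

text \<open>G is the sequence of all derivatives of g. With it the chain rule can be proved for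
  every \<open>G j\<close> at once, as differentiating \<open>G j (f x)\<close> leads to
  \<open>G (Suc j)\<close>.\<close>

definition smooth_real :: "(real \<Rightarrow> real) \<Rightarrow> bool"
  where "smooth_real g \<longleftrightarrow> (\<exists>G. G 0 = g \<and> (\<forall>k x. (G k has_real_derivative G (Suc k) x) (at x)))"

lemma C_on_compose:
  assumes S: "openin (Euclidean_space n) S" and "smooth_real g" "C_on n k S f"
  shows "C_on n k S (\<lambda>x. g (f x))"
proof -
  obtain G where G: "G 0 = g" "\<And>k x. (G k has_real_derivative G (Suc k) x) (at x)"
    using assms(2) by (auto simp: smooth_real_def)
  have cont: "continuous_on S (\<lambda>x. G j (f x))" if "continuous_on S f" for j f
  proof -
    have "continuous_on UNIV (G j)" using G(2) by (meson DERIV_continuous_on has_field_derivative_at_within)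
    then show ?thesis using that continuous_on_compose2 by blast
  qed
  have "C_on n k S (\<lambda>x. G j (f x))" for j
    using assms(3)
  proof (induction k arbitrary: j)
    case 0
    then show ?case using S cont by (auto simp: continuous_map_Euclidean_subspace_iff)
  next
    case (Suc k)
    note d = Suc.prems[THEN C_on_Suc_imp_differentiable, THEN partial_has_derivative]
    show ?case
    proof (rule C_on_SucI[OF S])
      show "continuous_on S (\<lambda>x. G j (f x))"
        using cont Suc.prems C_on_continuous_on S by blast
      show "((\<lambda>s. G j (f (x(i := s)))) has_real_derivative G (Suc j) (f x) * partial i f x) (at (x i))"
        if "i < n" "x \<in> S" for i x
        using DERIV_chain2[OF G(2)[of j "f (x(i := x i))"] d[OF that]] by (simp only: fun_upd_triv)
      show "C_on n k S (\<lambda>x. G (Suc j) (f x) * partial i f x)" if "i < n" for i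
        by (intro C_on_mult[OF S] Suc.IH) (use Suc.prems that C_on_SucD in auto)
    qed
  qed
  then show ?thesis using G(1) by metis
qed

section \<open>A flat function\<close>

text \<open>In the variable t = 1 / x one has d/dx = - t^2 d/dt, so p(t) exp(- t) has the derivative
  t^2 (p(t) - p'(t)) exp(- t).\<close>

primrec flat_poly :: "nat \<Rightarrow> real poly"
  where
    "flat_poly 0 = 1"
  | "flat_poly (Suc k) = [:0, 0, 1:] * (flat_poly k - pderiv (flat_poly k))"

(* The k-th derivative of exp (- 1 / x), extended by 0 to x <= 0. *)
definition flat :: "nat \<Rightarrow> real \<Rightarrow> real"
  where "flat k x = (if x > 0 then poly (flat_poly k) (1 / x) * exp (- (1 / x)) else 0)"

lemma poly_exp_tendsto_0: "((\<lambda>t. poly p t * exp (- t)) \<longlongrightarrow> (0 :: real)) at_top"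
proof -
  have "((\<lambda>t. \<Sum>i\<le>degree p. coeff p i * (t ^ i / exp t)) \<longlongrightarrow> (\<Sum>i\<le>degree p. coeff p i * 0)) at_top"
    by (intro tendsto_intros tendsto_power_div_exp_0)
  then show ?thesis
    by (simp add: poly_altdef sum_distrib_right exp_minus divide_inverse mult.assoc)
qed

lemma flat_has_derivative: "(flat k has_real_derivative flat (Suc k) x) (at x)"
proof -
  consider "x > 0" | "x < 0" | "x = 0" by linarith
  then show ?thesis
  proof cases
    case 1
    have inv: "((\<lambda>x. 1 / x) has_real_derivative - (1 / x)\<^sup>2) (at x)"
      using DERIV_inverse[of x UNIV] 1 by (simp add: inverse_eq_divide power2_eq_square)
    have "((\<lambda>x. poly (flat_poly k) (1 / x) * exp (- (1 / x))) has_real_derivative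
        (poly (pderiv (flat_poly k)) (1 / x) * - (1 / x)\<^sup>2) * exp (- (1 / x)) +
        (exp (- (1 / x)) * - (- (1 / x)\<^sup>2)) * poly (flat_poly k) (1 / x)) (at x)"
      by (intro DERIV_mult DERIV_chain2[OF poly_DERIV inv] DERIV_chain2[OF DERIV_exp] DERIV_minus inv)
    moreover have "(poly (pderiv (flat_poly k)) (1 / x) * - (1 / x)\<^sup>2) * exp (- (1 / x)) +
        (exp (- (1 / x)) * - (- (1 / x)\<^sup>2)) * poly (flat_poly k) (1 / x) = flat (Suc k) x"
      using 1 by (simp add: flat_def power2_eq_square algebra_simps)
    ultimately have "((\<lambda>x. poly (flat_poly k) (1 / x) * exp (- (1 / x))) has_real_derivative flat (Suc k) x) (at x)"
      by simp
    then show ?thesis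
      by (rule has_field_derivative_transform_within_open[where S = "{0<..}"]) (use 1 in \<open>auto simp: flat_def\<close>)
  next
    case 2
    have "((\<lambda>x. 0) has_real_derivative flat (Suc k) x) (at x)"
      using 2 by (simp add: flat_def)
    then show ?thesis
      by (rule has_field_derivative_transform_within_open[where S = "{..<0}"]) (use 2 in \<open>auto simp: flat_def\<close>)
  next
    case 3
    have "((\<lambda>y. flat k y / y) \<longlongrightarrow> 0) (at_right 0)"
    proof -
      \<comment> \<open>The factor \<open>[:0, 1:]\<close> is the division by y in the difference
        quotient at 0, written in the variable 1 / y; a polynomial times exp(- t) still tends to
        0.\<close>
      have "((\<lambda>y. poly ([:0, 1:] * flat_poly k) (inverse y) * exp (- inverse y)) \<longlongrightarrow> 0) (at_right 0)"
        by (rule filterlim_compose[OF poly_exp_tendsto_0 filterlim_inverse_at_top_right])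
      moreover have "eventually (\<lambda>y. flat k y / y =
          poly ([:0, 1:] * flat_poly k) (inverse y) * exp (- inverse y)) (at_right 0)"
        using eventually_at_right_less[of "0 :: real"]
        by eventually_elim (simp add: flat_def field_simps)
      ultimately show ?thesis by (simp add: tendsto_cong)
    qed
    moreover have "((\<lambda>y. flat k y / y) \<longlongrightarrow> 0) (at_left 0)"
      by (rule tendsto_eventually) (auto simp: flat_def eventually_at_filter)
    ultimately have "((\<lambda>y. flat k y / y) \<longlongrightarrow> 0) (at 0)"
      by (simp add: filterlim_split_at)
    then show ?thesis using 3 by (simp add: has_field_derivative_iff flat_def)
  qed
qed

text \<open>A cutoff vanishing for x \<ge> b. The bump function uses it twice: with b = - a on the
  function - u, which gives \<open>flat 0 (u - a)\<close>, and with b = k on that result, normalised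
  by c.\<close>

lemma smooth_real_flat: "smooth_real (\<lambda>x. c * flat 0 (b - x))"
proof -
  have "((\<lambda>x. c * (-1) ^ k * flat k (b - x)) has_real_derivative c * (-1) ^ Suc k * flat (Suc k) (b - x)) (at x)"
    for k x
    by (rule derivative_eq_intros DERIV_chain2[OF flat_has_derivative] refl)+ simp
  then show ?thesis
    unfolding smooth_real_def
    by (intro exI[of _ "\<lambda>k x. c * (-1) ^ k * flat k (b - x)"]) auto
qed

lemma flat_0_pos: "0 < x \<Longrightarrow> 0 < flat 0 x" and flat_nonpos: "x \<le> 0 \<Longrightarrow> flat k x = 0"
  by (auto simp: flat_def)

lemma flat_0_mono: "x \<le> y \<Longrightarrow> flat 0 x \<le> flat 0 y"
  by (auto simp: flat_def field_simps)

section \<open>Smooth functions on manifolds\<close>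

lemma smooth_manifold_chartD:
  assumes "smooth_manifold M" "(U, x) \<in> charts M"
  shows "open U" "openin (Euclidean_space (mdim M)) (x ` U)"
    "homeomorphic_map (top_of_set U) (subtopology (Euclidean_space (mdim M)) (x ` U)) x" "inj_on x U"
proof -
  have "open U \<and> openin (Euclidean_space (mdim M)) (x ` U) \<and>
       homeomorphic_map (top_of_set U) (subtopology (Euclidean_space (mdim M)) (x ` U)) x"
    using bspec[OF assms(1)[unfolded smooth_manifold_def, THEN conjunct1] assms(2)]
    by (simp only: prod.case)
  then show "open U" "openin (Euclidean_space (mdim M)) (x ` U)"
    and h: "homeomorphic_map (top_of_set U) (subtopology (Euclidean_space (mdim M)) (x ` U)) x"
    by blast+
  show "inj_on x U" using homeomorphic_imp_injective_map[OF h] by simp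
qed

lemma smooth_manifold_transition:
  assumes "smooth_manifold M" "(U, x) \<in> charts M" "(V, y) \<in> charts M" "i < mdim M"
  shows "C_inf_on (mdim M) (x ` (U \<inter> V)) (\<lambda>c. y (inv_into U x c) i)"
  using assms unfolding smooth_manifold_def by blast

lemma smooth_manifold_cover:
  assumes "smooth_manifold M"
  obtains U x where "(U, x) \<in> charts M" "p \<in> U"
  using assms unfolding smooth_manifold_def by blast

lemma openin_chart_image:
  assumes "smooth_manifold M" "(U, x) \<in> charts M" "open W"
  shows "openin (Euclidean_space (mdim M)) (x ` (U \<inter> W))"
proof -
  note c = smooth_manifold_chartD[OF assms(1,2)]
  have "openin (top_of_set U) (U \<inter> W)" using assms(3) by (simp add: openin_open_Int)
  then have "openin (subtopology (Euclidean_space (mdim M)) (x ` U)) (x ` (U \<inter> W))"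
    using homeomorphic_imp_open_map[OF c(3)] by (simp add: open_map_def)
  then show ?thesis using c(2) openin_trans_full by blast
qed

lemma chart_inv_into:
  assumes "smooth_manifold M" "(U, x) \<in> charts M" "q \<in> U"
  shows "inv_into U x (x q) = q"
  using smooth_manifold_chartD(4)[OF assms(1,2)] assms(3) by simp

context
  fixes M :: "'m::{t2_space, second_countable_topology} smooth_atlas"
  assumes M: "smooth_manifold M"
begin

lemma smooth_fun_on_cong:
  assumes "open W" "\<And>p. p \<in> W \<Longrightarrow> f p = g p" "smooth_fun_on M W f"
  shows "smooth_fun_on M W g"
  unfolding smooth_fun_on_def C_inf_on_def
proof clarify
  fix U x k assume c: "(U, x) \<in> charts M"
  show "C_on (mdim M) k (x ` (U \<inter> W)) (g \<circ> inv_into U x)"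
  proof (rule C_on_cong[OF openin_chart_image[OF M c assms(1)]])
    show "(f \<circ> inv_into U x) z = (g \<circ> inv_into U x) z" if "z \<in> x ` (U \<inter> W)" for z
      using that assms(2) chart_inv_into[OF M c] by auto
    show "C_on (mdim M) k (x ` (U \<inter> W)) (f \<circ> inv_into U x)"
      using assms(3) c by (auto simp: smooth_fun_on_def C_inf_on_def)
  qed
qed

lemma smooth_fun_on_subset:
  assumes "V \<subseteq> W" "smooth_fun_on M W f"
  shows "smooth_fun_on M V f"
  unfolding smooth_fun_on_def C_inf_on_def
proof clarify
  fix U x k assume c: "(U, x) \<in> charts M"
  show "C_on (mdim M) k (x ` (U \<inter> V)) (f \<circ> inv_into U x)"
    by (rule C_on_subset[of _ "x ` (U \<inter> W)"])
      (use assms c in \<open>auto simp: smooth_fun_on_def C_inf_on_def\<close>)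
qed

lemma smooth_fun_on_local:
  assumes "open W" "\<And>p. p \<in> W \<Longrightarrow> \<exists>N. open N \<and> p \<in> N \<and> smooth_fun_on M (N \<inter> W) f"
  shows "smooth_fun_on M W f"
  unfolding smooth_fun_on_def C_inf_on_def
proof clarify
  fix U x k assume c: "(U, x) \<in> charts M"
  show "C_on (mdim M) k (x ` (U \<inter> W)) (f \<circ> inv_into U x)"
  proof (rule C_on_local[OF openin_chart_image[OF M c assms(1)]])
    fix z assume "z \<in> x ` (U \<inter> W)"
    then obtain p where p: "z = x p" "p \<in> U" "p \<in> W" by auto
    obtain N where N: "open N" "p \<in> N" "smooth_fun_on M (N \<inter> W) f" using assms(2) p by blast
    have "x ` (U \<inter> N) \<inter> x ` (U \<inter> W) = x ` (U \<inter> (N \<inter> W))"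
      using smooth_manifold_chartD(4)[OF M c] unfolding inj_on_def by blast
    then have "C_on (mdim M) k (x ` (U \<inter> N) \<inter> x ` (U \<inter> W)) (f \<circ> inv_into U x)"
      using N(3) c by (auto simp: smooth_fun_on_def C_inf_on_def)
    then show "\<exists>T. openin (Euclidean_space (mdim M)) T \<and> z \<in> T \<and>
        C_on (mdim M) k (T \<inter> x ` (U \<inter> W)) (f \<circ> inv_into U x)"
      using openin_chart_image[OF M c N(1)] p N(2) by blast
  qed
qed

lemma smooth_fun_on_const: "open W \<Longrightarrow> smooth_fun_on M W (\<lambda>_. c)"
  using C_on_const openin_chart_image[OF M] by (fastforce simp: smooth_fun_on_def C_inf_on_def comp_def)

lemma smooth_fun_on_add:
  assumes "open W" "smooth_fun_on M W f" "smooth_fun_on M W g"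
  shows "smooth_fun_on M W (\<lambda>p. f p + g p)"
  unfolding smooth_fun_on_def C_inf_on_def comp_def
proof clarify
  fix U x k assume c: "(U, x) \<in> charts M"
  show "C_on (mdim M) k (x ` (U \<inter> W)) (\<lambda>z. f (inv_into U x z) + g (inv_into U x z))"
    by (rule C_on_add[OF openin_chart_image[OF M c assms(1)]])
      (use assms c in \<open>auto simp: smooth_fun_on_def C_inf_on_def comp_def\<close>)
qed

lemma smooth_fun_on_mult:
  assumes "open W" "smooth_fun_on M W f" "smooth_fun_on M W g"
  shows "smooth_fun_on M W (\<lambda>p. f p * g p)"
  unfolding smooth_fun_on_def C_inf_on_def comp_def
proof clarify
  fix U x k assume c: "(U, x) \<in> charts M"
  show "C_on (mdim M) k (x ` (U \<inter> W)) (\<lambda>z. f (inv_into U x z) * g (inv_into U x z))"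
    by (rule C_on_mult[OF openin_chart_image[OF M c assms(1)]])
      (use assms c in \<open>auto simp: smooth_fun_on_def C_inf_on_def comp_def\<close>)
qed

lemma smooth_fun_on_minus:
  assumes "open W" "smooth_fun_on M W f"
  shows "smooth_fun_on M W (\<lambda>p. - f p)"
  using smooth_fun_on_mult[OF assms(1) smooth_fun_on_const[OF assms(1), of "-1"] assms(2)] by simp

lemma smooth_fun_on_diff:
  assumes "open W" "smooth_fun_on M W f" "smooth_fun_on M W g"
  shows "smooth_fun_on M W (\<lambda>p. f p - g p)"
  using smooth_fun_on_add[OF assms(1,2) smooth_fun_on_minus[OF assms(1,3)]] by simp

lemma smooth_fun_on_sum:
  assumes "open W" "\<And>i. i \<in> I \<Longrightarrow> smooth_fun_on M W (f i)"
  shows "smooth_fun_on M W (\<lambda>p. \<Sum>i\<in>I. f i p)"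
  using assms(2)
  by (induction I rule: infinite_finite_induct) (auto intro: smooth_fun_on_add smooth_fun_on_const assms(1))

lemma smooth_fun_on_compose:
  assumes "open W" "smooth_real g" "smooth_fun_on M W f"
  shows "smooth_fun_on M W (\<lambda>p. g (f p))"
  unfolding smooth_fun_on_def C_inf_on_def comp_def
proof clarify
  fix U x k assume c: "(U, x) \<in> charts M"
  show "C_on (mdim M) k (x ` (U \<inter> W)) (\<lambda>z. g (f (inv_into U x z)))"
    by (rule C_on_compose[OF openin_chart_image[OF M c assms(1)] assms(2)])
      (use assms c in \<open>auto simp: smooth_fun_on_def C_inf_on_def comp_def\<close>)
qed

section \<open>Bump functions\<close>

lemma smooth_fun_on_coordinate:
  assumes "(V, y) \<in> charts M" "i < mdim M"
  shows "smooth_fun_on M V (\<lambda>p. y p i)"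
  using smooth_manifold_transition[OF M _ assms] by (auto simp: smooth_fun_on_def comp_def)

text \<open>A closed box is compact as a product of compact sets and is described by one inequality
  per coordinate. The factor \<open>{0}\<close> in the directions from n on keeps it inside the
  Euclidean space.\<close>

lemma Euclidean_box_subset:
  assumes "openin (Euclidean_space n) S" "c \<in> S"
  obtains e where "e > 0" "PiE UNIV (\<lambda>i. if i < n then cball (c i) e else {0}) \<subseteq> S"
proof -
  obtain T where T: "openin (powertop_real UNIV) T" "S = {x. \<forall>i\<ge>n. x i = 0} \<inter> T"
    using assms(1) by (auto simp: Euclidean_space_def openin_subtopology)
  obtain X where X: "c \<in> (\<Pi>\<^sub>E i\<in>UNIV. X i)" "\<And>i. open (X i)" "(\<Pi>\<^sub>E i\<in>UNIV. X i) \<subseteq> T"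
    using product_topology_open_contains_basis[OF T(1), of c] assms(2) T(2) by auto
  have "\<exists>e>0. cball (c i) e \<subseteq> X i" for i
    using X(1,2) open_contains_cball by (metis PiE_E UNIV_I)
  then obtain e where e: "\<And>i. e i > 0 \<and> cball (c i) (e i) \<subseteq> X i" by metis
  \<comment> \<open>Only the first n coordinates vary, so finitely many radii have to be compared;
    the extra 1 keeps the minimum defined for n = 0.\<close>
  define d where "d = Min (insert 1 (e ` {..<n}))"
  have d: "d > 0" "\<And>i. i < n \<Longrightarrow> d \<le> e i" using e by (auto simp: d_def)
  have "PiE UNIV (\<lambda>i. if i < n then cball (c i) d else {0}) \<subseteq> S"
  proof
    fix z assume z: "z \<in> PiE UNIV (\<lambda>i. if i < n then cball (c i) d else {0})"
    have "z i \<in> X i" for i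
    proof (cases "i < n")
      case True
      then have "z i \<in> cball (c i) d" using PiE_mem[OF z, of i] by simp
      then have "z i \<in> cball (c i) (e i)" using d(2)[OF True] by simp
      then show ?thesis using e by blast
    next
      case False
      then have "z i = c i" using PiE_mem[OF z, of i] assms(2) T(2) by simp
      then show ?thesis using X(1) by auto
    qed
    then have "z \<in> T" using X(3) by auto
    moreover have "z i = 0" if "i \<ge> n" for i using PiE_mem[OF z, of i] that by simp
    ultimately show "z \<in> S" using T(2) by auto
  qed
  then show ?thesis using d(1) that by blast
qed

text \<open>Let u be the squared coordinate distance from p. The composite flat(k - flat(u - a)) is
  constant where u \<le> a, because the inner function vanishes there, and 0 where the inner
  function is at least k. Nesting two flat functions thus gives both plateaus. The support lies in
  the preimage C of a closed box inside the chart.\<close>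

lemma exists_bump_function:
  assumes "open N" "p \<in> N"
  obtains \<rho> V C where "smooth_fun_on M UNIV \<rho>" "open V" "p \<in> V" "\<forall>q\<in>V. \<rho> q = 1"
    "closed C" "C \<subseteq> N" "\<forall>q. q \<notin> C \<longrightarrow> \<rho> q = 0"
proof -
  obtain V y where Vy: "(V, y) \<in> charts M" "p \<in> V" using smooth_manifold_cover[OF M] by blast
  let ?n = "mdim M"
  note c = smooth_manifold_chartD[OF M Vy(1)]
  have op: "openin (Euclidean_space ?n) (y ` (V \<inter> N))" by (rule openin_chart_image[OF M Vy(1) assms(1)])
  obtain e where e: "e > 0" and sub: "PiE UNIV (\<lambda>i. if i < ?n then cball (y p i) e else {0}) \<subseteq> y ` (V \<inter> N)"
    using Euclidean_box_subset[OF op, of "y p"] assms(2) Vy(2) by blast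
  define K where "K = PiE UNIV (\<lambda>i. if i < ?n then cball (y p i) e else {0})"
  define C where "C = inv_into V y ` K"
  have "compactin (powertop_real UNIV) K"
    unfolding K_def by (subst compactin_PiE) auto
  have K_top: "K \<subseteq> topspace (Euclidean_space ?n)" "K \<subseteq> y ` V"
    using sub openin_subset[OF op] unfolding K_def by auto
  have "compactin (subtopology (Euclidean_space ?n) (y ` V)) K"
    using \<open>compactin (powertop_real UNIV) K\<close> K_top
    by (auto simp: Euclidean_space_def compactin_subtopology topspace_subtopology)
  moreover have "continuous_map (subtopology (Euclidean_space ?n) (y ` V)) (top_of_set V) (inv_into V y)"
  proof -
    obtain g where g: "homeomorphic_maps (top_of_set V) (subtopology (Euclidean_space ?n) (y ` V)) y g"
      using c(3) homeomorphic_map_maps by blast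
    have "continuous_map (subtopology (Euclidean_space ?n) (y ` V)) (top_of_set V) g"
      using g by (simp add: homeomorphic_maps_def)
    \<comment> \<open>The homeomorphism comes with some inverse; injectivity of the chart identifies
      it on the chart image with the one that defines C.\<close>
    moreover have "g z = inv_into V y z" if z: "z \<in> topspace (subtopology (Euclidean_space ?n) (y ` V))" for z
    proof -
      obtain q where "z = y q" "q \<in> V" using z by auto
      then show ?thesis using g c(4) by (simp add: homeomorphic_maps_def)
    qed
    ultimately show ?thesis by (rule continuous_map_eq)
  qed
  ultimately have "compactin (top_of_set V) C"
    unfolding C_def by (rule image_compactin)
  then have "compact C" by (simp add: compactin_subtopology)
  \<comment> \<open>Compactness in a Hausdorff space makes C closed in the whole manifold and not
    only in the chart domain, so extending by 0 is smooth at the boundary of the chart.\<close>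
  then have "closed C" by (rule compact_imp_closed)
  have C_iff: "q \<in> C \<longleftrightarrow> q \<in> V \<and> y q \<in> K" for q
  proof
    assume "q \<in> C"
    then obtain z where "z \<in> K" "q = inv_into V y z" by (auto simp: C_def)
    then show "q \<in> V \<and> y q \<in> K"
      using K_top(2) by (metis f_inv_into_f inv_into_into subsetD)
  next
    assume "q \<in> V \<and> y q \<in> K"
    then show "q \<in> C" unfolding C_def using inv_into_f_f[OF c(4)] by (metis imageI)
  qed
  have "C \<subseteq> N"
  proof
    fix q assume "q \<in> C"
    then have "q \<in> V" "y q \<in> y ` (V \<inter> N)" using C_iff sub by (auto simp: K_def)
    then show "q \<in> N" using c(4) by (auto simp: inj_on_def)
  qed
  define u where "u q = (\<Sum>i<?n. (y q i - y p i) * (y q i - y p i))" for q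
  \<comment> \<open>Any a strictly between 0 and the square of e serves: rho is 1 for u < a. The
    number k below is the value of \<open>flat 0 (u - a)\<close> where u is the square of e, hence a
    lower bound for it off the box.\<close>
  define a where "a = e\<^sup>2 / 2"
  have a: "a > 0" "a < e\<^sup>2" using e by (auto simp: a_def)
  define k where "k = flat 0 (e\<^sup>2 - a)"
  have k: "k > 0" using a flat_0_pos by (simp add: k_def)
  define \<rho> where "\<rho> q = (if q \<in> V then 1 / flat 0 k * flat 0 (k - flat 0 (u q - a)) else 0)" for q
  define W where "W = {q \<in> V. u q < a}"
  have y_top: "y q i = 0" if "q \<in> V" "i \<ge> ?n" for q i
    using openin_subset[OF c(2)] that by (auto simp: topspace_Euclidean_space)
  have far: "\<rho> q = 0" if "q \<notin> C" for q
  proof (cases "q \<in> V")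
    case True
    \<comment> \<open>Off the box some coordinate is further than e from that of p, so a single
      summand of u already reaches the square of e.\<close>
    have "\<not> (\<forall>i<?n. \<bar>y q i - y p i\<bar> \<le> e)"
    proof
      assume "\<forall>i<?n. \<bar>y q i - y p i\<bar> \<le> e"
      then have "y q \<in> K" using y_top[OF True]
        by (auto simp: K_def PiE_def Pi_iff dist_real_def abs_minus_commute)
      then show False using that True C_iff by blast
    qed
    then obtain i where i: "i < ?n" "\<bar>y q i - y p i\<bar> > e" by force
    have "e\<^sup>2 \<le> (y q i - y p i) * (y q i - y p i)"
      using i(2) e power_mono[of e "\<bar>y q i - y p i\<bar>" 2] by (simp add: power2_eq_square)
    also have "\<dots> \<le> u q" unfolding u_def by (rule member_le_sum) (use i(1) in auto)
    finally have "k \<le> flat 0 (u q - a)" unfolding k_def by (intro flat_0_mono) simp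
    then show ?thesis by (simp add: \<rho>_def flat_nonpos)
  qed (simp add: \<rho>_def)
  have u_smooth: "smooth_fun_on M V u"
    unfolding u_def
    by (intro smooth_fun_on_sum smooth_fun_on_mult smooth_fun_on_diff smooth_fun_on_const
        smooth_fun_on_coordinate[OF Vy(1)] c(1)) auto
  have "continuous_on V u"
  proof -
    have "continuous_map (top_of_set V) (Euclidean_space ?n) y"
      using homeomorphic_imp_continuous_map[OF c(3)] continuous_map_in_subtopology by blast
    then have "continuous_map (top_of_set V) (powertop_real UNIV) y"
      unfolding Euclidean_space_def continuous_map_in_subtopology by blast
    then have "continuous_on V (\<lambda>q. y q i)" for i
      by (simp add: continuous_map_componentwise_UNIV)
    then show ?thesis unfolding u_def by (intro continuous_intros)
  qed
  then have "open (V \<inter> u -` {..<a})"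
    using c(1) by (simp add: continuous_on_open_vimage Int_commute)
  moreover have "V \<inter> u -` {..<a} = W" by (auto simp: W_def)
  ultimately have "open W" by simp
  have "smooth_fun_on M V (\<lambda>q. flat 0 (u q - a))"
  proof -
    have "smooth_fun_on M V (\<lambda>q. - u q)" by (intro smooth_fun_on_minus c(1) u_smooth)
    from smooth_fun_on_compose[OF c(1) smooth_real_flat[of 1 "- a"] this]
    show ?thesis by simp
  qed
  from smooth_fun_on_compose[OF c(1) smooth_real_flat[of "1 / flat 0 k" k] this]
  have "smooth_fun_on M V \<rho>"
    by (rule smooth_fun_on_cong[OF c(1), rotated]) (simp add: \<rho>_def)
  \<comment> \<open>V and the complement of C are open and cover the manifold; rho is a smooth
    composite on the former and 0 on the latter.\<close>
  have "smooth_fun_on M UNIV \<rho>"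
  proof (rule smooth_fun_on_local)
    fix q :: 'm
    show "\<exists>N. open N \<and> q \<in> N \<and> smooth_fun_on M (N \<inter> UNIV) \<rho>"
    proof (cases "q \<in> C")
      case True
      then show ?thesis using \<open>smooth_fun_on M V \<rho>\<close> c(1) C_iff by auto
    next
      case False
      have "smooth_fun_on M (- C) \<rho>"
        by (rule smooth_fun_on_cong[OF _ _ smooth_fun_on_const[of _ 0]]) (use far \<open>closed C\<close> in \<open>auto simp: open_closed\<close>)
      then show ?thesis using False \<open>closed C\<close> by (intro exI[of _ "- C"]) (auto simp: open_closed)
    qed
  qed simp
  moreover have "p \<in> W" using Vy(2) a by (simp add: W_def u_def)
  moreover have "\<rho> q = 1" if "q \<in> W" for q
    using that k flat_0_pos[OF k] by (auto simp: W_def \<rho>_def flat_nonpos)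
  ultimately show ?thesis using that \<open>open W\<close> \<open>closed C\<close> \<open>C \<subseteq> N\<close> far by blast
qed

end

section \<open>Frames, coframes and smooth sections\<close>

lemma sum_fun_apply: "(\<Sum>i\<in>I. f i) x = (\<Sum>i\<in>I. f i x)"
  by (induction I rule: infinite_finite_induct) auto

lemma dual_fibreD:
  assumes "\<xi> \<in> dual_fibre E p" "u \<in> fibre E p"
  shows "\<xi> (c *\<^sub>R u) = c * \<xi> u" "v \<in> fibre E p \<Longrightarrow> \<xi> (u + v) = \<xi> u + \<xi> v"
  using assms unfolding dual_fibre_def by blast+

lemma dual_fibre_outside: "\<xi> \<in> dual_fibre E p \<Longrightarrow> u \<notin> fibre E p \<Longrightarrow> \<xi> u = 0"
  unfolding dual_fibre_def by blast

text \<open>Covectors are 0 off the fibre by convention, so agreement on the fibre is equality of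
  functions.\<close>

lemma dual_fibre_eqI:
  assumes "\<xi> \<in> dual_fibre E p" "\<eta> \<in> dual_fibre E p" "\<And>u. u \<in> fibre E p \<Longrightarrow> \<xi> u = \<eta> u"
  shows "\<xi> = \<eta>"
proof
  fix u
  show "\<xi> u = \<eta> u"
    using assms(3) dual_fibre_outside[OF assms(1)] dual_fibre_outside[OF assms(2)]
    by (cases "u \<in> fibre E p") simp_all
qed

lemma subspace_dual_fibre: "subspace (dual_fibre E p)"
  unfolding subspace_def dual_fibre_def
  by (auto simp: scaleR_fun_def algebra_simps)

lemma dual_bundle_simps [simp]:
  "base (dual_bundle E) = base E" "vrank (dual_bundle E) = vrank E"
  "fibre (dual_bundle E) = dual_fibre E"
  "frames (dual_bundle E) = (\<lambda>(U, e). (U, coframe E e)) ` frames E"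
  by (simp_all add: dual_bundle_def)

abbreviation dual_sections ::
    "('m, 'v::real_vector, 'z) vbundle_scheme \<Rightarrow> ('m \<Rightarrow> 'v \<Rightarrow> real) set"
  where "dual_sections E \<equiv> sections (dual_bundle E)"

context
  fixes E :: "('m::{t2_space, second_countable_topology}, 'v::real_vector, 'z) vbundle_scheme"
  assumes E: "vector_bundle E"
begin

lemma vector_bundle_base: "smooth_manifold (base E)"
  using E by (simp add: vector_bundle_def)

lemma subspace_fibre: "subspace (fibre E p)"
  using E by (simp add: vector_bundle_def)

lemma frame_cover:
  obtains U e where "(U, e) \<in> frames E" "p \<in> U"
proof -
  have "(\<Union>(U, e)\<in>frames E. U) = UNIV" using E by (simp only: vector_bundle_def)
  then have "p \<in> (\<Union>(U, e)\<in>frames E. U)" by simp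
  then show ?thesis using that by (elim UN_E) (auto split: prod.splits)
qed

lemma frameD:
  assumes "(U, e) \<in> frames E"
  shows "open U" "i < vrank E \<Longrightarrow> smooth_section_on E U (e i)"
    and "p \<in> U \<Longrightarrow> inj_on (\<lambda>i. e i p) {..<vrank E}"
    and "p \<in> U \<Longrightarrow> independent ((\<lambda>i. e i p) ` {..<vrank E})"
    and "p \<in> U \<Longrightarrow> span ((\<lambda>i. e i p) ` {..<vrank E}) = fibre E p"
proof -
  have "\<forall>(U, e)\<in>frames E. open U \<and>
       (\<forall>p\<in>U. inj_on (\<lambda>i. e i p) {..<vrank E} \<and> independent ((\<lambda>i. e i p) ` {..<vrank E}) \<and>
              span ((\<lambda>i. e i p) ` {..<vrank E}) = fibre E p) \<and>
       (\<forall>i<vrank E. smooth_section_on E U (e i))"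
    using E unfolding vector_bundle_def by (elim conjE)
  then have *: "open U \<and>
       (\<forall>p\<in>U. inj_on (\<lambda>i. e i p) {..<vrank E} \<and> independent ((\<lambda>i. e i p) ` {..<vrank E}) \<and>
              span ((\<lambda>i. e i p) ` {..<vrank E}) = fibre E p) \<and>
       (\<forall>i<vrank E. smooth_section_on E U (e i))"
    by (drule_tac bspec[OF _ assms]) (unfold prod.case)
  show "open U" "i < vrank E \<Longrightarrow> smooth_section_on E U (e i)"
    "p \<in> U \<Longrightarrow> inj_on (\<lambda>i. e i p) {..<vrank E}"
    "p \<in> U \<Longrightarrow> independent ((\<lambda>i. e i p) ` {..<vrank E})"
    "p \<in> U \<Longrightarrow> span ((\<lambda>i. e i p) ` {..<vrank E}) = fibre E p"
    using * by blast+
qed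

lemma frame_in_fibre: "(U, e) \<in> frames E \<Longrightarrow> p \<in> U \<Longrightarrow> i < vrank E \<Longrightarrow> e i p \<in> fibre E p"
  using frameD(5)[of U e p] by (metis imageI lessThan_iff span_base)

lemma fibre_sum: "(\<And>i. i \<in> I \<Longrightarrow> f i \<in> fibre E p) \<Longrightarrow> (\<Sum>i\<in>I. c i *\<^sub>R f i) \<in> fibre E p"
  by (intro subspace_sum subspace_fibre subspace_scale)

lemma dual_fibre_zero: "\<xi> \<in> dual_fibre E p \<Longrightarrow> \<xi> 0 = 0"
  using dual_fibreD(1)[of \<xi> E p 0 0] subspace_0[OF subspace_fibre] by simp

lemma dual_fibre_minus: "\<xi> \<in> dual_fibre E p \<Longrightarrow> u \<in> fibre E p \<Longrightarrow> \<xi> (- u) = - \<xi> u"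
  using dual_fibreD(1)[of \<xi> E p u "-1"] by simp

lemma dual_fibre_diff:
  "\<xi> \<in> dual_fibre E p \<Longrightarrow> u \<in> fibre E p \<Longrightarrow> v \<in> fibre E p \<Longrightarrow> \<xi> (u - v) = \<xi> u - \<xi> v"
  using dual_fibreD(2)[of \<xi> E p u "- v"] subspace_neg[OF subspace_fibre]
  by (simp add: dual_fibre_minus)

lemma dual_fibre_sum:
  assumes "\<xi> \<in> dual_fibre E p" "\<And>i. i \<in> I \<Longrightarrow> f i \<in> fibre E p"
  shows "\<xi> (\<Sum>i\<in>I. c i *\<^sub>R f i) = (\<Sum>i\<in>I. c i * \<xi> (f i))"
  using assms(2)
proof (induction I rule: infinite_finite_induct)
  case (insert x F)
  then have "\<xi> (c x *\<^sub>R f x + (\<Sum>i\<in>F. c i *\<^sub>R f i)) = c x * \<xi> (f x) + \<xi> (\<Sum>i\<in>F. c i *\<^sub>R f i)"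
    using dual_fibreD[OF assms(1)] fibre_sum[of F f p c] subspace_scale[OF subspace_fibre] by simp
  then show ?case using insert by simp
qed (use dual_fibre_zero[OF assms(1)] in auto)

section \<open>Coordinates with respect to a frame\<close>

lemma frame_expansion:
  assumes "(U, e) \<in> frames E" "p \<in> U" "v \<in> fibre E p"
  obtains c where "v = (\<Sum>i<vrank E. c i *\<^sub>R e i p)"
proof -
  let ?B = "(\<lambda>i. e i p) ` {..<vrank E}"
  have "v \<in> span ?B" using frameD(5)[OF assms(1,2)] assms(3) by simp
  then obtain u where "v = (\<Sum>b\<in>?B. u b *\<^sub>R b)" by (auto simp: span_finite)
  also have "\<dots> = (\<Sum>i<vrank E. u (e i p) *\<^sub>R e i p)"
    by (subst sum.reindex[OF frameD(3)[OF assms(1,2)]]) simp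
  finally show ?thesis by (rule that)
qed

lemma dual_fibre_eq_on_frame:
  assumes "(U, e) \<in> frames E" "p \<in> U" "\<xi> \<in> dual_fibre E p" "\<eta> \<in> dual_fibre E p"
    and "\<And>i. i < vrank E \<Longrightarrow> \<xi> (e i p) = \<eta> (e i p)"
  shows "\<xi> = \<eta>"
proof (rule dual_fibre_eqI[OF assms(3,4)])
  fix u assume "u \<in> fibre E p"
  then obtain c where c: "u = (\<Sum>i<vrank E. c i *\<^sub>R e i p)" using frame_expansion assms(1,2) by metis
  have "\<xi> u = (\<Sum>i<vrank E. c i * \<xi> (e i p))"
    unfolding c by (rule dual_fibre_sum[OF assms(3)]) (use frame_in_fibre[OF assms(1,2)] in auto)
  also have "\<dots> = (\<Sum>i<vrank E. c i * \<eta> (e i p))" using assms(5) by simp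
  also have "\<dots> = \<eta> u"
    unfolding c by (rule dual_fibre_sum[OF assms(4), symmetric]) (use frame_in_fibre[OF assms(1,2)] in auto)
  finally show "\<xi> u = \<eta> u" .
qed

text \<open>A frame is a basis of the fibre, so the coordinate functional
  \<open>representation\<close>, set to 0 off the fibre, satisfies the description in
  \<open>coframe\<close>; the values on the basis determine it.\<close>

lemma coframe:
  assumes "(U, e) \<in> frames E" "p \<in> U" "i < vrank E"
  shows "coframe E e i p \<in> dual_fibre E p"
    and "j < vrank E \<Longrightarrow> coframe E e i p (e j p) = (if i = j then 1 else 0)"
proof -
  let ?B = "(\<lambda>i. e i p) ` {..<vrank E}"
  note ind = frameD(4)[OF assms(1,2)] and sp = frameD(5)[OF assms(1,2)]
  define \<xi> where "\<xi> v = (if v \<in> fibre E p then representation ?B v (e i p) else 0)" for v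
  have inF: "u + v \<in> fibre E p" "c *\<^sub>R u \<in> fibre E p"
    if "u \<in> fibre E p" "v \<in> fibre E p" for u v and c :: real
    using that subspace_fibre by (auto simp: subspace_add subspace_scale)
  have "\<xi> \<in> dual_fibre E p"
    unfolding dual_fibre_def \<xi>_def using ind sp inF
    by (auto simp: representation_add representation_scale)
  moreover have "\<xi> (e j p) = (if i = j then 1 else 0)" if "j < vrank E" for j
  proof -
    have "representation ?B (e j p) = (\<lambda>v. if v = e j p then 1 else 0)"
      by (rule representation_basis[OF ind]) (use that in auto)
    then show ?thesis using frame_in_fibre[OF assms(1,2) that] frameD(3)[OF assms(1,2)] that assms(3)
      by (auto simp: \<xi>_def inj_on_def)
  qed
  ultimately have ex: "\<xi> \<in> dual_fibre E p \<and> (\<forall>j<vrank E. \<xi> (e j p) = (if i = j then 1 else 0))" by blast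
  have "\<exists>!\<xi>. \<xi> \<in> dual_fibre E p \<and> (\<forall>j<vrank E. \<xi> (e j p) = (if i = j then 1 else 0))"
  proof (rule ex_ex1I)
    show "\<exists>\<xi>. \<xi> \<in> dual_fibre E p \<and> (\<forall>j<vrank E. \<xi> (e j p) = (if i = j then 1 else 0))"
      using ex by blast
    fix \<xi> \<eta>
    assume "\<xi> \<in> dual_fibre E p \<and> (\<forall>j<vrank E. \<xi> (e j p) = (if i = j then 1 else 0))"
      "\<eta> \<in> dual_fibre E p \<and> (\<forall>j<vrank E. \<eta> (e j p) = (if i = j then 1 else 0))"
    then show "\<xi> = \<eta>" by (intro dual_fibre_eq_on_frame[OF assms(1,2)]) auto
  qed
  from theI'[OF this]
  have "coframe E e i p \<in> dual_fibre E p \<and> (\<forall>j<vrank E. coframe E e i p (e j p) = (if i = j then 1 else 0))"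
    unfolding coframe_def .
  then show "coframe E e i p \<in> dual_fibre E p"
    "j < vrank E \<Longrightarrow> coframe E e i p (e j p) = (if i = j then 1 else 0)" by blast+
qed

lemma coframe_sum:
  assumes "(U, e) \<in> frames E" "p \<in> U" "i < vrank E"
  shows "coframe E e i p (\<Sum>j<vrank E. c j *\<^sub>R e j p) = c i"
proof -
  have "coframe E e i p (\<Sum>j<vrank E. c j *\<^sub>R e j p) = (\<Sum>j<vrank E. c j * coframe E e i p (e j p))"
    by (rule dual_fibre_sum[OF coframe(1)[OF assms]]) (use frame_in_fibre[OF assms(1,2)] in auto)
  also have "\<dots> = (\<Sum>j<vrank E. if i = j then c j else 0)"
    by (rule sum.cong) (use coframe(2)[OF assms] in auto)
  also have "\<dots> = c i" using assms(3) by simp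
  finally show ?thesis .
qed

lemma coframe_expansion:
  assumes "(U, e) \<in> frames E" "p \<in> U" "v \<in> fibre E p"
  shows "v = (\<Sum>i<vrank E. coframe E e i p v *\<^sub>R e i p)"
proof -
  obtain c where c: "v = (\<Sum>i<vrank E. c i *\<^sub>R e i p)" using frame_expansion assms by metis
  then have "coframe E e i p v = c i" if "i < vrank E" for i using coframe_sum[OF assms(1,2) that] by simp
  then show ?thesis using c by simp
qed

lemma dual_coframe_expansion:
  assumes "(U, e) \<in> frames E" "p \<in> U" "\<xi> \<in> dual_fibre E p"
  shows "\<xi> = (\<Sum>i<vrank E. \<xi> (e i p) *\<^sub>R coframe E e i p)"
proof (rule dual_fibre_eq_on_frame[OF assms(1-3)])
  show "(\<Sum>i<vrank E. \<xi> (e i p) *\<^sub>R coframe E e i p) \<in> dual_fibre E p"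
    by (intro subspace_sum subspace_scale subspace_dual_fibre) (use coframe(1)[OF assms(1,2)] in auto)
  fix j assume j: "j < vrank E"
  have "(\<Sum>i<vrank E. \<xi> (e i p) *\<^sub>R coframe E e i p) (e j p) = (\<Sum>i<vrank E. \<xi> (e i p) * coframe E e i p (e j p))"
    by (simp add: sum_fun_apply scaleR_fun_def)
  also have "\<dots> = (\<Sum>i<vrank E. if j = i then \<xi> (e i p) else 0)"
    by (rule sum.cong) (use coframe(2)[OF assms(1,2)] j in auto)
  also have "\<dots> = \<xi> (e j p)" using j by simp
  finally show "\<xi> (e j p) = (\<Sum>i<vrank E. \<xi> (e i p) *\<^sub>R coframe E e i p) (e j p)" by simp
qed

text \<open>The coframe reads off all coordinates. Identities between vectors are therefore checked
  after pairing with covectors, where the defining equations of \<open>Psi\<close>,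
  \<open>L_op\<close> and \<open>R_op\<close> apply.\<close>

lemma covector_separates:
  assumes "u \<in> fibre E p" "v \<in> fibre E p" "\<And>\<xi>. \<xi> \<in> dual_fibre E p \<Longrightarrow> \<xi> u = \<xi> v"
  shows "u = v"
proof -
  obtain U e where Ue: "(U, e) \<in> frames E" "p \<in> U" by (rule frame_cover)
  have "coframe E e i p u = coframe E e i p v" if "i < vrank E" for i
    using coframe(1)[OF Ue that] by (rule assms(3))
  then show ?thesis
    using coframe_expansion[OF Ue assms(1)] coframe_expansion[OF Ue assms(2)] by simp
qed

text \<open>The coefficients that \<open>smooth_section_on\<close> asks for are unique on the
  overlap and are given by the coframe, so the existential quantifier disappears.\<close>

lemma smooth_section_on_iff:
  assumes "open W"
  shows "smooth_section_on E W s \<longleftrightarrow> (\<forall>p\<in>W. s p \<in> fibre E p) \<and>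
    (\<forall>(U, e)\<in>frames E. \<forall>i<vrank E. smooth_fun_on (base E) (U \<inter> W) (\<lambda>p. coframe E e i p (s p)))"
    (is "?l \<longleftrightarrow> ?r")
proof
  assume l: ?l
  have "smooth_fun_on (base E) (U \<inter> W) (\<lambda>p. coframe E e i p (s p))"
    if Ue: "(U, e) \<in> frames E" and i: "i < vrank E" for U e i
  proof -
    obtain c where c: "\<And>i. i < vrank E \<Longrightarrow> smooth_fun_on (base E) (U \<inter> W) (c i)"
      "\<And>p. p \<in> U \<inter> W \<Longrightarrow> s p = (\<Sum>i<vrank E. c i p *\<^sub>R e i p)"
      using l Ue unfolding smooth_section_on_def by blast
    show ?thesis
      by (rule smooth_fun_on_cong[OF vector_bundle_base _ _ c(1)[OF i]])
        (use c(2) coframe_sum[OF Ue _ i] assms frameD(1)[OF Ue] in auto)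
  qed
  then show ?r using l unfolding smooth_section_on_def by blast
next
  assume r: ?r
  show ?l
    unfolding smooth_section_on_def
  proof (intro conjI ballI)
    fix p assume "p \<in> W" then show "s p \<in> fibre E p" using r by blast
  next
    fix Ue assume "Ue \<in> frames E"
    moreover obtain U e where "Ue = (U, e)" by (cases Ue)
    ultimately have Ue: "(U, e) \<in> frames E" "Ue = (U, e)" by simp_all
    show "case Ue of (U, e) \<Rightarrow> \<exists>c. (\<forall>i<vrank E. smooth_fun_on (base E) (U \<inter> W) (c i)) \<and>
       (\<forall>p\<in>U \<inter> W. s p = (\<Sum>i<vrank E. c i p *\<^sub>R e i p))"
      unfolding Ue(2) prod.case
    proof (intro exI[of _ "\<lambda>i p. coframe E e i p (s p)"] conjI allI impI ballI)
      fix i assume "i < vrank E"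
      then show "smooth_fun_on (base E) (U \<inter> W) (\<lambda>p. coframe E e i p (s p))" using r Ue by blast
    next
      fix p assume "p \<in> U \<inter> W"
      then show "s p = (\<Sum>i<vrank E. coframe E e i p (s p) *\<^sub>R e i p)"
        using r coframe_expansion[OF Ue(1), of p "s p"] by blast
    qed
  qed
qed

lemma smooth_section_on_coefficient:
  assumes "open W" "smooth_section_on E W s" "(U, e) \<in> frames E" "i < vrank E"
  shows "smooth_fun_on (base E) (U \<inter> W) (\<lambda>p. coframe E e i p (s p))"
  using assms(2-4) unfolding smooth_section_on_iff[OF assms(1)] by blast

lemma sections_iff:
  "s \<in> sections E \<longleftrightarrow> (\<forall>p. s p \<in> fibre E p) \<and>
    (\<forall>(U, e)\<in>frames E. \<forall>i<vrank E. smooth_fun_on (base E) U (\<lambda>p. coframe E e i p (s p)))"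
  by (simp add: sections_def smooth_section_on_iff)

lemma section_in_fibre: "s \<in> sections E \<Longrightarrow> s p \<in> fibre E p"
  by (simp add: sections_iff)

text \<open>The coefficients of a covector field along the coframe are its values on the frame. This
  form avoids the coframe of the coframe, which lives in the double dual.\<close>

lemma dual_smooth_section_on_iff:
  assumes "open W"
  shows "smooth_section_on (dual_bundle E) W \<eta> \<longleftrightarrow> (\<forall>p\<in>W. \<eta> p \<in> dual_fibre E p) \<and>
    (\<forall>(U, e)\<in>frames E. \<forall>i<vrank E. smooth_fun_on (base E) (U \<inter> W) (\<lambda>p. \<eta> p (e i p)))"
    (is "?l \<longleftrightarrow> ?r")
proof
  assume l: ?l
  have "smooth_fun_on (base E) (U \<inter> W) (\<lambda>p. \<eta> p (e i p))"
    if Ue: "(U, e) \<in> frames E" and i: "i < vrank E" for U e i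
  proof -
    have "(U, coframe E e) \<in> frames (dual_bundle E)" using Ue by force
    then obtain c where c: "\<And>i. i < vrank E \<Longrightarrow> smooth_fun_on (base E) (U \<inter> W) (c i)"
      "\<And>p. p \<in> U \<inter> W \<Longrightarrow> \<eta> p = (\<Sum>i<vrank E. c i p *\<^sub>R coframe E e i p)"
      using l unfolding smooth_section_on_def dual_bundle_simps(1-3) by blast
    have ce: "c i p = \<eta> p (e i p)" if p: "p \<in> U \<inter> W" for p
    proof -
      have "\<eta> p (e i p) = (\<Sum>j<vrank E. c j p * coframe E e j p (e i p))"
        by (simp add: c(2)[OF p] sum_fun_apply scaleR_fun_def)
      also have "\<dots> = (\<Sum>j<vrank E. if i = j then c j p else 0)"
        by (rule sum.cong) (use coframe(2)[OF Ue] p i in auto)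
      finally show ?thesis using i by simp
    qed
    show ?thesis
      by (rule smooth_fun_on_cong[OF vector_bundle_base _ ce c(1)[OF i]])
        (use assms frameD(1)[OF Ue] in auto)
  qed
  then show ?r using l unfolding smooth_section_on_def by auto
next
  assume r: ?r
  show ?l
    unfolding smooth_section_on_def
  proof (intro conjI ballI)
    fix p assume "p \<in> W" then show "\<eta> p \<in> fibre (dual_bundle E) p" using r by simp
  next
    fix Uf assume "Uf \<in> frames (dual_bundle E)"
    then obtain U e where Ue: "(U, e) \<in> frames E" "Uf = (U, coframe E e)" by auto
    show "case Uf of (U, f) \<Rightarrow> \<exists>c. (\<forall>i<vrank (dual_bundle E). smooth_fun_on (base (dual_bundle E)) (U \<inter> W) (c i)) \<and>
       (\<forall>p\<in>U \<inter> W. \<eta> p = (\<Sum>i<vrank (dual_bundle E). c i p *\<^sub>R f i p))"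
      unfolding Ue(2) prod.case dual_bundle_simps
    proof (intro exI[of _ "\<lambda>i p. \<eta> p (e i p)"] conjI allI impI ballI)
      fix i assume "i < vrank E"
      then show "smooth_fun_on (base E) (U \<inter> W) (\<lambda>p. \<eta> p (e i p))" using r Ue by blast
    next
      fix p assume "p \<in> U \<inter> W"
      then show "\<eta> p = (\<Sum>i<vrank E. \<eta> p (e i p) *\<^sub>R coframe E e i p)"
        using r dual_coframe_expansion[OF Ue(1), of p "\<eta> p"] by blast
    qed
  qed
qed

lemma dual_sections_iff:
  "\<eta> \<in> dual_sections E \<longleftrightarrow> (\<forall>p. \<eta> p \<in> dual_fibre E p) \<and>
    (\<forall>(U, e)\<in>frames E. \<forall>i<vrank E. smooth_fun_on (base E) U (\<lambda>p. \<eta> p (e i p)))"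
  by (simp add: sections_def dual_smooth_section_on_iff)

text \<open>With this, everything proved about sections, in particular extension and tensoriality,
  also applies to covector fields.\<close>

lemma vector_bundle_dual: "vector_bundle (dual_bundle E)"
  unfolding vector_bundle_def
proof (intro conjI allI ballI)
  show "smooth_manifold (base (dual_bundle E))" by (simp add: vector_bundle_base)
  show "subspace (fibre (dual_bundle E) p)" for p by (simp add: subspace_dual_fibre)
  show "(\<Union>(U, e)\<in>frames (dual_bundle E). U) = UNIV"
    using E by (auto simp: vector_bundle_def)
next
  fix Uf assume "Uf \<in> frames (dual_bundle E)"
  then obtain U e where Ue: "(U, e) \<in> frames E" "Uf = (U, coframe E e)" by auto
  let ?r = "vrank E" and ?f = "coframe E e"
  have eval: "(\<Sum>i<?r. c i *\<^sub>R ?f i p) (e j p) = c j" if "p \<in> U" "j < ?r" for c p j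
  proof -
    have "(\<Sum>i<?r. c i *\<^sub>R ?f i p) (e j p) = (\<Sum>i<?r. c i * ?f i p (e j p))"
      by (simp add: sum_fun_apply scaleR_fun_def)
    also have "\<dots> = (\<Sum>i<?r. if j = i then c i else 0)"
      by (rule sum.cong) (use coframe(2)[OF Ue(1)] that in auto)
    finally show ?thesis using that by simp
  qed
  have inj: "inj_on (\<lambda>i. ?f i p) {..<?r}" if p: "p \<in> U" for p
  proof (rule inj_onI)
    fix i j assume ij: "i \<in> {..<?r}" "j \<in> {..<?r}" "?f i p = ?f j p"
    then have "?f i p (e j p) = 1" using coframe(2)[OF Ue(1) p, of j j] by simp
    then show "i = j" using coframe(2)[OF Ue(1) p, of i j] ij by (auto split: if_splits)
  qed
  have "independent ((\<lambda>i. ?f i p) ` {..<?r})" if p: "p \<in> U" for p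
  proof (rule independent_if_scalars_zero)
    fix g x assume g: "(\<Sum>x\<in>(\<lambda>i. ?f i p) ` {..<?r}. g x *\<^sub>R x) = 0" "x \<in> (\<lambda>i. ?f i p) ` {..<?r}"
    then obtain j where j: "j < ?r" "x = ?f j p" by auto
    have "(\<Sum>i<?r. g (?f i p) *\<^sub>R ?f i p) = 0"
      using g(1) by (subst (asm) sum.reindex[OF inj[OF p]]) simp
    then show "g x = 0" using eval[OF p j(1), of "\<lambda>i. g (?f i p)"] j(2) by simp
  qed simp
  moreover have "span ((\<lambda>i. ?f i p) ` {..<?r}) = dual_fibre E p" if p: "p \<in> U" for p
  proof
    show "span ((\<lambda>i. ?f i p) ` {..<?r}) \<subseteq> dual_fibre E p"
      by (rule span_minimal[OF _ subspace_dual_fibre]) (use coframe(1)[OF Ue(1) p] in auto)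
    show "dual_fibre E p \<subseteq> span ((\<lambda>i. ?f i p) ` {..<?r})"
    proof
      fix \<xi> assume "\<xi> \<in> dual_fibre E p"
      then have "\<xi> = (\<Sum>i<?r. \<xi> (e i p) *\<^sub>R ?f i p)" by (rule dual_coframe_expansion[OF Ue(1) p])
      moreover have "\<dots> \<in> span ((\<lambda>i. ?f i p) ` {..<?r})"
        by (intro span_sum span_scale span_base) auto
      ultimately show "\<xi> \<in> span ((\<lambda>i. ?f i p) ` {..<?r})" by simp
    qed
  qed
  moreover have "smooth_section_on (dual_bundle E) U (?f i)" if i: "i < ?r" for i
    unfolding dual_smooth_section_on_iff[OF frameD(1)[OF Ue(1)]]
  proof (intro conjI ballI)
    show "?f i p \<in> dual_fibre E p" if "p \<in> U" for p using coframe(1)[OF Ue(1) that i] .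
  next
    fix Ue' assume "Ue' \<in> frames E"
    moreover obtain U' e' where "Ue' = (U', e')" by (cases Ue')
    ultimately have Ue': "(U', e') \<in> frames E" "Ue' = (U', e')" by simp_all
    \<comment> \<open>The coefficient of the i-th coframe element along the coframe of e' is also
      the coefficient of \<open>e' j\<close> along \<open>e i\<close>; smoothness of e' in the frame
      e is what is asked, transposed.\<close>
    have "smooth_fun_on (base E) (U' \<inter> U) (\<lambda>p. ?f i p (e' j p))" if "j < ?r" for j
      using smooth_section_on_coefficient[OF frameD(1)[OF Ue'(1)] frameD(2)[OF Ue'(1) that] Ue(1) i]
      by (simp add: Int_commute)
    then show "case Ue' of (U', e') \<Rightarrow> \<forall>j<?r. smooth_fun_on (base E) (U' \<inter> U) (\<lambda>p. ?f i p (e' j p))"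
      using Ue'(2) by simp
  qed
  ultimately show "case Uf of (U, f) \<Rightarrow> open U \<and>
       (\<forall>p\<in>U. inj_on (\<lambda>i. f i p) {..<vrank (dual_bundle E)} \<and>
           independent ((\<lambda>i. f i p) ` {..<vrank (dual_bundle E)}) \<and>
           span ((\<lambda>i. f i p) ` {..<vrank (dual_bundle E)}) = fibre (dual_bundle E) p) \<and>
       (\<forall>i<vrank (dual_bundle E). smooth_section_on (dual_bundle E) U (f i))"
    using inj frameD(1)[OF Ue(1)] unfolding Ue(2) prod.case dual_bundle_simps by blast
qed

section \<open>Global sections as a module over the smooth functions\<close>

lemma sectionsI:
  assumes "\<And>p. s p \<in> fibre E p"
    and "\<And>U e i. (U, e) \<in> frames E \<Longrightarrow> i < vrank E \<Longrightarrow> smooth_fun_on (base E) U (\<lambda>p. coframe E e i p (s p))"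
  shows "s \<in> sections E"
  unfolding sections_iff
proof (intro conjI allI ballI)
  fix Ue assume "Ue \<in> frames E"
  then show "case Ue of (U, e) \<Rightarrow> \<forall>i<vrank E. smooth_fun_on (base E) U (\<lambda>p. coframe E e i p (s p))"
    using assms(2) by (cases Ue) simp
qed (rule assms(1))

lemma section_coefficient_smooth:
  "s \<in> sections E \<Longrightarrow> (U, e) \<in> frames E \<Longrightarrow> i < vrank E \<Longrightarrow>
    smooth_fun_on (base E) U (\<lambda>p. coframe E e i p (s p))"
  by (auto simp: sections_iff)

lemma sections_add:
  assumes "s \<in> sections E" "t \<in> sections E"
  shows "s + t \<in> sections E"
proof (rule sectionsI)
  show "(s + t) p \<in> fibre E p" for p
    using assms[THEN section_in_fibre] subspace_add[OF subspace_fibre] by simp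
  fix U e i assume Ue: "(U, e) \<in> frames E" "i < vrank E"
  show "smooth_fun_on (base E) U (\<lambda>p. coframe E e i p ((s + t) p))"
    by (rule smooth_fun_on_cong[OF vector_bundle_base frameD(1)[OF Ue(1)] _
          smooth_fun_on_add[OF vector_bundle_base frameD(1)[OF Ue(1)]
            section_coefficient_smooth[OF assms(1) Ue] section_coefficient_smooth[OF assms(2) Ue]]])
      (use dual_fibreD(2)[OF coframe(1)[OF Ue(1) _ Ue(2)]] assms[THEN section_in_fibre] in simp)
qed

lemma sections_fun_scale:
  assumes "f \<in> smooth_funs (base E)" "s \<in> sections E"
  shows "fun_scale f s \<in> sections E"
proof (rule sectionsI)
  show "fun_scale f s p \<in> fibre E p" for p
    using assms(2)[THEN section_in_fibre] subspace_scale[OF subspace_fibre] by (simp add: fun_scale_def)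
  fix U e i assume Ue: "(U, e) \<in> frames E" "i < vrank E"
  have "smooth_fun_on (base E) U f"
    using assms(1) smooth_fun_on_subset[OF vector_bundle_base, of U UNIV] by simp
  then have "smooth_fun_on (base E) U (\<lambda>p. f p * coframe E e i p (s p))"
    by (rule smooth_fun_on_mult[OF vector_bundle_base frameD(1)[OF Ue(1)] _ section_coefficient_smooth[OF assms(2) Ue]])
  then show "smooth_fun_on (base E) U (\<lambda>p. coframe E e i p (fun_scale f s p))"
    by (rule smooth_fun_on_cong[OF vector_bundle_base frameD(1)[OF Ue(1)], rotated])
      (use dual_fibreD(1)[OF coframe(1)[OF Ue(1) _ Ue(2)]] assms(2)[THEN section_in_fibre] in \<open>simp add: fun_scale_def\<close>)
qed

lemma const_smooth: "(\<lambda>_. c) \<in> smooth_funs (base E)"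
  by (simp add: smooth_fun_on_const[OF vector_bundle_base])

lemma sections_scaleR:
  assumes "s \<in> sections E"
  shows "c *\<^sub>R s \<in> sections E"
proof -
  have "c *\<^sub>R s = fun_scale (\<lambda>_. c) s" by (simp add: scaleR_fun_def fun_scale_def)
  then show ?thesis using sections_fun_scale[OF const_smooth assms] by simp
qed

lemma sections_uminus: "s \<in> sections E \<Longrightarrow> - s \<in> sections E"
  using sections_scaleR[of s "-1"] by simp

lemma sections_diff: "s \<in> sections E \<Longrightarrow> t \<in> sections E \<Longrightarrow> s - t \<in> sections E"
  using sections_add[of s "- t"] sections_uminus[of t] by simp

lemma zero_section: "0 \<in> sections E"
proof (rule sectionsI)
  show "0 p \<in> fibre E p" for p using subspace_0[OF subspace_fibre] by simp
  fix U e i assume Ue: "(U, e) \<in> frames E" "i < vrank E"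
  show "smooth_fun_on (base E) U (\<lambda>p. coframe E e i p (0 p))"
    by (rule smooth_fun_on_cong[OF vector_bundle_base frameD(1)[OF Ue(1)] _
          smooth_fun_on_const[OF vector_bundle_base frameD(1)[OF Ue(1)], of 0]])
      (use dual_fibre_zero[OF coframe(1)[OF Ue(1) _ Ue(2)]] in simp)
qed

lemma sections_sum:
  assumes "\<And>i. i \<in> I \<Longrightarrow> s i \<in> sections E"
  shows "(\<Sum>i\<in>I. s i) \<in> sections E"
  using assms by (induction I rule: infinite_finite_induct) (auto intro: sections_add zero_section)

lemma pairing_smooth:
  assumes "\<eta> \<in> dual_sections E" "s \<in> sections E"
  shows "pairing \<eta> s \<in> smooth_funs (base E)"
proof -
  have "smooth_fun_on (base E) UNIV (pairing \<eta> s)"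
  proof (rule smooth_fun_on_local[OF vector_bundle_base])
    fix p
    obtain U e where Ue: "(U, e) \<in> frames E" "p \<in> U" by (rule frame_cover)
    note U = frameD(1)[OF Ue(1)]
    have \<eta>: "\<eta> q \<in> dual_fibre E q" for q using assms(1) dual_sections_iff by blast
    have "smooth_fun_on (base E) U (\<lambda>q. \<Sum>i<vrank E. coframe E e i q (s q) * \<eta> q (e i q))"
      by (intro smooth_fun_on_sum smooth_fun_on_mult vector_bundle_base U section_coefficient_smooth[OF assms(2) Ue(1)])
        (use assms(1) Ue(1) in \<open>auto simp: dual_sections_iff\<close>)
    moreover have "(\<Sum>i<vrank E. coframe E e i q (s q) * \<eta> q (e i q)) = pairing \<eta> s q" if "q \<in> U" for q
      using dual_fibre_sum[OF \<eta>, of "{..<vrank E}" "\<lambda>i. e i q" q "\<lambda>i. coframe E e i q (s q)"]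
        frame_in_fibre[OF Ue(1) that] coframe_expansion[OF Ue(1) that section_in_fibre[OF assms(2)]]
      by (simp add: pairing_def)
    ultimately have "smooth_fun_on (base E) U (pairing \<eta> s)"
      by (rule smooth_fun_on_cong[OF vector_bundle_base U, rotated])
    then show "\<exists>N. open N \<and> p \<in> N \<and> smooth_fun_on (base E) (N \<inter> UNIV) (pairing \<eta> s)"
      using U Ue(2) by auto
  qed simp
  then show ?thesis by simp
qed

section \<open>Extension of local sections\<close>

(* Both maps multiply by a bump function and extend by zero. *)
lemma exists_extensions:
  assumes "open U" "p \<in> U"
  obtains N ef es where "open N" "p \<in> N" "N \<subseteq> U"
    "\<forall>f. smooth_fun_on (base E) U f \<longrightarrow> ef f \<in> smooth_funs (base E)"
    "\<forall>f. \<forall>q\<in>N. ef f q = f q"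
    "\<forall>s. smooth_section_on E U s \<longrightarrow> es s \<in> sections E"
    "\<forall>s. \<forall>q\<in>N. es s q = s q"
    "\<forall>s f. \<forall>q\<in>U. ef f q *\<^sub>R es s q = f q *\<^sub>R (ef (\<lambda>_. 1) q * ef (\<lambda>_. 1) q) *\<^sub>R s q"
    "\<forall>f q. q \<notin> U \<longrightarrow> ef f q = 0"
proof -
  note M = vector_bundle_base
  obtain \<rho> V C where bump: "smooth_fun_on (base E) UNIV \<rho>" "open V" "p \<in> V" "\<forall>q\<in>V. \<rho> q = 1"
    "closed C" "C \<subseteq> U" "\<forall>q. q \<notin> C \<longrightarrow> \<rho> q = 0"
    by (rule exists_bump_function[OF M assms])
  note r = bump[rule_format]
  have "V \<subseteq> U"
  proof
    fix q assume "q \<in> V"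
    then have "\<rho> q \<noteq> 0" using r(4) by simp
    then show "q \<in> U" using r(6,7) by blast
  qed
  have opC: "open (- C)" using r(5) by (simp add: open_closed)
  define ef :: "('m \<Rightarrow> real) \<Rightarrow> 'm \<Rightarrow> real" where "ef f q = (if q \<in> U then \<rho> q * f q else 0)" for f q
  define es :: "('m \<Rightarrow> 'v) \<Rightarrow> 'm \<Rightarrow> 'v" where "es s q = (if q \<in> U then \<rho> q *\<^sub>R s q else 0)" for s q
  \<comment> \<open>One gluing argument serves both extended functions and the coefficients of
    extended sections: g is rho g' on U and 0 off the closed set C.\<close>
  have glue: "smooth_fun_on (base E) W g"
    if W: "open W" and g: "smooth_fun_on (base E) (W \<inter> U) g'"
      "\<And>q. q \<in> W \<inter> U \<Longrightarrow> g q = \<rho> q * g' q" "\<And>q. q \<in> W \<Longrightarrow> q \<notin> C \<Longrightarrow> g q = 0" for W g g'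
  proof (rule smooth_fun_on_local[OF M W])
    fix q assume q: "q \<in> W"
    have WU: "open (W \<inter> U)" using W assms(1) by blast
    show "\<exists>N. open N \<and> q \<in> N \<and> smooth_fun_on (base E) (N \<inter> W) g"
    proof (cases "q \<in> C")
      case True
      have "smooth_fun_on (base E) (W \<inter> U) (\<lambda>q. \<rho> q * g' q)"
        by (rule smooth_fun_on_mult[OF M WU smooth_fun_on_subset[OF M _ r(1)] g(1)]) simp
      then have "smooth_fun_on (base E) (W \<inter> U) g"
        by (rule smooth_fun_on_cong[OF M WU, rotated]) (use g(2) in simp)
      then show ?thesis using True r(6) assms(1) by (intro exI[of _ U]) (auto simp: Int_commute)
    next
      case False
      have "smooth_fun_on (base E) (- C \<inter> W) g"
        by (rule smooth_fun_on_cong[OF M _ _ smooth_fun_on_const[OF M, of _ 0]]) (use g(3) W opC in auto)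
      then show ?thesis using False opC by blast
    qed
  qed
  have ef: "ef f \<in> smooth_funs (base E)" if "smooth_fun_on (base E) U f" for f
    using glue[of UNIV f "ef f"] that r(7) by (auto simp: ef_def)
  have es: "es s \<in> sections E" if s: "smooth_section_on E U s" for s
  proof (rule sectionsI)
    fix q show "es s q \<in> fibre E q"
      using s subspace_scale[OF subspace_fibre] subspace_0[OF subspace_fibre]
      by (simp add: es_def smooth_section_on_def)
  next
    fix W e i assume We: "(W, e) \<in> frames E" and i: "i < vrank E"
    show "smooth_fun_on (base E) W (\<lambda>q. coframe E e i q (es s q))"
    proof (rule glue[OF frameD(1)[OF We]])
      show "smooth_fun_on (base E) (W \<inter> U) (\<lambda>q. coframe E e i q (s q))"
        by (rule smooth_section_on_coefficient[OF assms(1) s We i])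
      show "coframe E e i q (es s q) = \<rho> q * coframe E e i q (s q)" if "q \<in> W \<inter> U" for q
        using that dual_fibreD(1)[OF coframe(1)[OF We _ i]] s by (simp add: es_def smooth_section_on_def)
      show "coframe E e i q (es s q) = 0" if "q \<in> W" "q \<notin> C" for q
        using r(7)[OF that(2)] dual_fibre_zero[OF coframe(1)[OF We that(1) i]] by (simp add: es_def)
    qed
  qed
  show ?thesis
  proof (rule that[of V ef es])
    show "open V" "p \<in> V" "V \<subseteq> U" by fact+
    show "\<forall>f. smooth_fun_on (base E) U f \<longrightarrow> ef f \<in> smooth_funs (base E)" using ef by blast
    show "\<forall>s. smooth_section_on E U s \<longrightarrow> es s \<in> sections E" using es by blast
  qed (use r(4) \<open>V \<subseteq> U\<close> in \<open>auto simp: ef_def es_def\<close>)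
qed

lemma exists_section_extension:
  assumes "open U" "p \<in> U"
  obtains N es where "open N" "p \<in> N" "N \<subseteq> U"
    "\<forall>s. smooth_section_on E U s \<longrightarrow> es s \<in> sections E" "\<forall>s. \<forall>q\<in>N. es s q = s q"
  by (rule exists_extensions[OF assms]) (rule that)

text \<open>Extend the frame from a neighbourhood of p and combine it with the coordinates of v as
  constants. This is the passage from a fibre to global sections.\<close>

lemma section_through:
  assumes "v \<in> fibre E p"
  obtains s where "s \<in> sections E" "s p = v"
proof -
  obtain U e where Ue: "(U, e) \<in> frames E" "p \<in> U" by (rule frame_cover)
  obtain N es where ext: "open N" "p \<in> N" "N \<subseteq> U"
    "\<forall>s. smooth_section_on E U s \<longrightarrow> es s \<in> sections E" "\<forall>s. \<forall>q\<in>N. es s q = s q"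
    by (rule exists_section_extension[OF frameD(1)[OF Ue(1)] Ue(2)])
  note N = ext(2,4,5)[rule_format]
  let ?s = "\<Sum>i<vrank E. coframe E e i p v *\<^sub>R es (e i)"
  have "?s \<in> sections E"
    by (intro sections_sum sections_scaleR N(2) frameD(2)[OF Ue(1)]) simp
  moreover have "?s p = v"
    using coframe_expansion[OF Ue assms] N(1,3) by (simp add: sum_fun_apply scaleR_fun_def)
  ultimately show ?thesis by (rule that)
qed

(* Write y as the sum of (rho c_i) (rho e_i) and (1 - rho^2) y for a bump function rho at p. *)
lemma vanishing_section_decomposition:
  assumes "y \<in> sections E" "y p = 0"
  obtains n f s where "\<forall>i<n. f i \<in> smooth_funs (base E) \<and> f i p = 0 \<and> s i \<in> sections E"
    "y = (\<Sum>i<n::nat. fun_scale (f i) (s i))"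
proof -
  note M = vector_bundle_base
  obtain U e where Ue: "(U, e) \<in> frames E" "p \<in> U" by (rule frame_cover)
  obtain N ef es where ext: "open N" "p \<in> N" "N \<subseteq> U"
    "\<forall>f. smooth_fun_on (base E) U f \<longrightarrow> ef f \<in> smooth_funs (base E)"
    "\<forall>f. \<forall>q\<in>N. ef f q = f q"
    "\<forall>s. smooth_section_on E U s \<longrightarrow> es s \<in> sections E"
    "\<forall>s. \<forall>q\<in>N. es s q = s q"
    "\<forall>s f. \<forall>q\<in>U. ef f q *\<^sub>R es s q = f q *\<^sub>R (ef (\<lambda>_. 1) q * ef (\<lambda>_. 1) q) *\<^sub>R s q"
    "\<forall>f q. q \<notin> U \<longrightarrow> ef f q = 0"
    by (rule exists_extensions[OF frameD(1)[OF Ue(1)] Ue(2)])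
  note N = ext(2,4,5,6,8,9)[rule_format]
  define r where "r = vrank E"
  define c where "c i q = coframe E e i q (y q)" for i q
  define \<rho> where "\<rho> = ef (\<lambda>_. 1)"
  \<comment> \<open>The index r carries the remainder term; its factor vanishes at p because rho is
    1 there.\<close>
  define f where "f i = (if i < r then ef (c i) else (\<lambda>q. 1 - \<rho> q * \<rho> q))" for i
  define s where "s i = (if i < r then es (e i) else y)" for i
  have \<rho>: "smooth_fun_on (base E) UNIV \<rho>" "\<rho> p = 1"
    using N(1,2,3) smooth_fun_on_const[OF M frameD(1)[OF Ue(1)]] by (auto simp: \<rho>_def)
  show ?thesis
  proof (rule that[of "Suc r" f s], intro allI impI)
    fix i assume "i < Suc r"
    have "f i \<in> smooth_funs (base E)"
    proof (cases "i < r")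
      case True
      then have "smooth_fun_on (base E) U (c i)"
        unfolding c_def r_def by (rule section_coefficient_smooth[OF assms(1) Ue(1)])
      then show ?thesis using N(2) True by (simp add: f_def)
    next
      case False
      have "smooth_fun_on (base E) UNIV (\<lambda>q. 1 - \<rho> q * \<rho> q)"
        by (intro smooth_fun_on_diff smooth_fun_on_mult smooth_fun_on_const M \<rho>) auto
      then show ?thesis using False by (simp add: f_def)
    qed
    moreover have "f i p = 0"
    proof (cases "i < r")
      case True
      then have "coframe E e i p 0 = 0" unfolding r_def by (intro dual_fibre_zero[OF coframe(1)[OF Ue]])
      then show ?thesis using True assms(2) N(3)[OF N(1)] by (simp add: f_def c_def)
    qed (simp add: f_def \<rho>(2))
    moreover have "s i \<in> sections E"
      using assms(1) N(4) frameD(2)[OF Ue(1)] by (simp add: s_def r_def)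
    ultimately show "f i \<in> smooth_funs (base E) \<and> f i p = 0 \<and> s i \<in> sections E" by blast
  next
    show "y = (\<Sum>i<Suc r. fun_scale (f i) (s i))"
    proof
      fix q
      have *: "(\<Sum>i<Suc r. fun_scale (f i) (s i)) q =
          (\<Sum>i<r. ef (c i) q *\<^sub>R es (e i) q) + (1 - \<rho> q * \<rho> q) *\<^sub>R y q"
        by (simp add: sum_fun_apply fun_scale_def f_def s_def)
      show "y q = (\<Sum>i<Suc r. fun_scale (f i) (s i)) q"
      proof (cases "q \<in> U")
        case True
        have "(\<Sum>i<r. ef (c i) q *\<^sub>R es (e i) q) = (\<Sum>i<r. (\<rho> q * \<rho> q) *\<^sub>R c i q *\<^sub>R e i q)"
          by (rule sum.cong) (use N(5)[OF True] in \<open>auto simp: \<rho>_def\<close>)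
        also have "\<dots> = (\<rho> q * \<rho> q) *\<^sub>R y q"
          using coframe_expansion[OF Ue(1) True section_in_fibre[OF assms(1)], symmetric]
          by (simp only: c_def r_def flip: scaleR_sum_right)
        finally show ?thesis using * by (simp add: algebra_simps)
      next
        case False
        \<comment> \<open>Off U all extensions are 0, in particular rho, so the remainder is y
          itself.\<close>
        then show ?thesis using * N(6) by (simp add: \<rho>_def)
      qed
    qed
  qed
qed

end

section \<open>Tensoriality\<close>

definition tensorial ::
    "('m, 'v::real_vector, 'z) vbundle_scheme \<Rightarrow> nat \<Rightarrow> (('m \<Rightarrow> 'v) list \<Rightarrow> 'm \<Rightarrow> real) \<Rightarrow> bool"
  where "tensorial E k G \<longleftrightarrow> (\<forall>ss. length ss = k \<and> set ss \<subseteq> sections E \<longrightarrow>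
    G ss \<in> smooth_funs (base E) \<and>
    (\<forall>i<k. (\<forall>f\<in>smooth_funs (base E). G (ss[i := fun_scale f (ss ! i)]) = f * G ss) \<and>
           (\<forall>s\<in>sections E. G (ss[i := ss ! i + s]) = G ss + G (ss[i := s]))))"

text \<open>\<open>SOME\<close> picks an arbitrary global section through each vector;
  \<open>tensorial_cong\<close> shows that the choice does not affect the value at p.\<close>

definition induced_field ::
    "('m, 'v::real_vector, 'z) vbundle_scheme \<Rightarrow> nat \<Rightarrow> (('m \<Rightarrow> 'v) list \<Rightarrow> 'm \<Rightarrow> real) \<Rightarrow>
     'm \<Rightarrow> 'v list \<Rightarrow> real"
  where "induced_field E k G p vs = (if length vs = k \<and> set vs \<subseteq> fibre E p
    then G (map (\<lambda>v. SOME s. s \<in> sections E \<and> s p = v) vs) p else 0)"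

lemma tensorialD:
  assumes "tensorial E k G" "length ss = k" "set ss \<subseteq> sections E"
  shows "G ss \<in> smooth_funs (base E)"
    and "i < k \<Longrightarrow> f \<in> smooth_funs (base E) \<Longrightarrow> G (ss[i := fun_scale f (ss ! i)]) = f * G ss"
    and "i < k \<Longrightarrow> s \<in> sections E \<Longrightarrow> G (ss[i := ss ! i + s]) = G ss + G (ss[i := s])"
  using assms unfolding tensorial_def by blast+

lemma set_list_update_subset: "set xs \<subseteq> A \<Longrightarrow> x \<in> A \<Longrightarrow> set (xs[i := x]) \<subseteq> A"
  using set_update_subset_insert[of xs i x] by blast

context
  fixes E :: "('m::{t2_space, second_countable_topology}, 'v::real_vector, 'z) vbundle_scheme"
  assumes E: "vector_bundle E"
begin

lemma smooth_funs_add: "f \<in> smooth_funs (base E) \<Longrightarrow> g \<in> smooth_funs (base E) \<Longrightarrow> f + g \<in> smooth_funs (base E)"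
  using smooth_fun_on_add[OF vector_bundle_base[OF E], of UNIV f g] by (simp add: plus_fun_def)

lemma smooth_funs_mult: "f \<in> smooth_funs (base E) \<Longrightarrow> g \<in> smooth_funs (base E) \<Longrightarrow> f * g \<in> smooth_funs (base E)"
  using smooth_fun_on_mult[OF vector_bundle_base[OF E], of UNIV f g] by (simp add: times_fun_def)

lemma smooth_funs_diff: "f \<in> smooth_funs (base E) \<Longrightarrow> g \<in> smooth_funs (base E) \<Longrightarrow> f - g \<in> smooth_funs (base E)"
  using smooth_fun_on_diff[OF vector_bundle_base[OF E], of UNIV f g] by (simp add: fun_diff_def)

lemma smooth_funs_uminus: "f \<in> smooth_funs (base E) \<Longrightarrow> - f \<in> smooth_funs (base E)"
  using smooth_fun_on_minus[OF vector_bundle_base[OF E], of UNIV f] by (simp add: fun_Compl_def)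

text \<open>Writing y as a sum of f_i s_i with f_i(p) = 0 gives (F y)(p) as the sum of f_i(p) (F
  s_i)(p), which is 0.\<close>

lemma additive_homogeneous_vanishes:
  assumes add: "\<And>s t. s \<in> sections E \<Longrightarrow> t \<in> sections E \<Longrightarrow> F (s + t) = F s + F t"
    and scale: "\<And>f s. f \<in> smooth_funs (base E) \<Longrightarrow> s \<in> sections E \<Longrightarrow> F (fun_scale f s) = f * F s"
    and y: "y \<in> sections E" "y p = 0"
  shows "F y p = (0 :: real)"
proof -
  obtain n f s where fs: "\<forall>i<n. f i \<in> smooth_funs (base E) \<and> f i p = 0 \<and> s i \<in> sections E"
    and y_eq: "y = (\<Sum>i<n::nat. fun_scale (f i) (s i))"
    by (rule vanishing_section_decomposition[OF E y])
  have "F 0 = F 0 + F 0" using add[OF zero_section[OF E] zero_section[OF E]] by simp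
  then have "F 0 = 0" by simp
  \<comment> \<open>Additivity of F is known on sections only, so membership of the partial sums is
    carried along in the induction.\<close>
  have "(\<Sum>i<j. fun_scale (f i) (s i)) \<in> sections E \<and> F (\<Sum>i<j. fun_scale (f i) (s i)) p = 0"
    if "j \<le> n" for j
    using that
  proof (induction j)
    case 0
    then show ?case using \<open>F 0 = 0\<close> zero_section[OF E] by (simp add: zero_fun_def)
  next
    case (Suc j)
    then have IH: "(\<Sum>i<j. fun_scale (f i) (s i)) \<in> sections E" "F (\<Sum>i<j. fun_scale (f i) (s i)) p = 0"
      by simp_all
    have j: "f j \<in> smooth_funs (base E)" "f j p = 0" "s j \<in> sections E" using fs Suc.prems by auto
    note fsj = sections_fun_scale[OF E j(1,3)]
    show ?case using add[OF IH(1) fsj] scale[OF j(1,3)] j(2) IH sections_add[OF E IH(1) fsj]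
      by (simp add: plus_fun_def)
  qed
  then show ?thesis using y_eq by blast
qed

text \<open>By additivity in slot i it is enough to treat s - t, a section that vanishes at
  p.\<close>

lemma tensorial_update_cong:
  assumes G: "tensorial E k G" and ss: "length ss = k" "set ss \<subseteq> sections E" and i: "i < k"
    and st: "s \<in> sections E" "t \<in> sections E" "s p = t p"
  shows "G (ss[i := s]) p = G (ss[i := t]) p"
proof -
  note upd = set_list_update_subset[OF ss(2)]
  have add: "G (ss[i := u + v]) = G (ss[i := u]) + G (ss[i := v])"
    if "u \<in> sections E" "v \<in> sections E" for u v
    using tensorialD(3)[OF G, of "ss[i := u]" i v] upd[OF that(1)] ss(1) i that(2) by simp
  have "G (ss[i := s - t]) p = 0"
  proof (rule additive_homogeneous_vanishes[where F = "\<lambda>u. G (ss[i := u])"])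
    show "G (ss[i := fun_scale f u]) = f * G (ss[i := u])"
      if "f \<in> smooth_funs (base E)" "u \<in> sections E" for f u
      using tensorialD(2)[OF G, of "ss[i := u]" i f] upd[OF that(2)] ss(1) i that(1) by simp
    show "s - t \<in> sections E" "(s - t) p = 0" using st sections_diff[OF E] by auto
  qed (rule add)
  then show ?thesis using add[OF st(2), of "s - t"] sections_diff[OF E st(1,2)] by simp
qed

text \<open>The entries are exchanged one at a time; after j steps the list is
  \<open>take j ts @ drop j ss\<close>.\<close>

lemma tensorial_cong:
  assumes G: "tensorial E k G" and ss: "length ss = k" "set ss \<subseteq> sections E"
    and ts: "length ts = k" "set ts \<subseteq> sections E"
    and eq: "map (\<lambda>s. s p) ss = map (\<lambda>s. s p) ts"
  shows "G ss p = G ts p"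
proof -
  have "G (take j ts @ drop j ss) p = G ss p" if "j \<le> k" for j
    using that
  proof (induction j)
    case (Suc j)
    then have j: "j < k" by simp
    let ?us = "take j ts @ drop j ss"
    have us: "length ?us = k" "set ?us \<subseteq> sections E"
      using ss ts j by (auto dest: in_set_takeD in_set_dropD)
    have "take (Suc j) ts @ drop (Suc j) ss = ?us[j := ts ! j]"
      using ss(1) ts(1) j by (simp add: take_Suc_conv_app_nth list_update_append Cons_nth_drop_Suc[symmetric])
    moreover have "?us = ?us[j := ss ! j]"
      using ss(1) ts(1) j by (intro list_update_same_conv[THEN iffD2, symmetric]) (auto simp: nth_append)
    moreover have "G (?us[j := ts ! j]) p = G (?us[j := ss ! j]) p"
    proof (rule tensorial_update_cong[OF G us j])
      show "ts ! j \<in> sections E" "ss ! j \<in> sections E" using j ss ts by auto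
      show "(ts ! j) p = (ss ! j) p" using eq j ss(1) ts(1) by (metis nth_map)
    qed
    ultimately show ?case using Suc.IH j by simp
  qed simp
  from this[of k] show ?thesis using ss(1) ts(1) by simp
qed

lemma sections_through:
  assumes "set vs \<subseteq> fibre E p"
  obtains ss where "length ss = length vs" "set ss \<subseteq> sections E" "map (\<lambda>s. s p) ss = vs"
proof -
  have "\<forall>v\<in>set vs. \<exists>s. s \<in> sections E \<and> s p = v" using section_through[OF E] assms by blast
  then obtain S where S: "\<And>v. v \<in> set vs \<Longrightarrow> S v \<in> sections E \<and> S v p = v" by metis
  show ?thesis
    by (rule that[of "map S vs"]) (use S in \<open>auto simp: map_idI\<close>)
qed

context
  fixes k G
  assumes G: "tensorial E k G"
begin

section \<open>The tensor field of a function-multilinear map\<close>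

lemma induced_field_eq:
  assumes "length ss = k" "set ss \<subseteq> sections E"
  shows "induced_field E k G p (map (\<lambda>s. s p) ss) = G ss p"
proof -
  let ?S = "\<lambda>v. SOME s. s \<in> sections E \<and> s p = v"
  have S: "?S v \<in> sections E \<and> ?S v p = v" if v: "v \<in> fibre E p" for v
  proof -
    obtain s where "s \<in> sections E" "s p = v" by (rule section_through[OF E v])
    then show ?thesis by (intro someI_ex[of "\<lambda>s. s \<in> sections E \<and> s p = v"]) blast
  qed
  have fib: "s p \<in> fibre E p" if "s \<in> set ss" for s
    using that assms(2) section_in_fibre[OF E] by blast
  have "G (map ?S (map (\<lambda>s. s p) ss)) p = G ss p"
    by (rule tensorial_cong[OF G]) (use assms S fib in auto)
  then show ?thesis using assms(1) fib by (auto simp: induced_field_def)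
qed

lemma induced_field_outside:
  "\<not> (length vs = k \<and> set vs \<subseteq> fibre E p) \<Longrightarrow> induced_field E k G p vs = 0"
  by (auto simp: induced_field_def)

lemma induced_field_update:
  assumes "length vs = k" "set vs \<subseteq> fibre E p" "i < k"
  shows "induced_field E k G p (vs[i := c *\<^sub>R vs ! i]) = c * induced_field E k G p vs"
    and "v \<in> fibre E p \<Longrightarrow> induced_field E k G p (vs[i := vs ! i + v]) =
      induced_field E k G p vs + induced_field E k G p (vs[i := v])"
proof -
  obtain ss where ss: "length ss = length vs" "set ss \<subseteq> sections E" "map (\<lambda>s. s p) ss = vs"
    by (rule sections_through[OF assms(2)])
  have len: "length ss = k" using ss(1) assms(1) by simp
  have i: "vs ! i = (ss ! i) p" using ss(3) len assms(3) by auto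
  have ssi: "ss ! i \<in> sections E" using ss(2) len assms(3) by auto
  let ?f = "\<lambda>_. c"
  have f: "?f \<in> smooth_funs (base E)" by (rule const_smooth[OF E])
  have "vs[i := c *\<^sub>R vs ! i] = map (\<lambda>s. s p) (ss[i := fun_scale ?f (ss ! i)])"
    using ss(3) i by (simp add: map_update fun_scale_def)
  also have "induced_field E k G p \<dots> = G (ss[i := fun_scale ?f (ss ! i)]) p"
    by (rule induced_field_eq)
      (use len set_list_update_subset[OF ss(2) sections_fun_scale[OF E f ssi]] in simp_all)
  also have "\<dots> = c * G ss p" using tensorialD(2)[OF G len ss(2) assms(3) f] by simp
  also have "\<dots> = c * induced_field E k G p vs" using induced_field_eq[OF len ss(2), of p, unfolded ss(3)] by simp
  finally show "induced_field E k G p (vs[i := c *\<^sub>R vs ! i]) = c * induced_field E k G p vs" .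
  assume "v \<in> fibre E p"
  then obtain t where t: "t \<in> sections E" "t p = v" by (rule section_through[OF E])
  have "vs[i := vs ! i + v] = map (\<lambda>s. s p) (ss[i := ss ! i + t])"
    using ss(3) i t(2) by (simp add: map_update)
  also have "induced_field E k G p \<dots> = G (ss[i := ss ! i + t]) p"
    by (rule induced_field_eq) (use len set_list_update_subset[OF ss(2) sections_add[OF E ssi t(1)]] in simp_all)
  also have "\<dots> = G ss p + G (ss[i := t]) p"
    using tensorialD(3)[OF G len ss(2) assms(3) t(1)] by simp
  also have "G ss p = induced_field E k G p vs" using induced_field_eq[OF len ss(2), of p, unfolded ss(3)] by simp
  also have "G (ss[i := t]) p = induced_field E k G p (map (\<lambda>s. s p) (ss[i := t]))"
    by (rule induced_field_eq[symmetric]) (use len set_list_update_subset[OF ss(2) t(1)] in simp_all)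
  also have "map (\<lambda>s. s p) (ss[i := t]) = vs[i := v]" using ss(3) t(2) by (simp add: map_update)
  finally show "induced_field E k G p (vs[i := vs ! i + v]) =
      induced_field E k G p vs + induced_field E k G p (vs[i := v])" .
qed

text \<open>The extensions of the frame agree with the frame on a whole neighbourhood N of p and not
  just at p. On N the field is therefore the value of G on one fixed list of global sections, which
  is smooth.\<close>

lemma induced_field_smooth:
  assumes Ue: "(U, e) \<in> frames E" and "length is = k" "set is \<subseteq> {..<vrank E}"
  shows "smooth_fun_on (base E) U (\<lambda>p. induced_field E k G p (map (\<lambda>i. e i p) is))"
proof (rule smooth_fun_on_local[OF vector_bundle_base[OF E] frameD(1)[OF E Ue]])
  note M = vector_bundle_base[OF E]
  fix p assume p: "p \<in> U"
  obtain N es where ext: "open N" "p \<in> N" "N \<subseteq> U"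
    "\<forall>s. smooth_section_on E U s \<longrightarrow> es s \<in> sections E" "\<forall>s. \<forall>q\<in>N. es s q = s q"
    by (rule exists_section_extension[OF E frameD(1)[OF E Ue] p])
  let ?ss = "map (\<lambda>i. es (e i)) is"
  have ss: "length ?ss = k" "set ?ss \<subseteq> sections E"
    using assms(2,3) ext(4) frameD(2)[OF E Ue] by auto
  have "smooth_fun_on (base E) UNIV (G ?ss)" using tensorialD(1)[OF G ss] by simp
  then have "smooth_fun_on (base E) N (G ?ss)" by (rule smooth_fun_on_subset[OF M, rotated]) simp
  then have "smooth_fun_on (base E) N (\<lambda>p. induced_field E k G p (map (\<lambda>i. e i p) is))"
  proof (rule smooth_fun_on_cong[OF M ext(1), rotated])
    fix q assume "q \<in> N"
    then have m: "map (\<lambda>s. s q) ?ss = map (\<lambda>i. e i q) is" using ext(5) by simp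
    show "G ?ss q = induced_field E k G q (map (\<lambda>i. e i q) is)"
      by (rule induced_field_eq[OF ss, of q, unfolded m, symmetric])
  qed
  then show "\<exists>N. open N \<and> p \<in> N \<and>
      smooth_fun_on (base E) (N \<inter> U) (\<lambda>p. induced_field E k G p (map (\<lambda>i. e i p) is))"
    using ext(1-3) by (intro exI[of _ N]) (simp add: Int_absorb2)
qed

end

section \<open>Covector fields and cochains from their values on sections\<close>

lemma dual_section_unique:
  assumes "\<eta> \<in> dual_sections E" "\<theta> \<in> dual_sections E"
    and "\<And>y. y \<in> sections E \<Longrightarrow> pairing \<eta> y = pairing \<theta> y"
  shows "\<eta> = \<theta>"
proof
  fix p
  show "\<eta> p = \<theta> p"
  proof (rule dual_fibre_eqI)
    show "\<eta> p \<in> dual_fibre E p" "\<theta> p \<in> dual_fibre E p"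
      using assms(1,2) dual_sections_iff[OF E] by blast+
    fix u assume "u \<in> fibre E p"
    then obtain y where "y \<in> sections E" "y p = u" by (rule section_through[OF E])
    then show "\<eta> p u = \<theta> p u" using assms(3)[of y] by (metis pairing_def)
  qed
qed

text \<open>Tensoriality with one argument. The form of unique existence is the one that the
  definite descriptions \<open>L_op\<close> and \<open>R_op\<close> require.\<close>

lemma exists_dual_section:
  assumes smooth: "\<And>s. s \<in> sections E \<Longrightarrow> F s \<in> smooth_funs (base E)"
    and add: "\<And>s t. s \<in> sections E \<Longrightarrow> t \<in> sections E \<Longrightarrow> F (s + t) = F s + F t"
    and scale: "\<And>f s. f \<in> smooth_funs (base E) \<Longrightarrow> s \<in> sections E \<Longrightarrow> F (fun_scale f s) = f * F s"
  shows "\<exists>!\<eta>. \<eta> \<in> dual_sections E \<and> (\<forall>y\<in>sections E. pairing \<eta> y = F y)"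
proof (rule ex_ex1I)
  let ?G = "\<lambda>ss. F (hd ss)"
  have G: "tensorial E 1 ?G"
    unfolding tensorial_def
  proof (intro allI impI)
    fix ss assume "length ss = 1 \<and> set ss \<subseteq> sections E"
    then obtain s where s: "ss = [s]" "s \<in> sections E" by (cases ss) auto
    show "F (hd ss) \<in> smooth_funs (base E) \<and>
      (\<forall>i<1. (\<forall>f\<in>smooth_funs (base E). F (hd (ss[i := fun_scale f (ss ! i)])) = f * F (hd ss)) \<and>
           (\<forall>t\<in>sections E. F (hd (ss[i := ss ! i + t])) = F (hd ss) + F (hd (ss[i := t]))))"
      using smooth[OF s(2)] add[OF s(2)] scale[OF _ s(2)] s(1) by simp
  qed
  define T where "T = induced_field E 1 ?G"
  define \<eta> where "\<eta> p v = T p [v]" for p v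
  have "\<eta> p \<in> dual_fibre E p" for p
    unfolding dual_fibre_def
  proof (intro CollectI conjI ballI allI impI)
    fix u c assume "u \<in> fibre E p"
    then show "\<eta> p (c *\<^sub>R u) = c * \<eta> p u"
      using induced_field_update(1)[OF G, of "[u]" p 0 c] by (simp add: \<eta>_def T_def)
  next
    fix u v assume "u \<in> fibre E p" "v \<in> fibre E p"
    then show "\<eta> p (u + v) = \<eta> p u + \<eta> p v"
      using induced_field_update(2)[OF G, of "[u]" p 0 v] by (simp add: \<eta>_def T_def)
  next
    fix v assume "v \<notin> fibre E p"
    then show "\<eta> p v = 0" using induced_field_outside[OF G, of "[v]" p] by (simp add: \<eta>_def T_def)
  qed
  moreover have "smooth_fun_on (base E) U (\<lambda>p. \<eta> p (e i p))"
    if "(U, e) \<in> frames E" "i < vrank E" for U e i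
    using induced_field_smooth[OF G that(1), of "[i]"] that(2) by (simp add: \<eta>_def T_def)
  ultimately have "\<eta> \<in> dual_sections E" unfolding dual_sections_iff[OF E] by blast
  moreover have "pairing \<eta> y = F y" if "y \<in> sections E" for y
  proof
    fix p show "pairing \<eta> y p = F y p"
      using induced_field_eq[OF G, of "[y]" p] that by (simp add: pairing_def \<eta>_def T_def)
  qed
  ultimately show "\<exists>\<eta>. \<eta> \<in> dual_sections E \<and> (\<forall>y\<in>sections E. pairing \<eta> y = F y)" by blast
next
  fix \<eta> \<theta>
  assume "\<eta> \<in> dual_sections E \<and> (\<forall>y\<in>sections E. pairing \<eta> y = F y)"
    "\<theta> \<in> dual_sections E \<and> (\<forall>y\<in>sections E. pairing \<theta> y = F y)"
  then show "\<eta> = \<theta>" by (intro dual_section_unique) auto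
qed

lemma covecs_through:
  assumes "cs \<in> covecs E k p"
  obtains xs where "length xs = k" "set xs \<subseteq> dual_sections E" "map (\<lambda>\<xi>. \<xi> p) xs = cs"
proof -
  have "\<exists>\<xi>. \<xi> \<in> dual_sections E \<and> \<xi> p = v" if "v \<in> dual_fibre E p" for v
    using section_through[OF vector_bundle_dual[OF E], of v p] that by (metis dual_bundle_simps(3))
  then obtain S where S: "\<And>v. v \<in> dual_fibre E p \<Longrightarrow> S v \<in> dual_sections E \<and> S v p = v" by metis
  show ?thesis
    by (rule that[of "map S cs"]) (use S assms in \<open>auto simp: covecs_def intro!: map_idI\<close>)
qed

lemma dual_section_at: "\<xi> \<in> dual_sections E \<Longrightarrow> \<xi> p \<in> dual_fibre E p"
  using dual_sections_iff[OF E] by blast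

lemma covecs_of_sections:
  "length xs = k \<Longrightarrow> set xs \<subseteq> dual_sections E \<Longrightarrow> map (\<lambda>\<xi>. \<xi> p) xs \<in> covecs E k p"
  using dual_section_at by (auto simp: covecs_def)

end

text \<open>The arguments of a cochain are covectors, so the induced field is formed over the dual
  bundle, whose frames are the coframes. Skewness in all slots but the last, the tensor factor A,
  passes from sections to points by lifting covectors.\<close>

lemma exists_kv_cochain:
  fixes E :: "('m::{t2_space, second_countable_topology}, 'v::real_vector, 'z) vbundle_scheme"
  assumes E: "vector_bundle E" and G: "tensorial (dual_bundle E) k G"
    and skew: "\<And>cs i l. length cs = k \<Longrightarrow> set cs \<subseteq> dual_sections E \<Longrightarrow> i < l \<Longrightarrow> l < k - 1 \<Longrightarrow>
      G (cs[i := cs ! l, l := cs ! i]) = - G cs"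
  obtains T where "T \<in> kv_cochains E k"
    "\<forall>cs. length cs = k \<and> set cs \<subseteq> dual_sections E \<longrightarrow> eval_field T cs = G cs"
proof -
  note D = vector_bundle_dual[OF E]
  define T where "T = induced_field (dual_bundle E) k G"
  have ev: "T p (map (\<lambda>\<alpha>. \<alpha> p) cs) = G cs p" if "length cs = k" "set cs \<subseteq> dual_sections E" for p cs
    unfolding T_def by (rule induced_field_eq[OF D G that])
  have "multilinear_field E k (k - 1) T"
    unfolding multilinear_field_def
  proof (intro conjI allI impI ballI)
    fix p cs assume "cs \<notin> covecs E k p"
    then show "T p cs = 0" unfolding T_def by (intro induced_field_outside[OF D G]) (simp add: covecs_def)
  next
    fix p cs i c assume "cs \<in> covecs E k p" "i < k"
    then show "T p (cs[i := c *\<^sub>R cs ! i]) = c *\<^sub>R T p cs"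
      unfolding T_def using induced_field_update(1)[OF D G, of cs p i c] by (simp add: covecs_def)
  next
    fix p cs i \<xi> assume "cs \<in> covecs E k p" "i < k" "\<xi> \<in> dual_fibre E p"
    then show "T p (cs[i := cs ! i + \<xi>]) = T p cs + T p (cs[i := \<xi>])"
      unfolding T_def using induced_field_update(2)[OF D G, of cs p i \<xi>] by (simp add: covecs_def)
  next
    fix p cs i l assume a: "cs \<in> covecs E k p" and il: "i < l \<and> l < k - 1"
    obtain xs where xs: "length xs = k" "set xs \<subseteq> dual_sections E" "map (\<lambda>\<xi>. \<xi> p) xs = cs"
      by (rule covecs_through[OF E a])
    let ?xs = "xs[i := xs ! l, l := xs ! i]"
    have "map (\<lambda>\<xi>. \<xi> p) ?xs = cs[i := cs ! l, l := cs ! i]"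
      using xs(1,3) il by (auto simp: map_update)
    moreover have "length ?xs = k" using xs(1) by simp
    moreover have "set ?xs \<subseteq> dual_sections E"
      using xs(1,2) il by (intro set_list_update_subset) auto
    ultimately show "T p (cs[i := cs ! l, l := cs ! i]) = - T p cs"
      using ev[of ?xs p] ev[OF xs(1,2), of p] skew[OF xs(1,2), of i l] il xs(3) by simp
  qed
  moreover have "smooth_fun_on (base E) U (\<lambda>p. T p (map (\<lambda>i. coframe E e i p) is))"
    if "(U, e) \<in> frames E" "length is = k" "set is \<subseteq> {..<vrank E}" for U e "is"
    using induced_field_smooth[OF D G, of U "coframe E e" "is"] that by (force simp: T_def)
  ultimately have "T \<in> kv_cochains E k" unfolding kv_cochains_def by blast
  then show ?thesis using ev by (intro that[of T]) (auto simp: eval_field_def fun_eq_iff)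
qed

section \<open>The map Psi\<close>

lemma multilinear_fieldD:
  assumes "multilinear_field E k j T" "cs \<in> covecs E k p"
  shows "i < k \<Longrightarrow> T p (cs[i := c *\<^sub>R cs ! i]) = c *\<^sub>R T p cs"
    and "i < k \<Longrightarrow> \<xi> \<in> dual_fibre E p \<Longrightarrow> T p (cs[i := cs ! i + \<xi>]) = T p cs + T p (cs[i := \<xi>])"
    and "i < l \<Longrightarrow> l < j \<Longrightarrow> T p (cs[i := cs ! l, l := cs ! i]) = - T p cs"
  using assms unfolding multilinear_field_def by blast+

lemma multilinear_field_outside: "multilinear_field E k j T \<Longrightarrow> cs \<notin> covecs E k p \<Longrightarrow> T p cs = 0"
  unfolding multilinear_field_def by blast

lemma kv_cochainsD:
  assumes "\<phi> \<in> kv_cochains E k"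
  shows "multilinear_field E k (k - 1) \<phi>"
    and "(U, e) \<in> frames E \<Longrightarrow> length is = k \<Longrightarrow> set is \<subseteq> {..<vrank E} \<Longrightarrow>
      smooth_fun_on (base E) U (\<lambda>p. \<phi> p (map (\<lambda>i. coframe E e i p) is))"
  using assms unfolding kv_cochains_def by blast+

lemma covecs_snoc: "cs @ [\<beta>] \<in> covecs E (Suc k) p \<longleftrightarrow> cs \<in> covecs E k p \<and> \<beta> \<in> dual_fibre E p"
  by (auto simp: covecs_def)

context
  fixes E :: "('m::{t2_space, second_countable_topology}, 'v::real_vector, 'z) vbundle_scheme"
  assumes E: "vector_bundle E"
begin

lemma kv_cochain_last_sum:
  assumes \<phi>: "\<phi> \<in> kv_cochains E (Suc k)" and cs: "cs \<in> covecs E k p"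
    and f: "\<And>i. i \<in> I \<Longrightarrow> f i \<in> dual_fibre E p"
  shows "\<phi> p (cs @ [\<Sum>i\<in>I. c i *\<^sub>R f i]) = (\<Sum>i\<in>I. c i * \<phi> p (cs @ [f i]))"
proof -
  note ml = multilinear_fieldD[OF kv_cochainsD(1)[OF \<phi>]]
  have len: "length cs = k" using cs by (simp add: covecs_def)
  have scale: "\<phi> p (cs @ [c *\<^sub>R \<beta>]) = c * \<phi> p (cs @ [\<beta>])" if "\<beta> \<in> dual_fibre E p" for c \<beta>
    using ml(1)[of "cs @ [\<beta>]" p k c] covecs_snoc[of cs \<beta> E k p] that cs len
    by (simp add: list_update_append nth_append)
  have add: "\<phi> p (cs @ [\<beta> + \<gamma>]) = \<phi> p (cs @ [\<beta>]) + \<phi> p (cs @ [\<gamma>])"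
    if "\<beta> \<in> dual_fibre E p" "\<gamma> \<in> dual_fibre E p" for \<beta> \<gamma>
    using ml(2)[of "cs @ [\<beta>]" p k \<gamma>] covecs_snoc[of cs \<beta> E k p] that cs len
    by (simp add: list_update_append nth_append)
  have zero: "\<phi> p (cs @ [0]) = 0"
    using scale[of 0 0] subspace_0[OF subspace_dual_fibre[of E p]] by simp
  show ?thesis
    using f
  proof (induction I rule: infinite_finite_induct)
    case (insert x F)
    then have "(\<Sum>i\<in>F. c i *\<^sub>R f i) \<in> dual_fibre E p" "c x *\<^sub>R f x \<in> dual_fibre E p"
      by (auto intro!: subspace_sum subspace_scale subspace_dual_fibre)
    then have "\<phi> p (cs @ [c x *\<^sub>R f x + (\<Sum>i\<in>F. c i *\<^sub>R f i)]) =
        \<phi> p (cs @ [c x *\<^sub>R f x]) + \<phi> p (cs @ [\<Sum>i\<in>F. c i *\<^sub>R f i])"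
      by (intro add)
    moreover have "\<phi> p (cs @ [\<Sum>i\<in>F. c i *\<^sub>R f i]) = (\<Sum>i\<in>F. c i * \<phi> p (cs @ [f i]))"
      using insert.IH insert.prems by simp
    moreover have "\<phi> p (cs @ [c x *\<^sub>R f x]) = c x * \<phi> p (cs @ [f x])"
      using insert.prems by (intro scale) simp
    ultimately show ?case by (simp only: sum.insert[OF insert.hyps])
  next
    case (infinite I)
    show ?case by (simp only: sum.infinite[OF infinite.hyps] zero)
  next
    case empty
    show ?case by (simp only: sum.empty zero)
  qed
qed

lemma Psi_unique:
  assumes "v \<in> fibre E p" "\<And>\<beta>. \<beta> \<in> dual_fibre E p \<Longrightarrow> \<beta> v = \<phi> p (cs @ [\<beta>])"
  shows "Psi E \<phi> p cs = v"
  unfolding Psi_def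
proof (rule the_equality)
  show "v \<in> fibre E p \<and> (\<forall>\<beta>\<in>dual_fibre E p. \<beta> v = \<phi> p (cs @ [\<beta>]))" using assms by blast
  fix w assume w: "w \<in> fibre E p \<and> (\<forall>\<beta>\<in>dual_fibre E p. \<beta> w = \<phi> p (cs @ [\<beta>]))"
  show "w = v"
  proof (rule covector_separates[OF E _ assms(1)])
    show "\<xi> w = \<xi> v" if "\<xi> \<in> dual_fibre E p" for \<xi> using w assms(2) that by simp
  qed (use w in blast)
qed

lemma Psi_outside:
  assumes "\<phi> \<in> kv_cochains E (Suc k)" "cs \<notin> covecs E k p"
  shows "Psi E \<phi> p cs = 0"
proof (rule Psi_unique)
  show "0 \<in> fibre E p" by (rule subspace_0[OF subspace_fibre[OF E]])
  fix \<beta> assume "\<beta> \<in> dual_fibre E p"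
  moreover have "cs @ [\<beta>] \<notin> covecs E (Suc k) p" using assms(2) by (simp add: covecs_snoc)
  ultimately show "\<beta> 0 = \<phi> p (cs @ [\<beta>])"
    using dual_fibre_zero[OF E, of \<beta> p]
      multilinear_field_outside[OF kv_cochainsD(1)[OF assms(1)], of "cs @ [\<beta>]" p] by simp
qed

text \<open>Fibres have finite rank and so equal their double dual: the vector representing the last
  slot of \<phi> is the sum of the values of \<phi> on the coframe times the frame vectors.\<close>

lemma Psi_in_fibre_and_eval:
  assumes \<phi>: "\<phi> \<in> kv_cochains E (Suc k)" and cs: "cs \<in> covecs E k p"
  shows "Psi E \<phi> p cs \<in> fibre E p \<and> (\<forall>\<beta>\<in>dual_fibre E p. \<beta> (Psi E \<phi> p cs) = \<phi> p (cs @ [\<beta>]))"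
proof -
  obtain U e where Ue: "(U, e) \<in> frames E" "p \<in> U" by (rule frame_cover[OF E])
  define v where "v = (\<Sum>i<vrank E. \<phi> p (cs @ [coframe E e i p]) *\<^sub>R e i p)"
  have v: "v \<in> fibre E p"
    unfolding v_def by (rule fibre_sum[OF E]) (use frame_in_fibre[OF E Ue] in auto)
  have ev: "\<beta> v = \<phi> p (cs @ [\<beta>])" if \<beta>: "\<beta> \<in> dual_fibre E p" for \<beta>
  proof -
    have "\<beta> v = (\<Sum>i<vrank E. \<phi> p (cs @ [coframe E e i p]) * \<beta> (e i p))"
      unfolding v_def by (rule dual_fibre_sum[OF E \<beta>]) (use frame_in_fibre[OF E Ue] in auto)
    also have "\<dots> = (\<Sum>i<vrank E. \<beta> (e i p) * \<phi> p (cs @ [coframe E e i p]))"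
      by (simp add: mult.commute)
    also have "\<dots> = \<phi> p (cs @ [\<Sum>i<vrank E. \<beta> (e i p) *\<^sub>R coframe E e i p])"
      by (rule kv_cochain_last_sum[OF \<phi> cs, symmetric]) (use coframe(1)[OF E Ue] in auto)
    also have "(\<Sum>i<vrank E. \<beta> (e i p) *\<^sub>R coframe E e i p) = \<beta>"
      by (rule dual_coframe_expansion[OF E Ue \<beta>, symmetric])
    finally show ?thesis .
  qed
  have "Psi E \<phi> p cs = v" by (rule Psi_unique) (fact v, rule ev)
  then show ?thesis using v ev by simp
qed

lemma Psi_in_fibre: "\<phi> \<in> kv_cochains E (Suc k) \<Longrightarrow> Psi E \<phi> p cs \<in> fibre E p"
  using Psi_in_fibre_and_eval Psi_outside subspace_0[OF subspace_fibre[OF E]] by metis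

lemma Psi_eval:
  "\<phi> \<in> kv_cochains E (Suc k) \<Longrightarrow> cs \<in> covecs E k p \<Longrightarrow> \<beta> \<in> dual_fibre E p \<Longrightarrow>
    \<beta> (Psi E \<phi> p cs) = \<phi> p (cs @ [\<beta>])"
  using Psi_in_fibre_and_eval by blast

text \<open>Injectivity is what allows the \<open>inv_into\<close> in \<open>kv_bracket\<close> to
  be evaluated.\<close>

lemma inj_on_Psi: "inj_on (Psi E) (kv_cochains E (Suc k))"
proof (rule inj_onI)
  fix \<phi> \<psi> assume \<phi>: "\<phi> \<in> kv_cochains E (Suc k)" and \<psi>: "\<psi> \<in> kv_cochains E (Suc k)" and eq: "Psi E \<phi> = Psi E \<psi>"
  show "\<phi> = \<psi>"
  proof (intro ext)
    fix p cs
    show "\<phi> p cs = \<psi> p cs"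
    proof (cases "cs \<in> covecs E (Suc k) p")
      case True
      then have "cs \<noteq> []" by (auto simp: covecs_def)
      then have s: "cs = butlast cs @ [last cs]" by simp
      then have "butlast cs \<in> covecs E k p" "last cs \<in> dual_fibre E p"
        using True covecs_snoc[of "butlast cs" "last cs" E k p] by simp_all
      then have "\<phi> p (butlast cs @ [last cs]) = \<psi> p (butlast cs @ [last cs])"
        using Psi_eval[OF \<phi>, of "butlast cs" p "last cs"] Psi_eval[OF \<psi>, of "butlast cs" p "last cs"] eq
        by simp
      then show ?thesis using s by simp
    next
      case False
      then show ?thesis
        using multilinear_field_outside[OF kv_cochainsD(1)[OF \<phi>], of cs p]
          multilinear_field_outside[OF kv_cochainsD(1)[OF \<psi>], of cs p] by simp
    qed
  qed
qed

lemma covecs_update: "cs \<in> covecs E k p \<Longrightarrow> \<beta> \<in> dual_fibre E p \<Longrightarrow> cs[i := \<beta>] \<in> covecs E k p"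
  unfolding covecs_def using set_list_update_subset[of cs "dual_fibre E p" \<beta> i] by simp

text \<open>Every identity is tested against a covector \<beta> and becomes an identity of \<phi> on
  \<open>cs @ [\<beta>]\<close>. Skewness in the first Suc k - 1 slots of \<phi> is skewness in all
  k slots of its image.\<close>

lemma Psi_multilinear:
  assumes \<phi>: "\<phi> \<in> kv_cochains E (Suc k)"
  shows "multilinear_field E k k (Psi E \<phi>)"
proof -
  note ml = multilinear_fieldD[OF kv_cochainsD(1)[OF \<phi>]]
  note fib = Psi_in_fibre[OF \<phi>] and ev = Psi_eval[OF \<phi>]
  note sub = subspace_fibre[OF E]
  show ?thesis
    unfolding multilinear_field_def
  proof (intro conjI allI impI ballI)
    fix p cs assume "cs \<notin> covecs E k p"
    then show "Psi E \<phi> p cs = 0" by (rule Psi_outside[OF \<phi>])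
  next
    fix p cs i c assume a: "cs \<in> covecs E k p" "i < k"
    then have len: "length cs = k" and i: "cs ! i \<in> dual_fibre E p" by (auto simp: covecs_def)
    note upd = covecs_update[OF a(1) subspace_scale[OF subspace_dual_fibre i]]
    show "Psi E \<phi> p (cs[i := c *\<^sub>R cs ! i]) = c *\<^sub>R Psi E \<phi> p cs"
    proof (rule covector_separates[OF E])
      show "Psi E \<phi> p (cs[i := c *\<^sub>R cs ! i]) \<in> fibre E p" "c *\<^sub>R Psi E \<phi> p cs \<in> fibre E p"
        using fib subspace_scale[OF sub] by blast+
      fix \<beta> assume \<beta>: "\<beta> \<in> dual_fibre E p"
      have "cs[i := c *\<^sub>R cs ! i] @ [\<beta>] = (cs @ [\<beta>])[i := c *\<^sub>R (cs @ [\<beta>]) ! i]"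
        using a(2) len by (simp add: list_update_append nth_append)
      then show "\<beta> (Psi E \<phi> p (cs[i := c *\<^sub>R cs ! i])) = \<beta> (c *\<^sub>R Psi E \<phi> p cs)"
        using ml(1)[of "cs @ [\<beta>]" p i c] ev[OF upd \<beta>] ev[OF a(1) \<beta>] a \<beta>
          dual_fibreD(1)[OF \<beta> fib[of p cs]] by (simp add: covecs_snoc)
    qed
  next
    fix p cs i \<xi> assume a: "cs \<in> covecs E k p" "i < k" and \<xi>: "\<xi> \<in> dual_fibre E p"
    then have len: "length cs = k" and i: "cs ! i \<in> dual_fibre E p" by (auto simp: covecs_def)
    note upd = covecs_update[OF a(1) subspace_add[OF subspace_dual_fibre i \<xi>]]
    show "Psi E \<phi> p (cs[i := cs ! i + \<xi>]) = Psi E \<phi> p cs + Psi E \<phi> p (cs[i := \<xi>])"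
    proof (rule covector_separates[OF E])
      show "Psi E \<phi> p (cs[i := cs ! i + \<xi>]) \<in> fibre E p"
        "Psi E \<phi> p cs + Psi E \<phi> p (cs[i := \<xi>]) \<in> fibre E p"
        using fib subspace_add[OF sub] by blast+
      fix \<beta> assume \<beta>: "\<beta> \<in> dual_fibre E p"
      have "cs[i := cs ! i + \<xi>] @ [\<beta>] = (cs @ [\<beta>])[i := (cs @ [\<beta>]) ! i + \<xi>]"
        "cs[i := \<xi>] @ [\<beta>] = (cs @ [\<beta>])[i := \<xi>]"
        using a(2) len by (simp_all add: list_update_append nth_append)
      then show "\<beta> (Psi E \<phi> p (cs[i := cs ! i + \<xi>])) = \<beta> (Psi E \<phi> p cs + Psi E \<phi> p (cs[i := \<xi>]))"
        using ml(2)[of "cs @ [\<beta>]" p i \<xi>] ev[OF upd \<beta>] ev[OF a(1) \<beta>] ev[OF covecs_update[OF a(1) \<xi>] \<beta>, of i]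
          a \<beta> \<xi> dual_fibreD(2)[OF \<beta> fib[of p cs] fib[of p "cs[i := \<xi>]"]] by (simp add: covecs_snoc)
    qed
  next
    fix p cs i l assume a: "cs \<in> covecs E k p" and il: "i < l \<and> l < k"
    then have len: "length cs = k" and i: "cs ! i \<in> dual_fibre E p" "cs ! l \<in> dual_fibre E p"
      by (auto simp: covecs_def)
    note upd = covecs_update[OF covecs_update[OF a i(2)] i(1)]
    show "Psi E \<phi> p (cs[i := cs ! l, l := cs ! i]) = - Psi E \<phi> p cs"
    proof (rule covector_separates[OF E])
      show "Psi E \<phi> p (cs[i := cs ! l, l := cs ! i]) \<in> fibre E p" "- Psi E \<phi> p cs \<in> fibre E p"
        using fib subspace_neg[OF sub] by blast+
      fix \<beta> assume \<beta>: "\<beta> \<in> dual_fibre E p"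
      have "cs[i := cs ! l, l := cs ! i] @ [\<beta>] = (cs @ [\<beta>])[i := (cs @ [\<beta>]) ! l, l := (cs @ [\<beta>]) ! i]"
        using il len by (simp add: list_update_append nth_append)
      then show "\<beta> (Psi E \<phi> p (cs[i := cs ! l, l := cs ! i])) = \<beta> (- Psi E \<phi> p cs)"
        using ml(3)[of "cs @ [\<beta>]" p i l] ev[OF upd \<beta>] ev[OF a(1) \<beta>] a \<beta> il
          dual_fibre_minus[OF E \<beta> fib[of p cs]] by (simp add: covecs_snoc)
    qed
  qed
qed

lemma Psi_in_hom_cochains:
  assumes \<phi>: "\<phi> \<in> kv_cochains E (Suc k)"
  shows "Psi E \<phi> \<in> hom_cochains E k"
proof -
  note M = vector_bundle_base[OF E]
  have "smooth_section_on E U (\<lambda>p. Psi E \<phi> p (map (\<lambda>i. coframe E e i p) is))"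
    if Ue: "(U, e) \<in> frames E" and "is": "length is = k" "set is \<subseteq> {..<vrank E}" for U e "is"
  proof -
    note U = frameD(1)[OF E Ue]
    have cov: "map (\<lambda>i. coframe E e i p) is \<in> covecs E k p" if "p \<in> U" for p
      using "is" coframe(1)[OF E Ue that] by (auto simp: covecs_def)
    have "smooth_fun_on (base E) (W \<inter> U) (\<lambda>p. coframe E f j p (Psi E \<phi> p (map (\<lambda>i. coframe E e i p) is)))"
      if Wf: "(W, f) \<in> frames E" and j: "j < vrank E" for W f j
    proof -
      have WU: "open (W \<inter> U)" using U frameD(1)[OF E Wf] by blast
      \<comment> \<open>Coefficients are required along any other frame f. Expanding its coframe in
        the coframe of e expresses them by transition functions and components of \<phi> in e
        alone.\<close>
      have "smooth_fun_on (base E) (W \<inter> U)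
          (\<lambda>p. \<Sum>l<vrank E. coframe E f j p (e l p) * \<phi> p (map (\<lambda>i. coframe E e i p) (is @ [l])))"
      proof (rule smooth_fun_on_sum[OF M WU], rule smooth_fun_on_mult[OF M WU])
        fix l assume l: "l \<in> {..<vrank E}"
        show "smooth_fun_on (base E) (W \<inter> U) (\<lambda>p. coframe E f j p (e l p))"
          by (rule smooth_section_on_coefficient[OF E U frameD(2)[OF E Ue] Wf j]) (use l in simp)
        have "smooth_fun_on (base E) U (\<lambda>p. \<phi> p (map (\<lambda>i. coframe E e i p) (is @ [l])))"
          by (rule kv_cochainsD(2)[OF \<phi> Ue]) (use "is" l in auto)
        then show "smooth_fun_on (base E) (W \<inter> U) (\<lambda>p. \<phi> p (map (\<lambda>i. coframe E e i p) (is @ [l])))"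
          by (rule smooth_fun_on_subset[OF M, rotated]) simp
      qed
      then show ?thesis
      proof (rule smooth_fun_on_cong[OF M WU, rotated])
        fix p assume p: "p \<in> W \<inter> U"
        let ?cs = "map (\<lambda>i. coframe E e i p) is"
        have fj: "coframe E f j p \<in> dual_fibre E p" using coframe(1)[OF E Wf _ j] p by simp
        have "coframe E f j p (Psi E \<phi> p ?cs) = \<phi> p (?cs @ [coframe E f j p])"
          by (rule Psi_eval[OF \<phi> cov fj]) (use p in simp)
        also have "\<dots> = \<phi> p (?cs @ [\<Sum>l<vrank E. coframe E f j p (e l p) *\<^sub>R coframe E e l p])"
          using dual_coframe_expansion[OF E Ue _ fj] p by simp
        also have "\<phi> p (?cs @ [\<Sum>l<vrank E. coframe E f j p (e l p) *\<^sub>R coframe E e l p]) =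
            (\<Sum>l<vrank E. coframe E f j p (e l p) * \<phi> p (?cs @ [coframe E e l p]))"
          by (rule kv_cochain_last_sum[OF \<phi>]) (use p cov coframe(1)[OF E Ue] in auto)
        finally show "(\<Sum>l<vrank E. coframe E f j p (e l p) * \<phi> p (map (\<lambda>i. coframe E e i p) (is @ [l]))) =
            coframe E f j p (Psi E \<phi> p ?cs)" by simp
      qed
    qed
    then show ?thesis
      unfolding smooth_section_on_iff[OF E U] using Psi_in_fibre[OF \<phi>] by blast
  qed
  then show ?thesis
    unfolding hom_cochains_def using Psi_multilinear[OF \<phi>] Psi_in_fibre[OF \<phi>] by blast
qed

lemma eval_field_Psi:
  assumes "\<phi> \<in> kv_cochains E (Suc k)" "length cs = k" "set cs \<subseteq> dual_sections E"
    "\<beta> \<in> dual_sections E"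
  shows "pairing \<beta> (eval_field (Psi E \<phi>) cs) = eval_field \<phi> (cs @ [\<beta>])"
proof
  fix p
  show "pairing \<beta> (eval_field (Psi E \<phi>) cs) p = eval_field \<phi> (cs @ [\<beta>]) p"
    using Psi_eval[OF assms(1) covecs_of_sections[OF E assms(2,3)] dual_section_at[OF E assms(4)]]
    by (simp add: pairing_def eval_field_def)
qed

lemma kv_cochain_eqI:
  assumes "\<phi> \<in> kv_cochains E k" "\<psi> \<in> kv_cochains E k"
    and "\<And>cs. length cs = k \<Longrightarrow> set cs \<subseteq> dual_sections E \<Longrightarrow> eval_field \<phi> cs = eval_field \<psi> cs"
  shows "\<phi> = \<psi>"
proof (intro ext)
  fix p cs
  show "\<phi> p cs = \<psi> p cs"
  proof (cases "cs \<in> covecs E k p")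
    case True
    obtain xs where "length xs = k" "set xs \<subseteq> dual_sections E" "map (\<lambda>\<xi>. \<xi> p) xs = cs"
      by (rule covecs_through[OF E True])
    then show ?thesis using fun_cong[OF assms(3), of xs p] by (simp add: eval_field_def)
  next
    case False
    then show ?thesis
      using multilinear_field_outside[OF kv_cochainsD(1)[OF assms(1)], of cs p]
        multilinear_field_outside[OF kv_cochainsD(1)[OF assms(2)], of cs p] by simp
  qed
qed

lemma kv_cochains_uminus:
  assumes "\<phi> \<in> kv_cochains E k"
  shows "- \<phi> \<in> kv_cochains E k"
proof -
  note ml = kv_cochainsD(1)[OF assms]
  have "multilinear_field E k (k - 1) (- \<phi>)"
    unfolding multilinear_field_def
  proof (intro conjI allI impI ballI)
    fix p cs assume "cs \<notin> covecs E k p"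
    then show "(- \<phi>) p cs = 0" using multilinear_field_outside[OF ml] by simp
  qed (use multilinear_fieldD[OF ml] in \<open>simp_all add: algebra_simps\<close>)
  moreover have "smooth_fun_on (base E) U (\<lambda>p. (- \<phi>) p (map (\<lambda>i. coframe E e i p) is))"
    if "(U, e) \<in> frames E" "length is = k" "set is \<subseteq> {..<vrank E}" for U e "is"
    using smooth_fun_on_minus[OF vector_bundle_base[OF E] frameD(1)[OF E that(1)] kv_cochainsD(2)[OF assms that]]
    by simp
  ultimately show ?thesis unfolding kv_cochains_def by blast
qed

end

text \<open>The bracket hides two choices, a description over Hom-cochains and an inverse of
  \<open>Psi\<close>. If T takes the right values on global sections, then \<open>Psi A T\<close> is
  the unique solution of the description, since covectors lift to sections, and \<open>Psi\<close>
  is injective.\<close>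

lemma kv_bracket_eqI:
  fixes A :: "('m::{t2_space, second_countable_topology}, 'v::real_vector) lsalgebroid"
  assumes A: "vector_bundle A" and T: "T \<in> kv_cochains A (m + n + 1)"
    and expr: "\<And>cs p. length cs = m + n \<Longrightarrow> set cs \<subseteq> dual_sections A \<Longrightarrow>
      hom_bracket_expr A n (Psi A \<phi>) m (Psi A \<psi>) cs p \<in> fibre A p"
    and ev: "\<And>cs \<beta>. length cs = m + n \<Longrightarrow> set cs \<subseteq> dual_sections A \<Longrightarrow> \<beta> \<in> dual_sections A \<Longrightarrow>
      eval_field T (cs @ [\<beta>]) = pairing \<beta> (hom_bracket_expr A n (Psi A \<phi>) m (Psi A \<psi>) cs)"
  shows "kv_bracket A n \<phi> m \<psi> = T"
proof -
  have T': "T \<in> kv_cochains A (Suc (m + n))" using T by simp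
  have eq: "eval_field (Psi A T) cs = hom_bracket_expr A n (Psi A \<phi>) m (Psi A \<psi>) cs"
    if cs: "length cs = m + n" "set cs \<subseteq> dual_sections A" for cs
  proof
    fix p
    show "eval_field (Psi A T) cs p = hom_bracket_expr A n (Psi A \<phi>) m (Psi A \<psi>) cs p"
    proof (rule covector_separates[OF A])
      show "eval_field (Psi A T) cs p \<in> fibre A p"
        unfolding eval_field_def by (rule Psi_in_fibre[OF A T'])
      show "hom_bracket_expr A n (Psi A \<phi>) m (Psi A \<psi>) cs p \<in> fibre A p" by (rule expr[OF cs])
      fix \<xi> assume "\<xi> \<in> dual_fibre A p"
      then have "\<xi> \<in> fibre (dual_bundle A) p" by simp
      then obtain \<beta> where \<beta>: "\<beta> \<in> dual_sections A" "\<beta> p = \<xi>"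
        by (rule section_through[OF vector_bundle_dual[OF A]])
      have "pairing \<beta> (eval_field (Psi A T) cs) p =
          pairing \<beta> (hom_bracket_expr A n (Psi A \<phi>) m (Psi A \<psi>) cs) p"
        using eval_field_Psi[OF A T' cs \<beta>(1)] ev[OF cs \<beta>(1)] by simp
      then show "\<xi> (eval_field (Psi A T) cs p) = \<xi> (hom_bracket_expr A n (Psi A \<phi>) m (Psi A \<psi>) cs p)"
        using \<beta>(2) by (simp add: pairing_def)
    qed
  qed
  have "hom_bracket A n (Psi A \<phi>) m (Psi A \<psi>) = Psi A T"
    unfolding hom_bracket_def
  proof (rule the_equality)
    show "Psi A T \<in> hom_cochains A (m + n) \<and>
      (\<forall>cs. length cs = m + n \<and> set cs \<subseteq> dual_sections A \<longrightarrow>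
        eval_field (Psi A T) cs = hom_bracket_expr A n (Psi A \<phi>) m (Psi A \<psi>) cs)"
      using Psi_in_hom_cochains[OF A T'] eq by blast
  next
    fix S assume S: "S \<in> hom_cochains A (m + n) \<and>
      (\<forall>cs. length cs = m + n \<and> set cs \<subseteq> dual_sections A \<longrightarrow>
        eval_field S cs = hom_bracket_expr A n (Psi A \<phi>) m (Psi A \<psi>) cs)"
    then have ml: "multilinear_field A (m + n) (m + n) S" by (simp add: hom_cochains_def)
    show "S = Psi A T"
    proof (intro ext)
      fix p cs
      show "S p cs = Psi A T p cs"
      proof (cases "cs \<in> covecs A (m + n) p")
        case True
        obtain xs where xs: "length xs = m + n" "set xs \<subseteq> dual_sections A" "map (\<lambda>\<xi>. \<xi> p) xs = cs"
          by (rule covecs_through[OF A True])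
        have "eval_field S xs = eval_field (Psi A T) xs" using S eq xs(1,2) by simp
        then have "eval_field S xs p = eval_field (Psi A T) xs p" by simp
        then show ?thesis using xs(3) by (simp add: eval_field_def)
      next
        case False
        then show ?thesis using multilinear_field_outside[OF ml, of cs p] Psi_outside[OF A T', of cs p] by simp
      qed
    qed
  qed
  then show ?thesis
    unfolding kv_bracket_def using inv_into_f_f[OF inj_on_Psi[OF A, of "m + n"] T'] by simp
qed

section \<open>Pairings\<close>

lemma pairing_add_left: "pairing (\<xi> + \<eta>) y = pairing \<xi> y + pairing \<eta> y"
  by (simp add: pairing_def fun_eq_iff)

lemma pairing_fun_scale_left: "pairing (fun_scale f \<xi>) y = f * pairing \<xi> y"
  by (simp add: pairing_def fun_eq_iff fun_scale_def scaleR_fun_def)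

context
  fixes E :: "('m::{t2_space, second_countable_topology}, 'v::real_vector, 'z) vbundle_scheme"
  assumes E: "vector_bundle E"
begin

lemma pairing_add_right:
  assumes "\<xi> \<in> dual_sections E" "x \<in> sections E" "y \<in> sections E"
  shows "pairing \<xi> (x + y) = pairing \<xi> x + pairing \<xi> y"
  using dual_fibreD(2)[OF dual_section_at[OF E assms(1)] section_in_fibre[OF E assms(2)] section_in_fibre[OF E assms(3)]]
  by (simp add: pairing_def fun_eq_iff)

lemma pairing_diff_right:
  assumes "\<xi> \<in> dual_sections E" "x \<in> sections E" "y \<in> sections E"
  shows "pairing \<xi> (x - y) = pairing \<xi> x - pairing \<xi> y"
  using dual_fibre_diff[OF E dual_section_at[OF E assms(1)] section_in_fibre[OF E assms(2)] section_in_fibre[OF E assms(3)]]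
  by (simp add: pairing_def fun_eq_iff)

lemma pairing_uminus_right:
  assumes "\<xi> \<in> dual_sections E" "x \<in> sections E"
  shows "pairing \<xi> (- x) = - pairing \<xi> x"
  using dual_fibre_minus[OF E dual_section_at[OF E assms(1)] section_in_fibre[OF E assms(2)]]
  by (simp add: pairing_def fun_eq_iff)

lemma pairing_fun_scale_right:
  assumes "\<xi> \<in> dual_sections E" "x \<in> sections E"
  shows "pairing \<xi> (fun_scale f x) = f * pairing \<xi> x"
  using dual_fibreD(1)[OF dual_section_at[OF E assms(1)] section_in_fibre[OF E assms(2)]]
  by (simp add: pairing_def fun_eq_iff fun_scale_def)

lemma section_eqI:
  assumes "x \<in> sections E" "y \<in> sections E"
    and "\<And>\<beta>. \<beta> \<in> dual_sections E \<Longrightarrow> pairing \<beta> x = pairing \<beta> y"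
  shows "x = y"
proof
  fix p
  show "x p = y p"
  proof (rule covector_separates[OF E])
    show "x p \<in> fibre E p" "y p \<in> fibre E p" using assms(1,2) section_in_fibre[OF E] by blast+
    fix \<xi> assume "\<xi> \<in> dual_fibre E p"
    then have "\<xi> \<in> fibre (dual_bundle E) p" by simp
    then obtain \<beta> where \<beta>: "\<beta> \<in> dual_sections E" "\<beta> p = \<xi>"
      by (rule section_through[OF vector_bundle_dual[OF E]])
    then show "\<xi> (x p) = \<xi> (y p)" using fun_cong[OF assms(3)[OF \<beta>(1)], of p] by (simp add: pairing_def)
  qed
qed

end

section \<open>Operations on a left-symmetric algebroid\<close>

lemma fun_scale_add: "fun_scale f (x + y) = fun_scale f x + fun_scale f y"
  and fun_scale_diff: "fun_scale f (x - y) = fun_scale f x - fun_scale f y"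
  and fun_scale_uminus: "fun_scale f (- x) = - fun_scale f x"
  and fun_scale_fun_scale: "fun_scale f (fun_scale g x) = fun_scale (f * g) x"
  and add_fun_scale: "fun_scale (f + g) x = fun_scale f x + fun_scale g x"
  by (simp_all add: fun_scale_def fun_eq_iff algebra_simps)

context
  fixes A :: "('m::{t2_space, second_countable_topology}, 'v::real_vector) lsalgebroid"
  assumes A: "left_symmetric_algebroid A"
begin

lemma lsa_bundle: "vector_bundle A"
  using A by (simp add: left_symmetric_algebroid_def)

lemma lsa_product:
  assumes "x \<in> sections A" "y \<in> sections A"
  shows "lprod A x y \<in> sections A"
    and "z \<in> sections A \<Longrightarrow> lprod A (x + y) z = lprod A x z + lprod A y z"
    and "z \<in> sections A \<Longrightarrow> lprod A z (x + y) = lprod A z x + lprod A z y"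
    and "f \<in> smooth_funs (base A) \<Longrightarrow>
      lprod A x (fun_scale f y) = fun_scale f (lprod A x y) + fun_scale (anchor_act A x f) y"
    and "f \<in> smooth_funs (base A) \<Longrightarrow> lprod A (fun_scale f x) y = fun_scale f (lprod A x y)"
proof -
  have "\<forall>x\<in>sections A. \<forall>y\<in>sections A. lprod A x y \<in> sections A \<and>
       (\<forall>c. lprod A (c *\<^sub>R x) y = c *\<^sub>R lprod A x y \<and> lprod A x (c *\<^sub>R y) = c *\<^sub>R lprod A x y) \<and>
       (\<forall>z\<in>sections A. lprod A (x + y) z = lprod A x z + lprod A y z \<and>
          lprod A z (x + y) = lprod A z x + lprod A z y \<and>
          lprod A x (lprod A y z) - lprod A (lprod A x y) z =
          lprod A y (lprod A x z) - lprod A (lprod A y x) z) \<and>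
       (\<forall>f\<in>smooth_funs (base A).
          lprod A x (fun_scale f y) =
            fun_scale f (lprod A x y) + fun_scale (anchor_act A x f) y \<and>
          lprod A (fun_scale f x) y = fun_scale f (lprod A x y))"
    using A unfolding left_symmetric_algebroid_def by (elim conjE)
  from bspec[OF bspec[OF this assms(1)] assms(2)]
  show "lprod A x y \<in> sections A"
    and "z \<in> sections A \<Longrightarrow> lprod A (x + y) z = lprod A x z + lprod A y z"
    and "z \<in> sections A \<Longrightarrow> lprod A z (x + y) = lprod A z x + lprod A z y"
    and "f \<in> smooth_funs (base A) \<Longrightarrow>
      lprod A x (fun_scale f y) = fun_scale f (lprod A x y) + fun_scale (anchor_act A x f) y"
    and "f \<in> smooth_funs (base A) \<Longrightarrow> lprod A (fun_scale f x) y = fun_scale f (lprod A x y)"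
    by blast+
qed

lemma anchor_linear:
  assumes "u \<in> fibre A p"
  shows "anchor A p (c *\<^sub>R u) = c *\<^sub>R anchor A p u"
    and "v \<in> fibre A p \<Longrightarrow> anchor A p (u + v) = anchor A p u + anchor A p v"
proof -
  have "\<forall>p. \<forall>u\<in>fibre A p. anchor A p u \<in> fibre (tangent_bundle (base A)) p \<and>
      (\<forall>c. anchor A p (c *\<^sub>R u) = c *\<^sub>R anchor A p u) \<and>
      (\<forall>v\<in>fibre A p. anchor A p (u + v) = anchor A p u + anchor A p v)"
    using A unfolding left_symmetric_algebroid_def bundle_map_def by (elim conjE)
  from bspec[OF spec[OF this] assms]
  show "anchor A p (c *\<^sub>R u) = c *\<^sub>R anchor A p u"
    and "v \<in> fibre A p \<Longrightarrow> anchor A p (u + v) = anchor A p u + anchor A p v"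
    by blast+
qed

section \<open>The anchor acts by derivations\<close>

lemma anchor_act_add_left:
  assumes "x \<in> sections A" "y \<in> sections A"
  shows "anchor_act A (x + y) f = anchor_act A x f + anchor_act A y f"
  using anchor_linear(2)[OF section_in_fibre[OF lsa_bundle assms(1)] section_in_fibre[OF lsa_bundle assms(2)]]
  by (simp add: anchor_act_def fun_eq_iff)

lemma anchor_act_fun_scale_left:
  assumes "x \<in> sections A"
  shows "anchor_act A (fun_scale g x) f = g * anchor_act A x f"
  using anchor_linear(1)[OF section_in_fibre[OF lsa_bundle assms]]
  by (simp add: anchor_act_def fun_eq_iff fun_scale_def scaleR_fun_def)

lemma anchor_act_eq_0:
  assumes "x p = 0"
  shows "anchor_act A x f p = 0"
  using anchor_linear(1)[OF subspace_0[OF subspace_fibre[OF lsa_bundle]], of p 0] assms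
  by (simp add: anchor_act_def)

(* The derivation rules at p follow from the Leibniz rule for x * (f x) when x does not vanish
   at p. *)
lemma anchor_act_add:
  assumes x: "x \<in> sections A" and f: "f \<in> smooth_funs (base A)" and g: "g \<in> smooth_funs (base A)"
  shows "anchor_act A x (f + g) = anchor_act A x f + anchor_act A x g"
proof
  fix p
  note fg = smooth_funs_add[OF lsa_bundle f g]
  note sf = sections_fun_scale[OF lsa_bundle f x] and sg = sections_fun_scale[OF lsa_bundle g x]
  have "lprod A x (fun_scale (f + g) x) = lprod A x (fun_scale f x) + lprod A x (fun_scale g x)"
    unfolding add_fun_scale by (rule lsa_product(3)[OF sf sg x])
  then have "fun_scale (f + g) (lprod A x x) + fun_scale (anchor_act A x (f + g)) x =
      (fun_scale f (lprod A x x) + fun_scale (anchor_act A x f) x) +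
      (fun_scale g (lprod A x x) + fun_scale (anchor_act A x g) x)"
    using lsa_product(4)[OF x x] f g fg by simp
  from fun_cong[OF this, of p]
  have "anchor_act A x (f + g) p *\<^sub>R x p = (anchor_act A x f p + anchor_act A x g p) *\<^sub>R x p"
    by (simp add: fun_scale_def algebra_simps)
  \<comment> \<open>Where x vanishes both sides are 0, because the anchor is linear on the fibre;
    elsewhere the vector x(p) can be cancelled.\<close>
  then show "anchor_act A x (f + g) p = (anchor_act A x f + anchor_act A x g) p"
    using anchor_act_eq_0[of x p] by (cases "x p = 0") simp_all
qed

lemma anchor_act_mult:
  assumes x: "x \<in> sections A" and f: "f \<in> smooth_funs (base A)" and g: "g \<in> smooth_funs (base A)"
  shows "anchor_act A x (f * g) = f * anchor_act A x g + g * anchor_act A x f"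
proof
  fix p
  note fg = smooth_funs_mult[OF lsa_bundle f g]
  note sg = sections_fun_scale[OF lsa_bundle g x]
  \<comment> \<open>The product of x with (f g) x is expanded in two ways: by the Leibniz rule for f
    g, and by the one for f followed by the one for g.\<close>
  have "lprod A x (fun_scale (f * g) x) = fun_scale f (lprod A x (fun_scale g x)) + fun_scale (anchor_act A x f) (fun_scale g x)"
    unfolding fun_scale_fun_scale[symmetric] by (rule lsa_product(4)[OF x sg f])
  then have "fun_scale (f * g) (lprod A x x) + fun_scale (anchor_act A x (f * g)) x =
      fun_scale f (fun_scale g (lprod A x x) + fun_scale (anchor_act A x g) x) +
      fun_scale (anchor_act A x f) (fun_scale g x)"
    using lsa_product(4)[OF x x] g fg by simp
  from fun_cong[OF this, of p]
  have "anchor_act A x (f * g) p *\<^sub>R x p = (f p * anchor_act A x g p + g p * anchor_act A x f p) *\<^sub>R x p"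
    by (simp add: fun_scale_def algebra_simps)
  then show "anchor_act A x (f * g) p = (f * anchor_act A x g + g * anchor_act A x f) p"
    using anchor_act_eq_0[of x p] by (cases "x p = 0") simp_all
qed

(* If the rank is positive, a(x)(f) is locally a coefficient of the section x * (f y) - f (x * y),
   where y extends a frame section. *)
lemma anchor_act_smooth:
  assumes x: "x \<in> sections A" and f: "f \<in> smooth_funs (base A)"
  shows "anchor_act A x f \<in> smooth_funs (base A)"
proof -
  note M = vector_bundle_base[OF lsa_bundle]
  have "smooth_fun_on (base A) UNIV (anchor_act A x f)"
  proof (rule smooth_fun_on_local[OF M])
    fix p
    obtain U e where Ue: "(U, e) \<in> frames A" "p \<in> U" by (rule frame_cover[OF lsa_bundle])
    note U = frameD(1)[OF lsa_bundle Ue(1)]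
    obtain N es where ext: "open N" "p \<in> N" "N \<subseteq> U"
      "\<forall>s. smooth_section_on A U s \<longrightarrow> es s \<in> sections A" "\<forall>s. \<forall>q\<in>N. es s q = s q"
      by (rule exists_section_extension[OF lsa_bundle U Ue(2)])
    have "smooth_fun_on (base A) N (anchor_act A x f)"
    proof (cases "vrank A = 0")
      case True
      \<comment> \<open>In rank 0 there is no frame section to read a coefficient from, but x and
        with it a(x)(f) vanish.\<close>
      have "x q = 0" if "q \<in> U" for q
      proof -
        have "fibre A q = {0}" using frameD(5)[OF lsa_bundle Ue(1) that] True by simp
        then show ?thesis using section_in_fibre[OF lsa_bundle x, of q] by simp
      qed
      then have "anchor_act A x f q = 0" if "q \<in> N" for q
        using that ext(3) anchor_act_eq_0 by blast
      then show ?thesis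
        by (intro smooth_fun_on_cong[OF M ext(1) _ smooth_fun_on_const[OF M ext(1), of 0]]) simp
    next
      case False
      then have r: "0 < vrank A" by simp
      define y where "y = es (e 0)"
      have y: "y \<in> sections A" using ext(4) frameD(2)[OF lsa_bundle Ue(1) r] by (simp add: y_def)
      define s where "s = lprod A x (fun_scale f y) - fun_scale f (lprod A x y)"
      have "s \<in> sections A"
        unfolding s_def by (intro sections_diff[OF lsa_bundle] lsa_product(1) x sections_fun_scale[OF lsa_bundle f] y)
      then have "smooth_fun_on (base A) U (\<lambda>q. coframe A e 0 q (s q))"
        by (rule section_coefficient_smooth[OF lsa_bundle _ Ue(1) r])
      then have "smooth_fun_on (base A) N (\<lambda>q. coframe A e 0 q (s q))"
        by (rule smooth_fun_on_subset[OF M ext(3)])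
      then show ?thesis
      proof (rule smooth_fun_on_cong[OF M ext(1), rotated])
        fix q assume q: "q \<in> N"
        then have qU: "q \<in> U" using ext(3) by blast
        have "s = fun_scale (anchor_act A x f) y" using lsa_product(4)[OF x y f] by (simp add: s_def)
        then have "s q = anchor_act A x f q *\<^sub>R e 0 q" using ext(5) q by (simp add: fun_scale_def y_def)
        then show "coframe A e 0 q (s q) = anchor_act A x f q"
          using coframe[OF lsa_bundle Ue(1) qU r] dual_fibreD(1)[OF coframe(1)[OF lsa_bundle Ue(1) qU r] frame_in_fibre[OF lsa_bundle Ue(1) qU r]] r
          by simp
      qed
    qed
    then show "\<exists>N. open N \<and> p \<in> N \<and> smooth_fun_on (base A) (N \<inter> UNIV) (anchor_act A x f)"
      using ext(1,2) by auto
  qed simp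
  then show ?thesis by simp
qed

text \<open>As a(x) is a derivation, the first term produces a(x)(f) times the pairing of \<xi> with
  s; the Leibniz rule for x * (f s) produces the same term with the opposite sign. What remains is
  linear over functions in s.\<close>

lemma L_op:
  assumes x: "x \<in> sections A" and \<xi>: "\<xi> \<in> dual_sections A"
  shows "L_op A x \<xi> \<in> dual_sections A"
    and "y \<in> sections A \<Longrightarrow>
      pairing (L_op A x \<xi>) y = anchor_act A x (pairing \<xi> y) - pairing \<xi> (lprod A x y)"
proof -
  let ?F = "\<lambda>y. anchor_act A x (pairing \<xi> y) - pairing \<xi> (lprod A x y)"
  note ps = pairing_smooth[OF lsa_bundle \<xi>]
  have "\<exists>!\<eta>. \<eta> \<in> dual_sections A \<and> (\<forall>y\<in>sections A. pairing \<eta> y = ?F y)"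
  proof (rule exists_dual_section[OF lsa_bundle])
    fix s assume s: "s \<in> sections A"
    show "?F s \<in> smooth_funs (base A)"
      by (rule smooth_funs_diff[OF lsa_bundle anchor_act_smooth[OF x ps[OF s]] ps[OF lsa_product(1)[OF x s]]])
    show "?F (s + t) = ?F s + ?F t" if t: "t \<in> sections A" for t
      using anchor_act_add[OF x ps[OF s] ps[OF t]] pairing_add_right[OF lsa_bundle \<xi> s t]
        lsa_product(3)[OF s t x] pairing_add_right[OF lsa_bundle \<xi> lsa_product(1)[OF x s] lsa_product(1)[OF x t]]
      by simp
    show "?F (fun_scale f s) = f * ?F s" if f: "f \<in> smooth_funs (base A)" for f
    proof -
      note xs = lsa_product(1)[OF x s]
      have "pairing \<xi> (lprod A x (fun_scale f s)) =
          f * pairing \<xi> (lprod A x s) + anchor_act A x f * pairing \<xi> s"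
        using lsa_product(4)[OF x s f] pairing_fun_scale_right[OF lsa_bundle \<xi>] xs s
          pairing_add_right[OF lsa_bundle \<xi> sections_fun_scale[OF lsa_bundle f xs] sections_fun_scale[OF lsa_bundle anchor_act_smooth[OF x f] s]]
        by simp
      then show ?thesis
        using anchor_act_mult[OF x f ps[OF s]] pairing_fun_scale_right[OF lsa_bundle \<xi> s]
        by (simp add: algebra_simps)
    qed
  qed
  from theI'[OF this]
  have *: "L_op A x \<xi> \<in> dual_sections A \<and> (\<forall>y\<in>sections A. pairing (L_op A x \<xi>) y = ?F y)"
    unfolding L_op_def .
  then show "L_op A x \<xi> \<in> dual_sections A" by blast
  show "pairing (L_op A x \<xi>) y = ?F y" if "y \<in> sections A" using * that by blast
qed

text \<open>The argument y stands in the left factor of the product, in which the product is linear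
  over functions, so no correction by the anchor arises.\<close>

lemma R_op:
  assumes x: "x \<in> sections A" and \<xi>: "\<xi> \<in> dual_sections A"
  shows "R_op A x \<xi> \<in> dual_sections A"
    and "y \<in> sections A \<Longrightarrow> pairing (R_op A x \<xi>) y = - pairing \<xi> (lprod A y x)"
proof -
  let ?F = "\<lambda>y. - pairing \<xi> (lprod A y x)"
  note ps = pairing_smooth[OF lsa_bundle \<xi>]
  have "\<exists>!\<eta>. \<eta> \<in> dual_sections A \<and> (\<forall>y\<in>sections A. pairing \<eta> y = ?F y)"
  proof (rule exists_dual_section[OF lsa_bundle])
    fix s assume s: "s \<in> sections A"
    show "?F s \<in> smooth_funs (base A)"
      by (rule smooth_funs_uminus[OF lsa_bundle ps[OF lsa_product(1)[OF s x]]])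
    show "?F (s + t) = ?F s + ?F t" if t: "t \<in> sections A" for t
      using lsa_product(2)[OF s t x] pairing_add_right[OF lsa_bundle \<xi> lsa_product(1)[OF s x] lsa_product(1)[OF t x]]
      by simp
    show "?F (fun_scale f s) = f * ?F s" if f: "f \<in> smooth_funs (base A)" for f
      using lsa_product(5)[OF s x f] pairing_fun_scale_right[OF lsa_bundle \<xi> lsa_product(1)[OF s x]] by simp
  qed
  from theI'[OF this]
  have *: "R_op A x \<xi> \<in> dual_sections A \<and> (\<forall>y\<in>sections A. pairing (R_op A x \<xi>) y = ?F y)"
    unfolding R_op_def .
  then show "R_op A x \<xi> \<in> dual_sections A" by blast
  show "pairing (R_op A x \<xi>) y = ?F y" if "y \<in> sections A" using * that by blast
qed

lemma L_op_add_left: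
  assumes "x \<in> sections A" "y \<in> sections A" "\<xi> \<in> dual_sections A"
  shows "L_op A (x + y) \<xi> = L_op A x \<xi> + L_op A y \<xi>"
proof (rule dual_section_unique[OF lsa_bundle])
  note xy = sections_add[OF lsa_bundle assms(1,2)]
  show "L_op A (x + y) \<xi> \<in> dual_sections A" by (rule L_op(1)[OF xy assms(3)])
  show "L_op A x \<xi> + L_op A y \<xi> \<in> dual_sections A"
    by (intro sections_add[OF vector_bundle_dual[OF lsa_bundle]] L_op(1) assms)
  fix z assume z: "z \<in> sections A"
  show "pairing (L_op A (x + y) \<xi>) z = pairing (L_op A x \<xi> + L_op A y \<xi>) z"
    using L_op(2)[OF xy assms(3) z] L_op(2)[OF assms(1,3) z] L_op(2)[OF assms(2,3) z]
      lsa_product(2)[OF assms(1,2) z] anchor_act_add_left[OF assms(1,2)]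
      pairing_add_right[OF lsa_bundle assms(3) lsa_product(1)[OF assms(1) z] lsa_product(1)[OF assms(2) z]]
    by (simp add: pairing_add_left)
qed

lemma L_op_add_right:
  assumes "x \<in> sections A" "\<xi> \<in> dual_sections A" "\<eta> \<in> dual_sections A"
  shows "L_op A x (\<xi> + \<eta>) = L_op A x \<xi> + L_op A x \<eta>"
proof (rule dual_section_unique[OF lsa_bundle])
  note D = vector_bundle_dual[OF lsa_bundle]
  note xy = sections_add[OF D assms(2,3)]
  show "L_op A x (\<xi> + \<eta>) \<in> dual_sections A" by (rule L_op(1)[OF assms(1) xy])
  show "L_op A x \<xi> + L_op A x \<eta> \<in> dual_sections A"
    by (intro sections_add[OF D] L_op(1) assms)
  fix z assume z: "z \<in> sections A"
  show "pairing (L_op A x (\<xi> + \<eta>)) z = pairing (L_op A x \<xi> + L_op A x \<eta>) z"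
    using L_op(2)[OF assms(1) xy z] L_op(2)[OF assms(1,2) z] L_op(2)[OF assms(1,3) z]
      anchor_act_add[OF assms(1) pairing_smooth[OF lsa_bundle assms(2) z] pairing_smooth[OF lsa_bundle assms(3) z]]
    by (simp add: pairing_add_left)
qed

lemma L_op_fun_scale_left:
  assumes f: "f \<in> smooth_funs (base A)" and x: "x \<in> sections A" and \<xi>: "\<xi> \<in> dual_sections A"
  shows "L_op A (fun_scale f x) \<xi> = fun_scale f (L_op A x \<xi>)"
proof (rule dual_section_unique[OF lsa_bundle])
  have fD: "f \<in> smooth_funs (base (dual_bundle A))" using f by simp
  note fx = sections_fun_scale[OF lsa_bundle f x]
  show "L_op A (fun_scale f x) \<xi> \<in> dual_sections A" by (rule L_op(1)[OF fx \<xi>])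
  show "fun_scale f (L_op A x \<xi>) \<in> dual_sections A"
    by (intro sections_fun_scale[OF vector_bundle_dual[OF lsa_bundle] fD] L_op(1) x \<xi>)
  fix z assume z: "z \<in> sections A"
  show "pairing (L_op A (fun_scale f x) \<xi>) z = pairing (fun_scale f (L_op A x \<xi>)) z"
    using L_op(2)[OF fx \<xi> z] L_op(2)[OF x \<xi> z] lsa_product(5)[OF x z f]
      pairing_fun_scale_right[OF lsa_bundle \<xi> lsa_product(1)[OF x z]] anchor_act_fun_scale_left[OF x]
    by (simp add: pairing_fun_scale_left right_diff_distrib)
qed

text \<open>The anchor term is the defect which the commutator has to cancel in the brackets
  below.\<close>

lemma L_op_fun_scale_right:
  assumes f: "f \<in> smooth_funs (base A)" and x: "x \<in> sections A" and \<xi>: "\<xi> \<in> dual_sections A"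
  shows "L_op A x (fun_scale f \<xi>) = fun_scale f (L_op A x \<xi>) + fun_scale (anchor_act A x f) \<xi>"
proof (rule dual_section_unique[OF lsa_bundle])
  note D = vector_bundle_dual[OF lsa_bundle]
  have fD: "f \<in> smooth_funs (base (dual_bundle A))" "anchor_act A x f \<in> smooth_funs (base (dual_bundle A))"
    using f anchor_act_smooth[OF x f] by simp_all
  note f\<xi> = sections_fun_scale[OF D fD(1) \<xi>]
  show "L_op A x (fun_scale f \<xi>) \<in> dual_sections A" by (rule L_op(1)[OF x f\<xi>])
  show "fun_scale f (L_op A x \<xi>) + fun_scale (anchor_act A x f) \<xi> \<in> dual_sections A"
    by (intro sections_add[OF D] sections_fun_scale[OF D] fD L_op(1) x \<xi>)
  fix z assume z: "z \<in> sections A"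
  show "pairing (L_op A x (fun_scale f \<xi>)) z =
      pairing (fun_scale f (L_op A x \<xi>) + fun_scale (anchor_act A x f) \<xi>) z"
    using L_op(2)[OF x f\<xi> z] L_op(2)[OF x \<xi> z] anchor_act_mult[OF x f pairing_smooth[OF lsa_bundle \<xi> z]]
    by (simp add: pairing_fun_scale_left pairing_add_left right_diff_distrib mult.commute)
qed

lemma sub_adj_bracket_section:
  "x \<in> sections A \<Longrightarrow> y \<in> sections A \<Longrightarrow> sub_adj_bracket A x y \<in> sections A"
  unfolding sub_adj_bracket_def by (intro sections_diff[OF lsa_bundle] lsa_product(1))

lemma sub_adj_bracket_swap: "sub_adj_bracket A y x = - sub_adj_bracket A x y"
  by (simp add: sub_adj_bracket_def)

lemma sub_adj_bracket_add_right:
  "x \<in> sections A \<Longrightarrow> y \<in> sections A \<Longrightarrow> z \<in> sections A \<Longrightarrow>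
    sub_adj_bracket A x (y + z) = sub_adj_bracket A x y + sub_adj_bracket A x z"
  using lsa_product(2,3)[of y z x] by (simp add: sub_adj_bracket_def)

lemma sub_adj_bracket_fun_scale_right:
  "f \<in> smooth_funs (base A) \<Longrightarrow> x \<in> sections A \<Longrightarrow> y \<in> sections A \<Longrightarrow>
    sub_adj_bracket A x (fun_scale f y) = fun_scale f (sub_adj_bracket A x y) + fun_scale (anchor_act A x f) y"
  using lsa_product(4)[of x y f] lsa_product(5)[of y x f]
  by (simp add: sub_adj_bracket_def fun_scale_diff)

section \<open>Symmetric tensors as maps from covector fields to sections\<close>

context
  fixes H
  assumes H: "H \<in> Sym2 A"
begin

lemma Sym2_cochain: "H \<in> kv_cochains A (Suc 1)" "H \<in> kv_cochains A (Suc (Suc 0))"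
  using H by (simp_all add: Sym2_def numeral_2_eq_2)

lemma pairing_sharp:
  assumes "\<alpha> \<in> dual_sections A" "\<beta> \<in> dual_sections A"
  shows "pairing \<beta> (sharp A H \<alpha>) = eval_field H [\<alpha>, \<beta>]"
  using eval_field_Psi[OF lsa_bundle Sym2_cochain(1), of "[\<alpha>]" \<beta>] assms by (simp add: sharp_def)

lemma pairing_sharp_commute:
  assumes "\<alpha> \<in> dual_sections A" "\<beta> \<in> dual_sections A"
  shows "pairing \<beta> (sharp A H \<alpha>) = pairing \<alpha> (sharp A H \<beta>)"
  using H by (simp add: pairing_sharp assms eval_field_def Sym2_def)

lemma sharp_section:
  assumes \<alpha>: "\<alpha> \<in> dual_sections A"
  shows "sharp A H \<alpha> \<in> sections A"
proof (rule sectionsI[OF lsa_bundle])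
  note M = vector_bundle_base[OF lsa_bundle]
  show "sharp A H \<alpha> p \<in> fibre A p" for p
    unfolding sharp_def eval_field_def by (rule Psi_in_fibre[OF lsa_bundle Sym2_cochain(1)])
  fix U e j assume Ue: "(U, e) \<in> frames A" and j: "j < vrank A"
  note U = frameD(1)[OF lsa_bundle Ue]
  have "smooth_fun_on (base A) U (\<lambda>p. \<Sum>i<vrank A. \<alpha> p (e i p) * H p (map (\<lambda>i. coframe A e i p) [j, i]))"
  proof (rule smooth_fun_on_sum[OF M U], rule smooth_fun_on_mult[OF M U])
    fix i assume i: "i \<in> {..<vrank A}"
    show "smooth_fun_on (base A) U (\<lambda>p. \<alpha> p (e i p))"
      using \<alpha> Ue i unfolding dual_sections_iff[OF lsa_bundle] by blast
    show "smooth_fun_on (base A) U (\<lambda>p. H p (map (\<lambda>i. coframe A e i p) [j, i]))"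
      by (rule kv_cochainsD(2)[OF Sym2_cochain(1) Ue]) (use i j in auto)
  qed
  then show "smooth_fun_on (base A) U (\<lambda>p. coframe A e j p (sharp A H \<alpha> p))"
  proof (rule smooth_fun_on_cong[OF M U, rotated])
    fix p assume p: "p \<in> U"
    note c = coframe(1)[OF lsa_bundle Ue p]
    note \<alpha>p = dual_section_at[OF lsa_bundle \<alpha>, of p]
    have "coframe A e j p (sharp A H \<alpha> p) = H p ([\<alpha> p] @ [coframe A e j p])"
      unfolding sharp_def eval_field_def list.map
      by (rule Psi_eval[OF lsa_bundle Sym2_cochain(2) _ c[OF j]]) (use \<alpha>p in \<open>simp add: covecs_def\<close>)
    \<comment> \<open>Symmetry moves the covector field into the last slot, where it can be expanded
      in the coframe.\<close>
    also have "\<dots> = H p ([coframe A e j p] @ [\<alpha> p])" using H by (simp add: Sym2_def)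
    also have "\<dots> = H p ([coframe A e j p] @ [\<Sum>i<vrank A. \<alpha> p (e i p) *\<^sub>R coframe A e i p])"
      using dual_coframe_expansion[OF lsa_bundle Ue p \<alpha>p] by simp
    also have "\<dots> = (\<Sum>i<vrank A. \<alpha> p (e i p) * H p ([coframe A e j p] @ [coframe A e i p]))"
      by (rule kv_cochain_last_sum[OF lsa_bundle Sym2_cochain(2)]) (use c j in \<open>auto simp: covecs_def\<close>)
    finally show "(\<Sum>i<vrank A. \<alpha> p (e i p) * H p (map (\<lambda>i. coframe A e i p) [j, i])) =
        coframe A e j p (sharp A H \<alpha> p)" by simp
  qed
qed

text \<open>By symmetry, pairing the image of \<alpha> with \<gamma> is pairing \<alpha> with the
  image of \<gamma>, and this is visibly additive in \<alpha>.\<close>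

lemma sharp_add:
  assumes "\<alpha> \<in> dual_sections A" "\<beta> \<in> dual_sections A"
  shows "sharp A H (\<alpha> + \<beta>) = sharp A H \<alpha> + sharp A H \<beta>"
proof (rule section_eqI[OF lsa_bundle])
  note ab = sections_add[OF vector_bundle_dual[OF lsa_bundle] assms]
  note sh = sharp_section[OF assms(1)] sharp_section[OF assms(2)]
  show "sharp A H (\<alpha> + \<beta>) \<in> sections A" by (rule sharp_section[OF ab])
  show "sharp A H \<alpha> + sharp A H \<beta> \<in> sections A" by (rule sections_add[OF lsa_bundle sh])
  fix \<gamma> assume \<gamma>: "\<gamma> \<in> dual_sections A"
  show "pairing \<gamma> (sharp A H (\<alpha> + \<beta>)) = pairing \<gamma> (sharp A H \<alpha> + sharp A H \<beta>)"
    using pairing_sharp_commute[OF ab \<gamma>] pairing_sharp_commute[OF assms(1) \<gamma>]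
      pairing_sharp_commute[OF assms(2) \<gamma>] pairing_add_right[OF lsa_bundle \<gamma> sh]
    by (simp add: pairing_add_left)
qed

lemma sharp_fun_scale:
  assumes f: "f \<in> smooth_funs (base A)" and \<alpha>: "\<alpha> \<in> dual_sections A"
  shows "sharp A H (fun_scale f \<alpha>) = fun_scale f (sharp A H \<alpha>)"
proof (rule section_eqI[OF lsa_bundle])
  have fD: "f \<in> smooth_funs (base (dual_bundle A))" using f by simp
  note fa = sections_fun_scale[OF vector_bundle_dual[OF lsa_bundle] fD \<alpha>]
  show "sharp A H (fun_scale f \<alpha>) \<in> sections A" by (rule sharp_section[OF fa])
  show "fun_scale f (sharp A H \<alpha>) \<in> sections A" by (rule sections_fun_scale[OF lsa_bundle f sharp_section[OF \<alpha>]])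
  fix \<gamma> assume \<gamma>: "\<gamma> \<in> dual_sections A"
  show "pairing \<gamma> (sharp A H (fun_scale f \<alpha>)) = pairing \<gamma> (fun_scale f (sharp A H \<alpha>))"
    using pairing_sharp_commute[OF fa \<gamma>] pairing_sharp_commute[OF \<alpha> \<gamma>]
      pairing_fun_scale_right[OF lsa_bundle \<gamma> sharp_section[OF \<alpha>]]
    by (simp add: pairing_fun_scale_left)
qed

end

lemma eval_field_Psi_vec_cochain:
  assumes x: "x \<in> sections A"
  shows "eval_field (Psi A (vec_cochain A x)) [] = x"
proof
  fix p
  have "Psi A (vec_cochain A x) p [] = x p"
    by (rule Psi_unique[OF lsa_bundle section_in_fibre[OF lsa_bundle x]]) (simp add: vec_cochain_def covecs_def)
  then show "eval_field (Psi A (vec_cochain A x)) [] p = x p" by (simp add: eval_field_def)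
qed

end

section \<open>Brackets in low degree\<close>

lemma unshuffles_one:
  assumes "ns = [0, 1, 0] \<or> ns = [1, 0] \<or> ns = [0, 1]"
  shows "unshuffles ns = {id}"
  using assms
  by (auto simp: unshuffles_def strict_mono_on_def lessThan_Suc numeral_eq_Suc less_Suc_eq)

text \<open>Blocks of length at most 1 impose no monotonicity, so every permutation of two indices
  is an unshuffle.\<close>

lemma unshuffles_two:
  assumes "ns = [1, 1, 0] \<or> ns = [1, 1]"
  shows "unshuffles ns = {id, Transposition.transpose 0 1}"
proof -
  have "{..<sum_list ns} = {0, 1}" using assms by auto
  moreover have "\<forall>b<length ns. strict_mono_on {sum_list (take b ns)..<sum_list (take (Suc b) ns)} \<sigma>" for \<sigma> :: "nat \<Rightarrow> nat"
    using assms by (auto simp: strict_mono_on_def numeral_eq_Suc less_Suc_eq)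
  ultimately show ?thesis by (auto simp: unshuffles_def permutes_doubleton_iff)
qed

lemma sum_unshuffles_two:
  fixes f :: "_ \<Rightarrow> 'c::real_vector"
  assumes "ns = [1, 1, 0] \<or> ns = [1, 1]"
  shows "(\<Sum>\<sigma>\<in>unshuffles ns. of_int (sign \<sigma>) *\<^sub>R f \<sigma>) = f id - f (Transposition.transpose 0 1)"
proof -
  have "id \<noteq> Transposition.transpose (0::nat) 1"
    by (metis id_apply transpose_apply_first zero_neq_one)
  then show ?thesis unfolding unshuffles_two[OF assms] by (simp add: sign_swap_id sign_id)
qed

lemma sum_unshuffles_one:
  fixes f :: "_ \<Rightarrow> 'c::real_vector"
  assumes "ns = [0, 1, 0] \<or> ns = [1, 0] \<or> ns = [0, 1]"
  shows "(\<Sum>\<sigma>\<in>unshuffles ns. of_int (sign \<sigma>) *\<^sub>R f \<sigma>) = f id"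
  unfolding unshuffles_one[OF assms] by (simp add: sign_id)

text \<open>For m = n = 1 the sign (-1)^(m n) is -1: the middle sum enters with a plus and the
  commutators with a minus.\<close>

lemma hom_bracket_expr_1_1:
  "hom_bracket_expr A 1 P 1 Q [\<alpha>, \<beta>] =
    eval_field P [L_op A (eval_field Q [\<alpha>]) \<beta>] - eval_field P [L_op A (eval_field Q [\<beta>]) \<alpha>] +
    (eval_field Q [L_op A (eval_field P [\<alpha>]) \<beta>] - eval_field Q [L_op A (eval_field P [\<beta>]) \<alpha>]) -
    (sub_adj_bracket A (eval_field P [\<alpha>]) (eval_field Q [\<beta>]) -
     sub_adj_bracket A (eval_field P [\<beta>]) (eval_field Q [\<alpha>]))"
  unfolding hom_bracket_expr_def Let_def
  by (simp add: sum_unshuffles_two[unfolded One_nat_def] upt_rec)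

text \<open>For m = 0 the middle sum would have a block of length -1 and is 0.\<close>

lemma hom_bracket_expr_1_0:
  "hom_bracket_expr A 1 P 0 Q [\<alpha>] =
    eval_field P [L_op A (eval_field Q []) \<alpha>] + sub_adj_bracket A (eval_field P [\<alpha>]) (eval_field Q [])"
  unfolding hom_bracket_expr_def Let_def
  by (simp add: sum_unshuffles_one[unfolded One_nat_def] upt_rec)

text \<open>Now the first sum is the one that drops out, and the middle one keeps its minus sign. By
  antisymmetry of the commutator this is the negative of the other order.\<close>

lemma hom_bracket_expr_0_1:
  "hom_bracket_expr A 0 P 1 Q [\<alpha>] =
    - eval_field Q [L_op A (eval_field P []) \<alpha>] + sub_adj_bracket A (eval_field P []) (eval_field Q [\<alpha>])"
  unfolding hom_bracket_expr_def Let_def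
  by (simp add: sum_unshuffles_one[unfolded One_nat_def] upt_rec)

lemma length_one_eq: "length xs = 1 \<Longrightarrow> \<exists>x. xs = [x]"
  by (cases xs) auto

lemma length_two_eq: "length xs = 2 \<Longrightarrow> \<exists>x y. xs = [x, y]"
  by (cases xs; cases "tl xs") auto

section \<open>Brackets of symmetric tensors with each other and with sections\<close>

context
  fixes A :: "('m::{t2_space, second_countable_topology}, 'v::real_vector) lsalgebroid"
  assumes A: "left_symmetric_algebroid A"
begin

text \<open>The cochain is the preimage of W under \<open>Psi\<close>: pair W with one more covector
  field, in which the result is linear by itself. The hypotheses on W are the ones to be checked for
  a bracket.\<close>

lemma exists_cochain_of_section_valued:
  fixes W :: "('m \<Rightarrow> 'v \<Rightarrow> real) list \<Rightarrow> 'm \<Rightarrow> 'v"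
  assumes sec: "\<And>cs. length cs = k \<Longrightarrow> set cs \<subseteq> dual_sections A \<Longrightarrow> W cs \<in> sections A"
    and scale: "\<And>cs i f. length cs = k \<Longrightarrow> set cs \<subseteq> dual_sections A \<Longrightarrow> i < k \<Longrightarrow>
      f \<in> smooth_funs (base A) \<Longrightarrow> W (cs[i := fun_scale f (cs ! i)]) = fun_scale f (W cs)"
    and add: "\<And>cs i \<beta>. length cs = k \<Longrightarrow> set cs \<subseteq> dual_sections A \<Longrightarrow> i < k \<Longrightarrow>
      \<beta> \<in> dual_sections A \<Longrightarrow> W (cs[i := cs ! i + \<beta>]) = W cs + W (cs[i := \<beta>])"
    and skew: "\<And>cs i l. length cs = k \<Longrightarrow> set cs \<subseteq> dual_sections A \<Longrightarrow> i < l \<Longrightarrow> l < k \<Longrightarrow>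
      W (cs[i := cs ! l, l := cs ! i]) = - W cs"
  obtains T where "T \<in> kv_cochains A (Suc k)"
    "\<forall>cs \<beta>. length cs = k \<and> set cs \<subseteq> dual_sections A \<and> \<beta> \<in> dual_sections A \<longrightarrow>
      eval_field T (cs @ [\<beta>]) = pairing \<beta> (W cs)"
proof -
  let ?D = "dual_bundle A"
  let ?G = "\<lambda>gs. pairing (last gs) (W (butlast gs))"
  have split: "\<exists>cs \<beta>. gs = cs @ [\<beta>] \<and> length cs = k \<and> set cs \<subseteq> sections ?D \<and> \<beta> \<in> sections ?D"
    if "length gs = Suc k" "set gs \<subseteq> sections ?D" for gs
    using that by (cases gs rule: rev_cases) auto
  have "tensorial ?D (Suc k) ?G"
    unfolding tensorial_def
  proof (intro allI impI)
    fix gs assume "length gs = Suc k \<and> set gs \<subseteq> sections ?D"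
    then obtain cs \<beta> where g: "gs = cs @ [\<beta>]" and a: "length cs = k" "set cs \<subseteq> sections ?D"
      and b: "\<beta> \<in> sections ?D" using split by blast
    have "?G gs \<in> smooth_funs (base ?D)" using pairing_smooth[OF lsa_bundle[OF A] b sec[OF a]] g by simp
    moreover have "?G (gs[i := fun_scale f (gs ! i)]) = f * ?G gs"
      if "i < Suc k" "f \<in> smooth_funs (base ?D)" for i f
    \<comment> \<open>Slots below k belong to W; slot k is the covector field that W is paired
      with.\<close>
    proof (cases "i < k")
      case True
      then show ?thesis using g a scale[OF a True, of f] that(2) pairing_fun_scale_right[OF lsa_bundle[OF A] b sec[OF a]]
        by (simp add: list_update_append nth_append)
    next
      case False
      then have "i = k" using that(1) by simp
      then show ?thesis using g a by (simp add: list_update_append nth_append pairing_fun_scale_left)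
    qed
    moreover have "?G (gs[i := gs ! i + \<xi>]) = ?G gs + ?G (gs[i := \<xi>])"
      if "i < Suc k" "\<xi> \<in> sections ?D" for i \<xi>
    proof (cases "i < k")
      case True
      have "W (cs[i := \<xi>]) \<in> sections A"
        using a set_list_update_subset[OF a(2) that(2)] by (intro sec) simp_all
      then show ?thesis using g a add[OF a True that(2)] pairing_add_right[OF lsa_bundle[OF A] b sec[OF a]] True
        by (simp add: list_update_append nth_append)
    next
      case False
      then have "i = k" using that(1) by simp
      then show ?thesis using g a by (simp add: list_update_append nth_append pairing_add_left)
    qed
    ultimately show "?G gs \<in> smooth_funs (base ?D) \<and>
        (\<forall>i<Suc k. (\<forall>f\<in>smooth_funs (base ?D). ?G (gs[i := fun_scale f (gs ! i)]) = f * ?G gs) \<and>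
           (\<forall>\<xi>\<in>sections ?D. ?G (gs[i := gs ! i + \<xi>]) = ?G gs + ?G (gs[i := \<xi>])))"
      by blast
  qed
  moreover have "?G (gs[i := gs ! l, l := gs ! i]) = - ?G gs"
    if gs: "length gs = Suc k" "set gs \<subseteq> sections ?D" and il: "i < l" "l < Suc k - 1" for gs i l
  proof -
    obtain cs \<beta> where g: "gs = cs @ [\<beta>]" and a: "length cs = k" "set cs \<subseteq> sections ?D"
      and b: "\<beta> \<in> sections ?D" using split[OF gs] by blast
    show ?thesis
      using g a il skew[OF a, of i l] pairing_uminus_right[OF lsa_bundle[OF A] b sec[OF a]]
      by (simp add: list_update_append nth_append)
  qed
  ultimately obtain T where T: "T \<in> kv_cochains A (Suc k)"
    "\<forall>gs. length gs = Suc k \<and> set gs \<subseteq> sections ?D \<longrightarrow> eval_field T gs = ?G gs"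
    by (rule exists_kv_cochain[OF lsa_bundle[OF A]])
  show ?thesis
    by (rule that[OF T(1)]) (use T(2) in simp)
qed

lemma hom_bracket_expr_sharp_sharp:
  "hom_bracket_expr A 1 (Psi A H) 1 (Psi A K) [\<alpha>, \<beta>] =
    sharp A H (L_op A (sharp A K \<alpha>) \<beta>) - sharp A H (L_op A (sharp A K \<beta>) \<alpha>) +
    (sharp A K (L_op A (sharp A H \<alpha>) \<beta>) - sharp A K (L_op A (sharp A H \<beta>) \<alpha>)) -
    (sub_adj_bracket A (sharp A H \<alpha>) (sharp A K \<beta>) - sub_adj_bracket A (sharp A H \<beta>) (sharp A K \<alpha>))"
  unfolding hom_bracket_expr_1_1 sharp_def ..

text \<open>Symmetry moves the map of H off L, and the definition of L then turns the pairing of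
  \<gamma> with H^sharp(L_x \<beta>) into an anchor term and a product term. With x =
  K^sharp(\<alpha>) these are terms of \<open>KV_expr A K H\<close>; exchanging H and K gives the
  other half. For K = H the bracket is twice [H, H].\<close>

lemma kv_bracket_Sym2_Sym2:
  assumes H: "H \<in> Sym2 A" and K: "K \<in> Sym2 A"
  shows "kv_bracket A 1 H 1 K \<in> kv_cochains A 3"
    and "\<alpha> \<in> dual_sections A \<Longrightarrow> \<beta> \<in> dual_sections A \<Longrightarrow> \<gamma> \<in> dual_sections A \<Longrightarrow>
      eval_field (kv_bracket A 1 H 1 K) [\<alpha>, \<beta>, \<gamma>] = KV_expr A H K \<alpha> \<beta> \<gamma> + KV_expr A K H \<alpha> \<beta> \<gamma>"
proof -
  let ?D = "dual_bundle A"
  define W where "W cs = hom_bracket_expr A 1 (Psi A H) 1 (Psi A K) cs" for cs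
  note W_eq = hom_bracket_expr_sharp_sharp[of H K, folded W_def]
  note D = vector_bundle_dual[OF lsa_bundle[OF A]]
  note shH = sharp_section[OF A H] and shK = sharp_section[OF A K]
  note L = L_op(1)[OF A]
  have sec2: "W [\<alpha>, \<beta>] \<in> sections A" if "\<alpha> \<in> sections ?D" "\<beta> \<in> sections ?D" for \<alpha> \<beta>
    unfolding W_eq using that
    by (intro sections_diff[OF lsa_bundle[OF A]] sections_add[OF lsa_bundle[OF A]] shH shK L sub_adj_bracket_section[OF A])
  have skew2: "W [\<beta>, \<alpha>] = - W [\<alpha>, \<beta>]" for \<alpha> \<beta>
    unfolding W_eq by simp
  \<comment> \<open>The six terms are split into two groups of three that are each linear over
    functions in \<xi>: the anchor term from L applied to f \<xi> cancels the one from the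
    commutator of the same group.\<close>
  define S where "S H' K' \<xi> \<beta> = sharp A H' (L_op A (sharp A K' \<xi>) \<beta>) - sharp A H' (L_op A (sharp A K' \<beta>) \<xi>)
    + sub_adj_bracket A (sharp A K' \<beta>) (sharp A H' \<xi>)" for H' K' \<xi> \<beta>
  have W_split: "W [\<xi>, \<beta>] = S H K \<xi> \<beta> + S K H \<xi> \<beta>" for \<xi> \<beta>
    unfolding W_eq S_def using sub_adj_bracket_swap[OF A, of "sharp A K \<beta>" "sharp A H \<xi>"] by simp
  have scale2: "W [fun_scale f \<alpha>, \<beta>] = fun_scale f (W [\<alpha>, \<beta>])"
    if \<alpha>: "\<alpha> \<in> sections ?D" and \<beta>: "\<beta> \<in> sections ?D" and f: "f \<in> smooth_funs (base A)" for \<alpha> \<beta> f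
  proof -
    have fD: "f \<in> smooth_funs (base ?D)" using f by simp
    have summand: "S H' K' (fun_scale f \<alpha>) \<beta> = fun_scale f (S H' K' \<alpha> \<beta>)"
      if H': "H' \<in> Sym2 A" and K': "K' \<in> Sym2 A" for H' K'
    proof -
      note sH = sharp_section[OF A H'] and sK = sharp_section[OF A K']
      have aD: "anchor_act A (sharp A K' \<beta>) f \<in> smooth_funs (base A)" by (rule anchor_act_smooth[OF A sK[OF \<beta>] f])
      then have aD': "anchor_act A (sharp A K' \<beta>) f \<in> smooth_funs (base ?D)" by simp
      have "sharp A H' (L_op A (sharp A K' (fun_scale f \<alpha>)) \<beta>) = fun_scale f (sharp A H' (L_op A (sharp A K' \<alpha>) \<beta>))"
        using sharp_fun_scale[OF A K' f \<alpha>] L_op_fun_scale_left[OF A f sK[OF \<alpha>] \<beta>]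
          sharp_fun_scale[OF A H' f L[OF sK[OF \<alpha>] \<beta>]] by simp
      moreover have "sharp A H' (L_op A (sharp A K' \<beta>) (fun_scale f \<alpha>)) =
          fun_scale f (sharp A H' (L_op A (sharp A K' \<beta>) \<alpha>)) + fun_scale (anchor_act A (sharp A K' \<beta>) f) (sharp A H' \<alpha>)"
        using L_op_fun_scale_right[OF A f sK[OF \<beta>] \<alpha>] sharp_fun_scale[OF A H' f L[OF sK[OF \<beta>] \<alpha>]]
          sharp_fun_scale[OF A H' aD \<alpha>]
          sharp_add[OF A H' sections_fun_scale[OF D fD L[OF sK[OF \<beta>] \<alpha>]] sections_fun_scale[OF D aD' \<alpha>]]
        by simp
      moreover have "sub_adj_bracket A (sharp A K' \<beta>) (sharp A H' (fun_scale f \<alpha>)) =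
          fun_scale f (sub_adj_bracket A (sharp A K' \<beta>) (sharp A H' \<alpha>)) +
          fun_scale (anchor_act A (sharp A K' \<beta>) f) (sharp A H' \<alpha>)"
        using sharp_fun_scale[OF A H' f \<alpha>] sub_adj_bracket_fun_scale_right[OF A f sK[OF \<beta>] sH[OF \<alpha>]] by simp
      ultimately show ?thesis by (simp add: S_def fun_scale_add fun_scale_diff)
    qed
    show ?thesis unfolding W_split using summand[OF H K] summand[OF K H] by (simp add: fun_scale_add)
  qed
  have add2: "W [\<alpha> + \<alpha>', \<beta>] = W [\<alpha>, \<beta>] + W [\<alpha>', \<beta>]"
    if \<alpha>: "\<alpha> \<in> sections ?D" "\<alpha>' \<in> sections ?D" and \<beta>: "\<beta> \<in> sections ?D" for \<alpha> \<alpha>' \<beta>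
  proof -
    have summand: "S H' K' (\<alpha> + \<alpha>') \<beta> = S H' K' \<alpha> \<beta> + S H' K' \<alpha>' \<beta>"
      if H': "H' \<in> Sym2 A" and K': "K' \<in> Sym2 A" for H' K'
    proof -
      note sH = sharp_section[OF A H'] and sK = sharp_section[OF A K']
      have "sharp A H' (L_op A (sharp A K' (\<alpha> + \<alpha>')) \<beta>) =
          sharp A H' (L_op A (sharp A K' \<alpha>) \<beta>) + sharp A H' (L_op A (sharp A K' \<alpha>') \<beta>)"
        using sharp_add[OF A K' \<alpha>] L_op_add_left[OF A sK[OF \<alpha>(1)] sK[OF \<alpha>(2)] \<beta>]
          sharp_add[OF A H' L[OF sK[OF \<alpha>(1)] \<beta>] L[OF sK[OF \<alpha>(2)] \<beta>]] by simp
      moreover have "sharp A H' (L_op A (sharp A K' \<beta>) (\<alpha> + \<alpha>')) =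
          sharp A H' (L_op A (sharp A K' \<beta>) \<alpha>) + sharp A H' (L_op A (sharp A K' \<beta>) \<alpha>')"
        using L_op_add_right[OF A sK[OF \<beta>] \<alpha>]
          sharp_add[OF A H' L[OF sK[OF \<beta>] \<alpha>(1)] L[OF sK[OF \<beta>] \<alpha>(2)]] by simp
      moreover have "sub_adj_bracket A (sharp A K' \<beta>) (sharp A H' (\<alpha> + \<alpha>')) =
          sub_adj_bracket A (sharp A K' \<beta>) (sharp A H' \<alpha>) + sub_adj_bracket A (sharp A K' \<beta>) (sharp A H' \<alpha>')"
        using sharp_add[OF A H' \<alpha>] sub_adj_bracket_add_right[OF A sK[OF \<beta>] sH[OF \<alpha>(1)] sH[OF \<alpha>(2)]] by simp
      ultimately show ?thesis by (simp add: S_def)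
    qed
    show ?thesis unfolding W_split using summand[OF H K] summand[OF K H] by simp
  qed
  have two: "\<exists>\<alpha> \<beta>. cs = [\<alpha>, \<beta>] \<and> \<alpha> \<in> sections ?D \<and> \<beta> \<in> sections ?D"
    if "length cs = 2" "set cs \<subseteq> sections ?D" for cs
    using length_two_eq[OF that(1)] that(2) by auto
  obtain T where T: "T \<in> kv_cochains A (Suc 2)"
    "\<forall>cs \<beta>. length cs = 2 \<and> set cs \<subseteq> sections ?D \<and> \<beta> \<in> sections ?D \<longrightarrow>
      eval_field T (cs @ [\<beta>]) = pairing \<beta> (W cs)"
  proof (rule exists_cochain_of_section_valued[of 2 W])
    show "W cs \<in> sections A" if "length cs = 2" "set cs \<subseteq> sections ?D" for cs
      using two[OF that] sec2 by auto
  next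
    fix cs i f assume "length cs = 2" "set cs \<subseteq> sections ?D" and i: "i < (2::nat)" and f: "f \<in> smooth_funs (base A)"
    then obtain \<alpha> \<beta> where ab: "cs = [\<alpha>, \<beta>]" "\<alpha> \<in> sections ?D" "\<beta> \<in> sections ?D" using two by blast
    \<comment> \<open>Linearity in the second argument is reduced to that in the first by
      skewness.\<close>
    have "W [\<alpha>, fun_scale f \<beta>] = - W [fun_scale f \<beta>, \<alpha>]" by (rule skew2)
    also have "\<dots> = fun_scale f (- W [\<beta>, \<alpha>])" unfolding scale2[OF ab(3,2) f] fun_scale_uminus ..
    also have "- W [\<beta>, \<alpha>] = W [\<alpha>, \<beta>]" by (rule skew2[symmetric])
    finally have "W [\<alpha>, fun_scale f \<beta>] = fun_scale f (W [\<alpha>, \<beta>])" .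
    then show "W (cs[i := fun_scale f (cs ! i)]) = fun_scale f (W cs)"
      using ab scale2[OF ab(2,3) f] i by (auto simp: less_2_cases_iff)
  next
    fix cs i \<xi> assume "length cs = 2" "set cs \<subseteq> sections ?D" and i: "i < (2::nat)" and \<xi>: "\<xi> \<in> sections ?D"
    then obtain \<alpha> \<beta> where ab: "cs = [\<alpha>, \<beta>]" "\<alpha> \<in> sections ?D" "\<beta> \<in> sections ?D" using two by blast
    have "W [\<alpha>, \<beta> + \<xi>] = - W [\<beta> + \<xi>, \<alpha>]" by (rule skew2)
    also have "\<dots> = - W [\<beta>, \<alpha>] + - W [\<xi>, \<alpha>]"
      unfolding add2[OF ab(3) \<xi> ab(2)] by (rule minus_add_distrib)
    also have "\<dots> = W [\<alpha>, \<beta>] + W [\<alpha>, \<xi>]"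
      by (rule arg_cong2[where f = "(+)"]) (rule skew2[symmetric])+
    finally have "W [\<alpha>, \<beta> + \<xi>] = W [\<alpha>, \<beta>] + W [\<alpha>, \<xi>]" .
    then show "W (cs[i := cs ! i + \<xi>]) = W cs + W (cs[i := \<xi>])"
      using ab add2[OF ab(2) \<xi> ab(3)] i by (auto simp: less_2_cases_iff)
  next
    fix cs i l assume "length cs = 2" "set cs \<subseteq> sections ?D" and il: "i < l" "l < (2::nat)"
    then obtain \<alpha> \<beta> where ab: "cs = [\<alpha>, \<beta>]" using two by blast
    have "i = 0" "l = 1" using il by auto
    then have "cs[i := cs ! l, l := cs ! i] = [\<beta>, \<alpha>]" using ab by simp
    then show "W (cs[i := cs ! l, l := cs ! i]) = - W cs" unfolding ab by (simp only: skew2[of \<beta> \<alpha>])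
  qed
  have T3: "T \<in> kv_cochains A 3" using T(1) by (simp add: numeral_3_eq_3)
  have br: "kv_bracket A 1 H 1 K = T"
  proof (rule kv_bracket_eqI[OF lsa_bundle[OF A]])
    show "T \<in> kv_cochains A (1 + 1 + 1)" using T3 by (simp add: numeral_3_eq_3)
    fix cs :: "('m \<Rightarrow> 'v \<Rightarrow> real) list"
    assume "length cs = 1 + 1" "set cs \<subseteq> sections ?D"
    then have as: "length cs = 2" "set cs \<subseteq> sections ?D" by simp_all
    have "W cs \<in> sections A" using two[OF as] sec2 by auto
    then show "hom_bracket_expr A 1 (Psi A H) 1 (Psi A K) cs p \<in> fibre A p" for p
      unfolding W_def[symmetric] by (rule section_in_fibre[OF lsa_bundle[OF A]])
    show "eval_field T (cs @ [\<beta>]) = pairing \<beta> (hom_bracket_expr A 1 (Psi A H) 1 (Psi A K) cs)"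
      if "\<beta> \<in> sections ?D" for \<beta>
      unfolding W_def[symmetric] using T(2) as that by blast
  qed
  show "kv_bracket A 1 H 1 K \<in> kv_cochains A 3" using br T3 by simp
  assume \<alpha>: "\<alpha> \<in> sections ?D" and \<beta>: "\<beta> \<in> sections ?D" and \<gamma>: "\<gamma> \<in> sections ?D"
  have "eval_field T [\<alpha>, \<beta>, \<gamma>] = pairing \<gamma> (W [\<alpha>, \<beta>])"
    using T(2)[rule_format, of "[\<alpha>, \<beta>]" \<gamma>] \<alpha> \<beta> \<gamma> by simp
  also have "\<dots> = KV_expr A H K \<alpha> \<beta> \<gamma> + KV_expr A K H \<alpha> \<beta> \<gamma>"
  proof -
    \<comment> \<open>Symmetry of H' is used twice: to move its map onto \<gamma> before L is
      unfolded, and to move it back to \<eta> under the anchor.\<close>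
    have summand: "pairing \<gamma> (sharp A H' (L_op A (sharp A K' \<xi>) \<eta>)) =
        anchor_act A (sharp A K' \<xi>) (pairing \<gamma> (sharp A H' \<eta>)) - pairing \<eta> (lprod A (sharp A K' \<xi>) (sharp A H' \<gamma>))"
      if "H' \<in> Sym2 A" "K' \<in> Sym2 A" and \<xi>: "\<xi> \<in> sections ?D" and \<eta>: "\<eta> \<in> sections ?D" for H' K' \<xi> \<eta>
      using pairing_sharp_commute[OF A that(1) L[OF sharp_section[OF A that(2) \<xi>] \<eta>] \<gamma>]
        L_op(2)[OF A sharp_section[OF A that(2) \<xi>] \<eta> sharp_section[OF A that(1) \<gamma>]]
        pairing_sharp_commute[OF A that(1) \<eta> \<gamma>] by simp
    have "pairing \<gamma> (W [\<alpha>, \<beta>]) =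
      pairing \<gamma> (sharp A H (L_op A (sharp A K \<alpha>) \<beta>)) - pairing \<gamma> (sharp A H (L_op A (sharp A K \<beta>) \<alpha>)) +
      (pairing \<gamma> (sharp A K (L_op A (sharp A H \<alpha>) \<beta>)) - pairing \<gamma> (sharp A K (L_op A (sharp A H \<beta>) \<alpha>))) -
      (pairing \<gamma> (sub_adj_bracket A (sharp A H \<alpha>) (sharp A K \<beta>)) -
       pairing \<gamma> (sub_adj_bracket A (sharp A H \<beta>) (sharp A K \<alpha>)))"
      unfolding W_eq
      by (simp add: pairing_diff_right[OF lsa_bundle[OF A] \<gamma>] pairing_add_right[OF lsa_bundle[OF A] \<gamma>] sections_diff[OF lsa_bundle[OF A]]
          sections_add[OF lsa_bundle[OF A]] shH shK L sub_adj_bracket_section[OF A] \<alpha> \<beta>)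
    moreover have "pairing \<gamma> (sub_adj_bracket A (sharp A H \<beta>) (sharp A K \<alpha>)) =
        - pairing \<gamma> (sub_adj_bracket A (sharp A K \<alpha>) (sharp A H \<beta>))"
      using sub_adj_bracket_swap[OF A, of "sharp A H \<beta>" "sharp A K \<alpha>"]
        pairing_uminus_right[OF lsa_bundle[OF A] \<gamma> sub_adj_bracket_section[OF A shK[OF \<alpha>] shH[OF \<beta>]]] by simp
    ultimately show ?thesis
      unfolding KV_expr_def using summand[OF H K] summand[OF K H] \<alpha> \<beta> by simp
  qed
  finally show "eval_field (kv_bracket A 1 H 1 K) [\<alpha>, \<beta>, \<gamma>] = KV_expr A H K \<alpha> \<beta> \<gamma> + KV_expr A K H \<alpha> \<beta> \<gamma>"
    using br by simp
qed

text \<open>The order of arguments matters: the differential uses [[K, x]] and the exponential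
  [[x, K]], and the latter is the negative. In the values on \<alpha>, \<beta> the first three terms
  together are symmetric, so that symmetry of the bracket is decided by the last one.\<close>

lemma kv_bracket_Sym2_vec:
  assumes K: "K \<in> Sym2 A" and x: "x \<in> sections A"
  shows "kv_bracket A 1 K 0 (vec_cochain A x) \<in> kv_cochains A 2"
    and "kv_bracket A 0 (vec_cochain A x) 1 K = - kv_bracket A 1 K 0 (vec_cochain A x)"
    and "\<alpha> \<in> dual_sections A \<Longrightarrow> \<beta> \<in> dual_sections A \<Longrightarrow>
      eval_field (kv_bracket A 1 K 0 (vec_cochain A x)) [\<alpha>, \<beta>] =
        anchor_act A x (pairing \<beta> (sharp A K \<alpha>)) - pairing \<alpha> (lprod A x (sharp A K \<beta>))
        - pairing \<beta> (lprod A x (sharp A K \<alpha>)) + pairing \<beta> (lprod A (sharp A K \<alpha>) x)"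
proof -
  let ?D = "dual_bundle A"
  note D = vector_bundle_dual[OF lsa_bundle[OF A]]
  note sh = sharp_section[OF A K] and L = L_op(1)[OF A x]
  define V where "V \<alpha> = sharp A K (L_op A x \<alpha>) - sub_adj_bracket A x (sharp A K \<alpha>)" for \<alpha>
  have expr: "hom_bracket_expr A 1 (Psi A K) 0 (Psi A (vec_cochain A x)) [\<alpha>] = V \<alpha>" for \<alpha>
    unfolding hom_bracket_expr_1_0 eval_field_Psi_vec_cochain[OF A x] V_def sharp_def[symmetric]
    using sub_adj_bracket_swap[OF A, of "sharp A K \<alpha>" x] by simp
  have expr': "hom_bracket_expr A 0 (Psi A (vec_cochain A x)) 1 (Psi A K) [\<alpha>] = - V \<alpha>" for \<alpha>
    unfolding hom_bracket_expr_0_1 eval_field_Psi_vec_cochain[OF A x] V_def sharp_def[symmetric] by simp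
  have V_sec: "V \<alpha> \<in> sections A" if "\<alpha> \<in> sections ?D" for \<alpha>
    unfolding V_def using that by (intro sections_diff[OF lsa_bundle[OF A]] sh L sub_adj_bracket_section[OF A] x)
  have one: "\<exists>\<alpha>. cs = [\<alpha>] \<and> \<alpha> \<in> sections ?D" if "length cs = 1" "set cs \<subseteq> sections ?D" for cs
    using length_one_eq[OF that(1)] that(2) by auto
  obtain T where T: "T \<in> kv_cochains A (Suc 1)"
    "\<forall>cs \<beta>. length cs = 1 \<and> set cs \<subseteq> sections ?D \<and> \<beta> \<in> sections ?D \<longrightarrow>
      eval_field T (cs @ [\<beta>]) = pairing \<beta> (V (hd cs))"
  proof (rule exists_cochain_of_section_valued[of 1 "\<lambda>cs. V (hd cs)"])
    show "V (hd cs) \<in> sections A" if "length cs = 1" "set cs \<subseteq> sections ?D" for cs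
      using one[OF that] V_sec by auto
  next
    fix cs i f assume "length cs = 1" "set cs \<subseteq> sections ?D" and i: "i < (1::nat)" and f: "f \<in> smooth_funs (base A)"
    then obtain \<alpha> where cs: "cs = [\<alpha>]" and \<alpha>: "\<alpha> \<in> sections ?D" using one by blast
    have aD: "anchor_act A x f \<in> smooth_funs (base A)" by (rule anchor_act_smooth[OF A x f])
    then have fD: "f \<in> smooth_funs (base ?D)" "anchor_act A x f \<in> smooth_funs (base ?D)" using f by simp_all
    \<comment> \<open>The term a(x)(f) K^sharp(\<alpha>) comes once from L and once from the
      commutator, with opposite signs.\<close>
    have "V (fun_scale f \<alpha>) = fun_scale f (V \<alpha>)"
      unfolding V_def
      using L_op_fun_scale_right[OF A f x \<alpha>] sharp_fun_scale[OF A K f L[OF \<alpha>]] sharp_fun_scale[OF A K aD \<alpha>]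
        sharp_add[OF A K sections_fun_scale[OF D fD(1) L[OF \<alpha>]] sections_fun_scale[OF D fD(2) \<alpha>]]
        sharp_fun_scale[OF A K f \<alpha>] sub_adj_bracket_fun_scale_right[OF A f x sh[OF \<alpha>]]
      by (simp add: fun_scale_diff)
    then show "V (hd (cs[i := fun_scale f (cs ! i)])) = fun_scale f (V (hd cs))" using cs i by simp
  next
    fix cs i \<xi> assume "length cs = 1" "set cs \<subseteq> sections ?D" and i: "i < (1::nat)" and \<xi>: "\<xi> \<in> sections ?D"
    then obtain \<alpha> where cs: "cs = [\<alpha>]" and \<alpha>: "\<alpha> \<in> sections ?D" using one by blast
    have "V (\<alpha> + \<xi>) = V \<alpha> + V \<xi>"
      unfolding V_def
      using L_op_add_right[OF A x \<alpha> \<xi>] sharp_add[OF A K L[OF \<alpha>] L[OF \<xi>]] sharp_add[OF A K \<alpha> \<xi>]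
        sub_adj_bracket_add_right[OF A x sh[OF \<alpha>] sh[OF \<xi>]] by simp
    then show "V (hd (cs[i := cs ! i + \<xi>])) = V (hd cs) + V (hd (cs[i := \<xi>]))" using cs i by simp
  qed simp
  have T2: "T \<in> kv_cochains A 2" using T(1) by (simp add: numeral_2_eq_2)
  have T_ev: "eval_field T [\<alpha>, \<beta>] = pairing \<beta> (V \<alpha>)" if "\<alpha> \<in> sections ?D" "\<beta> \<in> sections ?D" for \<alpha> \<beta>
    using T(2)[rule_format, of "[\<alpha>]" \<beta>] that by simp
  have br: "kv_bracket A 1 K 0 (vec_cochain A x) = T"
  proof (rule kv_bracket_eqI[OF lsa_bundle[OF A]])
    show "T \<in> kv_cochains A (0 + 1 + 1)" using T2 by (simp add: numeral_2_eq_2)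
    fix cs :: "('m \<Rightarrow> 'v \<Rightarrow> real) list"
    assume "length cs = 0 + 1" "set cs \<subseteq> sections ?D"
    then obtain \<alpha> where cs: "cs = [\<alpha>]" and \<alpha>: "\<alpha> \<in> sections ?D" using one[of cs] by auto
    show "hom_bracket_expr A 1 (Psi A K) 0 (Psi A (vec_cochain A x)) cs p \<in> fibre A p" for p
      unfolding cs expr by (rule section_in_fibre[OF lsa_bundle[OF A] V_sec[OF \<alpha>]])
    show "eval_field T (cs @ [\<beta>]) = pairing \<beta> (hom_bracket_expr A 1 (Psi A K) 0 (Psi A (vec_cochain A x)) cs)"
      if "\<beta> \<in> sections ?D" for \<beta>
      unfolding cs expr using T_ev[OF \<alpha> that] by simp
  qed
  have br': "kv_bracket A 0 (vec_cochain A x) 1 K = - T"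
  proof (rule kv_bracket_eqI[OF lsa_bundle[OF A]])
    show "- T \<in> kv_cochains A (1 + 0 + 1)"
      using kv_cochains_uminus[OF lsa_bundle[OF A] T2] by (simp add: numeral_2_eq_2)
    fix cs :: "('m \<Rightarrow> 'v \<Rightarrow> real) list"
    assume "length cs = 1 + 0" "set cs \<subseteq> sections ?D"
    then obtain \<alpha> where cs: "cs = [\<alpha>]" and \<alpha>: "\<alpha> \<in> sections ?D" using one[of cs] by auto
    show "hom_bracket_expr A 0 (Psi A (vec_cochain A x)) 1 (Psi A K) cs p \<in> fibre A p" for p
      unfolding cs expr' by (rule section_in_fibre[OF lsa_bundle[OF A] sections_uminus[OF lsa_bundle[OF A] V_sec[OF \<alpha>]]])
    show "eval_field (- T) (cs @ [\<beta>]) = pairing \<beta> (hom_bracket_expr A 0 (Psi A (vec_cochain A x)) 1 (Psi A K) cs)"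
      if "\<beta> \<in> sections ?D" for \<beta>
    proof -
      have "eval_field (- T) [\<alpha>, \<beta>] = - eval_field T [\<alpha>, \<beta>]" by (simp add: eval_field_def fun_eq_iff)
      then show ?thesis
        unfolding cs expr' using T_ev[OF \<alpha> that] pairing_uminus_right[OF lsa_bundle[OF A] that V_sec[OF \<alpha>]] by simp
    qed
  qed
  show "kv_bracket A 1 K 0 (vec_cochain A x) \<in> kv_cochains A 2" using br T2 by simp
  show "kv_bracket A 0 (vec_cochain A x) 1 K = - kv_bracket A 1 K 0 (vec_cochain A x)" using br br' by simp
  assume \<alpha>: "\<alpha> \<in> sections ?D" and \<beta>: "\<beta> \<in> sections ?D"
  have "pairing \<beta> (V \<alpha>) = pairing \<beta> (sharp A K (L_op A x \<alpha>)) - pairing \<beta> (sub_adj_bracket A x (sharp A K \<alpha>))"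
    unfolding V_def by (rule pairing_diff_right[OF lsa_bundle[OF A] \<beta> sh[OF L[OF \<alpha>]] sub_adj_bracket_section[OF A x sh[OF \<alpha>]]])
  also have "pairing \<beta> (sub_adj_bracket A x (sharp A K \<alpha>)) =
      pairing \<beta> (lprod A x (sharp A K \<alpha>)) - pairing \<beta> (lprod A (sharp A K \<alpha>) x)"
    unfolding sub_adj_bracket_def
    by (rule pairing_diff_right[OF lsa_bundle[OF A] \<beta> lsa_product(1)[OF A x sh[OF \<alpha>]] lsa_product(1)[OF A sh[OF \<alpha>] x]])
  also have "pairing \<beta> (sharp A K (L_op A x \<alpha>)) =
      anchor_act A x (pairing \<beta> (sharp A K \<alpha>)) - pairing \<alpha> (lprod A x (sharp A K \<beta>))"
    using pairing_sharp_commute[OF A K L[OF \<alpha>] \<beta>] L_op(2)[OF A x \<alpha> sh[OF \<beta>]]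
      pairing_sharp_commute[OF A K \<alpha> \<beta>] by simp
  finally show "eval_field (kv_bracket A 1 K 0 (vec_cochain A x)) [\<alpha>, \<beta>] =
        anchor_act A x (pairing \<beta> (sharp A K \<alpha>)) - pairing \<alpha> (lprod A x (sharp A K \<beta>))
        - pairing \<beta> (lprod A x (sharp A K \<alpha>)) + pairing \<beta> (lprod A (sharp A K \<alpha>) x)"
    unfolding br T_ev[OF \<alpha> \<beta>] by (simp add: fun_eq_iff)
qed

end

section \<open>Deformations and cocycles\<close>

text \<open>Since g is onto Z and matches the relations pair by pair, the image of the class of a is
  exactly the class of g(a).\<close>

lemma bij_betw_quotients:
  assumes g: "bij_betw g D Z" and R: "R \<subseteq> D \<times> D" and S: "S \<subseteq> Z \<times> Z"
    and RS: "\<And>a b. a \<in> D \<Longrightarrow> b \<in> D \<Longrightarrow> (a, b) \<in> R \<longleftrightarrow> (g a, g b) \<in> S"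
  shows "bij_betw (\<lambda>X. g ` X) (D // R) (Z // S)"
    and "a \<in> D \<Longrightarrow> g ` (R `` {a}) = S `` {g a}"
proof -
  have im: "g ` D = Z" and inj: "inj_on g D" using g by (auto simp: bij_betw_def)
  show img: "g ` (R `` {a}) = S `` {g a}" if a: "a \<in> D" for a
  proof
    show "g ` (R `` {a}) \<subseteq> S `` {g a}" using R RS a by auto
    show "S `` {g a} \<subseteq> g ` (R `` {a})"
    proof
      fix z assume z: "z \<in> S `` {g a}"
      then obtain b where "b \<in> D" "z = g b" using S im by blast
      then show "z \<in> g ` (R `` {a})" using z RS a by auto
    qed
  qed
  show "bij_betw (\<lambda>X. g ` X) (D // R) (Z // S)"
    unfolding bij_betw_def
  proof
    \<comment> \<open>Classes are subsets of D, and taking images under an injective map is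
      injective on subsets.\<close>
    have "D // R \<subseteq> Pow D" using R by (auto simp: quotient_def)
    then show "inj_on (\<lambda>X. g ` X) (D // R)"
      using inj_on_image_Pow[OF inj] inj_on_subset by blast
    have "(\<lambda>X. g ` X) ` (D // R) = (\<lambda>a. S `` {g a}) ` D"
      unfolding quotient_def using img by auto
    also have "\<dots> = Z // S" unfolding quotient_def im[symmetric] by auto
    finally show "(\<lambda>X. g ` X) ` (D // R) = Z // S" .
  qed
qed

text \<open>The bracket is known by its values on sections, while \<open>Sym2\<close> is a pointwise
  condition. Covectors lift to sections; on other arguments both sides are 0.\<close>

lemma Sym2_iff:
  assumes "vector_bundle E" "\<phi> \<in> kv_cochains E 2"
  shows "\<phi> \<in> Sym2 E \<longleftrightarrow> (\<forall>\<alpha>\<in>dual_sections E. \<forall>\<beta>\<in>dual_sections E.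
    eval_field \<phi> [\<alpha>, \<beta>] = eval_field \<phi> [\<beta>, \<alpha>])"
proof
  assume "\<phi> \<in> Sym2 E"
  then show "\<forall>\<alpha>\<in>dual_sections E. \<forall>\<beta>\<in>dual_sections E.
    eval_field \<phi> [\<alpha>, \<beta>] = eval_field \<phi> [\<beta>, \<alpha>]"
    by (simp add: Sym2_def eval_field_def)
next
  assume sym: "\<forall>\<alpha>\<in>dual_sections E. \<forall>\<beta>\<in>dual_sections E.
    eval_field \<phi> [\<alpha>, \<beta>] = eval_field \<phi> [\<beta>, \<alpha>]"
  have "\<phi> p [\<alpha>, \<beta>] = \<phi> p [\<beta>, \<alpha>]" for p \<alpha> \<beta>
  proof (cases "\<alpha> \<in> fibre (dual_bundle E) p \<and> \<beta> \<in> fibre (dual_bundle E) p")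
    case True
    obtain \<xi> where \<xi>: "\<xi> \<in> dual_sections E" "\<xi> p = \<alpha>"
      using section_through[OF vector_bundle_dual[OF assms(1)]] True by blast
    obtain \<eta> where \<eta>: "\<eta> \<in> dual_sections E" "\<eta> p = \<beta>"
      using section_through[OF vector_bundle_dual[OF assms(1)]] True by blast
    have "eval_field \<phi> [\<xi>, \<eta>] p = eval_field \<phi> [\<eta>, \<xi>] p" using sym \<xi>(1) \<eta>(1) by simp
    then show ?thesis using \<xi>(2) \<eta>(2) by (simp add: eval_field_def)
  next
    case False
    then have "[\<alpha>, \<beta>] \<notin> covecs E 2 p" "[\<beta>, \<alpha>] \<notin> covecs E 2 p" by (auto simp: covecs_def)
    then show ?thesis
      using multilinear_field_outside[OF kv_cochainsD(1)[OF assms(2)], of "[\<alpha>, \<beta>]" p]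
        multilinear_field_outside[OF kv_cochainsD(1)[OF assms(2)], of "[\<beta>, \<alpha>]" p] by simp
  qed
  then show "\<phi> \<in> Sym2 E" using assms(2) by (simp add: Sym2_def)
qed

lemma kv_cochains_zero:
  fixes E :: "('m::{t2_space, second_countable_topology}, 'v::real_vector, 'z) vbundle_scheme"
  assumes E: "vector_bundle E"
  shows "0 \<in> kv_cochains E k"
proof -
  have "multilinear_field E k (k - 1) 0" by (simp add: multilinear_field_def)
  moreover have "smooth_fun_on (base E) U (\<lambda>p. (0 :: 'm \<Rightarrow> ('v \<Rightarrow> real) list \<Rightarrow> real) p (map (\<lambda>i. coframe E e i p) is))"
    if "(U, e) \<in> frames E" for U e "is"
    using smooth_fun_on_const[OF vector_bundle_base[OF E] frameD(1)[OF E that], of 0] by simp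
  ultimately show ?thesis unfolding kv_cochains_def by blast
qed

section \<open>Infinitesimal deformations, cocycles and coboundaries\<close>

context
  fixes A :: "('m::{t2_space, second_countable_topology}, 'v::real_vector) lsalgebroid"
    and H :: "'m \<Rightarrow> ('v \<Rightarrow> real) list \<Rightarrow> real"
  assumes A: "left_symmetric_algebroid A" and KV: "koszul_vinberg A H"
begin

lemma KV_Sym2: "H \<in> Sym2 A"
  using KV by (simp add: koszul_vinberg_def)

lemma tilde_cochains_2: "tilde_cochains A H 2 = Sym2 A"
  by (simp add: tilde_cochains_def Sym2_def)

text \<open>In degree 2 the differential is - [[H, K]]; the sign does not affect its vanishing,
  which can be tested on global sections.\<close>

lemma kv_delta_2_eq_0_iff:
  assumes K: "K \<in> Sym2 A"
  shows "kv_delta A H 2 K = 0 \<longleftrightarrow>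
    (\<forall>\<alpha>1\<in>dual_sections A. \<forall>\<alpha>2\<in>dual_sections A. \<forall>\<alpha>3\<in>dual_sections A.
      KV_expr A H K \<alpha>1 \<alpha>2 \<alpha>3 + KV_expr A K H \<alpha>1 \<alpha>2 \<alpha>3 = 0)"
proof -
  let ?T = "kv_bracket A 1 H 1 K"
  let ?Z = "\<forall>\<alpha>1\<in>dual_sections A. \<forall>\<alpha>2\<in>dual_sections A. \<forall>\<alpha>3\<in>dual_sections A.
      eval_field ?T [\<alpha>1, \<alpha>2, \<alpha>3] = 0"
  note T = kv_bracket_Sym2_Sym2[OF A KV_Sym2 K]
  note vb = lsa_bundle[OF A]
  have "kv_delta A H 2 K = - ?T" by (simp add: kv_delta_def)
  then have "kv_delta A H 2 K = 0 \<longleftrightarrow> ?T = 0" by (simp only: neg_equal_0_iff_equal)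
  also have "\<dots> \<longleftrightarrow> ?Z"
  proof
    assume "?T = 0"
    then show ?Z
      by (simp add: eval_field_def fun_eq_iff)
  next
    assume z: ?Z
    show "?T = 0"
    proof (rule kv_cochain_eqI[OF vb T(1) kv_cochains_zero[OF vb]])
      fix cs :: "('m \<Rightarrow> 'v \<Rightarrow> real) list"
      assume as: "length cs = 3" "set cs \<subseteq> dual_sections A"
      obtain \<alpha>1 \<alpha>2 \<alpha>3 where "cs = [\<alpha>1, \<alpha>2, \<alpha>3]"
        using as(1) by (auto simp: numeral_3_eq_3 length_Suc_conv)
      then have "eval_field ?T cs = 0" using z as(2) by simp
      also have "0 = eval_field (0 :: 'm \<Rightarrow> ('v \<Rightarrow> real) list \<Rightarrow> real) cs" by (simp add: eval_field_def fun_eq_iff)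
      finally show "eval_field ?T cs = eval_field 0 cs" .
    qed
  qed
  finally show ?thesis by (simp only: T(2) cong: ball_cong)
qed

text \<open>The constant coefficient of the deformation equation is [H, H] = 0. The coefficient of t
  has the two summands of the polarisation, and symmetry of the linear term is membership in the
  subcomplex.\<close>

lemma deformations_1_iff:
  "Ht \<in> deformations A H 1 \<longleftrightarrow> Ht 0 = H \<and> (\<forall>i>1. Ht i = 0) \<and> Ht 1 \<in> tilde_cocycles A H 2"
proof -
  let ?D = "dual_sections A"
  have le1: "(\<forall>i\<le>1. P i) \<longleftrightarrow> P 0 \<and> P (1::nat)" for P
    by (metis le_0_eq le_Suc_eq One_nat_def)
  have H0: "KV_expr A H H \<alpha>1 \<alpha>2 \<alpha>3 = 0" if "\<alpha>1 \<in> ?D" "\<alpha>2 \<in> ?D" "\<alpha>3 \<in> ?D" for \<alpha>1 \<alpha>2 \<alpha>3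
    using KV that unfolding koszul_vinberg_def by blast
  have "Ht \<in> deformations A H 1 \<longleftrightarrow> Ht 0 = H \<and> Ht 1 \<in> Sym2 A \<and> (\<forall>i>1. Ht i = 0) \<and>
      (\<forall>\<alpha>1\<in>?D. \<forall>\<alpha>2\<in>?D. \<forall>\<alpha>3\<in>?D. KV_expr A H (Ht 1) \<alpha>1 \<alpha>2 \<alpha>3 + KV_expr A (Ht 1) H \<alpha>1 \<alpha>2 \<alpha>3 = 0)"
    unfolding deformations_def mem_Collect_eq le1 using KV_Sym2 H0 by (auto simp: atMost_Suc add.commute)
  also have "\<dots> \<longleftrightarrow> Ht 0 = H \<and> (\<forall>i>1. Ht i = 0) \<and> Ht 1 \<in> tilde_cocycles A H 2"
    using kv_delta_2_eq_0_iff[of "Ht 1"] by (auto simp: tilde_cocycles_def tilde_cochains_2)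
  finally show ?thesis .
qed

text \<open>Coefficients above t are fixed to be 0, which makes the linear term determine the
  deformation.\<close>

lemma bij_betw_deformations_cocycles:
  "bij_betw (\<lambda>Ht. Ht 1) (deformations A H 1) (tilde_cocycles A H 2)"
proof (rule bij_betwI[where g = "\<lambda>K i. if i = 0 then H else if i = 1 then K else 0"])
  show "(\<lambda>Ht. Ht 1) \<in> deformations A H 1 \<rightarrow> tilde_cocycles A H 2"
    using deformations_1_iff by blast
  show "(\<lambda>K i. if i = 0 then H else if i = 1 then K else 0) \<in> tilde_cocycles A H 2 \<rightarrow> deformations A H 1"
    by (simp only: Pi_iff deformations_1_iff) simp
  show "(\<lambda>i. if i = 0 then H else if i = 1 then Ht 1 else 0) = Ht" if "Ht \<in> deformations A H 1" for Ht
  proof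
    fix i
    show "(if i = 0 then H else if i = 1 then Ht 1 else 0) = Ht i"
      using that unfolding deformations_1_iff by (cases "i > 1") (auto simp: not_less le_Suc_eq)
  qed
qed simp

lemma kv_bracket_vec_symmetric_iff:
  assumes x: "x \<in> sections A"
  shows "kv_bracket A 1 H 0 (vec_cochain A x) \<in> Sym2 A \<longleftrightarrow>
    (\<forall>\<alpha>\<in>dual_sections A. \<forall>\<beta>\<in>dual_sections A.
      eval_field H [R_op A x \<alpha>, \<beta>] = eval_field H [\<alpha>, R_op A x \<beta>])"
proof -
  let ?T = "kv_bracket A 1 H 0 (vec_cochain A x)" and ?D = "dual_sections A"
  note vb = lsa_bundle[OF A] and H = KV_Sym2
  note T = kv_bracket_Sym2_vec[OF A H x]
  have "eval_field ?T [\<alpha>, \<beta>] = eval_field ?T [\<beta>, \<alpha>] \<longleftrightarrow>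
      eval_field H [R_op A x \<alpha>, \<beta>] = eval_field H [\<alpha>, R_op A x \<beta>]"
    if \<alpha>: "\<alpha> \<in> ?D" and \<beta>: "\<beta> \<in> ?D" for \<alpha> \<beta>
  proof -
    \<comment> \<open>This rewrites the only nonsymmetric term of [[H, x]] by R, the operator in the
      definition of the subcomplex.\<close>
    have R: "pairing \<xi> (lprod A (sharp A H \<eta>) x) = - eval_field H [\<eta>, R_op A x \<xi>]"
      if "\<xi> \<in> ?D" "\<eta> \<in> ?D" for \<xi> \<eta>
      using R_op(2)[OF A x that(1) sharp_section[OF A H that(2)]]
        pairing_sharp[OF A H that(2) R_op(1)[OF A x that(1)]] by simp
    have "eval_field H [\<beta>, R_op A x \<alpha>] = eval_field H [R_op A x \<alpha>, \<beta>]"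
      using H by (simp add: Sym2_def eval_field_def)
    then show ?thesis
      unfolding T(3)[OF \<alpha> \<beta>] T(3)[OF \<beta> \<alpha>] R[OF \<beta> \<alpha>] R[OF \<alpha> \<beta>] pairing_sharp_commute[OF A H \<beta> \<alpha>]
      by (auto simp: fun_eq_iff)
  qed
  then show ?thesis using Sym2_iff[OF vb T(1)] by simp
qed

text \<open>In degree 1 the sign of the differential is +1. The condition on x by means of R is
  traded for symmetry of [[H, x]], the form in which it can be deduced for an equivalence.\<close>

lemma tilde_coboundaries_2:
  "tilde_coboundaries A H 2 =
    {kv_bracket A 1 H 0 (vec_cochain A x) | x. x \<in> sections A \<and> kv_bracket A 1 H 0 (vec_cochain A x) \<in> Sym2 A}"
proof -
  have "tilde_coboundaries A H 2 = (\<lambda>x. kv_bracket A 1 H 0 (vec_cochain A x)) `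
      {x \<in> sections A. \<forall>\<alpha>\<in>dual_sections A. \<forall>\<beta>\<in>dual_sections A.
        eval_field H [R_op A x \<alpha>, \<beta>] = eval_field H [\<alpha>, R_op A x \<beta>]}"
    by (simp add: tilde_coboundaries_def tilde_cochains_def kv_delta_def image_image)
  also have "\<dots> = (\<lambda>x. kv_bracket A 1 H 0 (vec_cochain A x)) `
      {x \<in> sections A. kv_bracket A 1 H 0 (vec_cochain A x) \<in> Sym2 A}"
    using kv_bracket_vec_symmetric_iff by (intro arg_cong2[where f = image] refl Collect_cong) auto
  finally show ?thesis by blast
qed

section \<open>Equivalence of infinitesimal deformations\<close>

lemma Sym2_diff:
  assumes "\<phi> \<in> Sym2 A" "\<psi> \<in> Sym2 A" "\<phi> - \<psi> \<in> kv_cochains A 2"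
  shows "\<phi> - \<psi> \<in> Sym2 A"
  using assms by (simp add: Sym2_def)

text \<open>The coefficient of t in ad_X contains the summand with X_0 = 0. Linearity of the bracket
  in x is not among the facts above, so the summand is evaluated on sections.\<close>

lemma kv_bracket_zero_vec:
  assumes K: "K \<in> Sym2 A"
  shows "kv_bracket A 0 (vec_cochain A 0) 1 K = 0"
proof -
  note vb = lsa_bundle[OF A]
  note z = zero_section[OF vb] and T = kv_bracket_Sym2_vec[OF A K zero_section[OF vb]]
  let ?T = "kv_bracket A 1 K 0 (vec_cochain A 0)"
  have zero: "(0 :: 'm \<Rightarrow> 'v) = fun_scale 0 0" by (simp add: fun_scale_def fun_eq_iff)
  have f0: "0 \<in> smooth_funs (base A)" using const_smooth[OF vb, of 0] by (simp add: zero_fun_def)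
  have "?T = 0"
  proof (rule kv_cochain_eqI[OF vb T(1) kv_cochains_zero[OF vb]])
    fix cs :: "('m \<Rightarrow> 'v \<Rightarrow> real) list"
    assume as: "length cs = 2" "set cs \<subseteq> dual_sections A"
    then obtain \<alpha> \<beta> where ab: "cs = [\<alpha>, \<beta>]" "\<alpha> \<in> dual_sections A" "\<beta> \<in> dual_sections A"
      using length_two_eq[OF as(1)] by auto
    have l: "lprod A 0 y = 0" "lprod A y 0 = 0" if y: "y \<in> sections A" for y
      using lsa_product(2)[OF A z z y] lsa_product(3)[OF A z z y] by simp_all
    have "anchor_act A 0 f = 0" for f
      using anchor_act_eq_0[OF A, of 0] by (simp add: fun_eq_iff)
    moreover have "pairing \<xi> (0 :: 'm \<Rightarrow> 'v) = 0" if "\<xi> \<in> dual_sections A" for \<xi>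
      using pairing_diff_right[OF vb that z z] by simp
    ultimately have "eval_field ?T [\<alpha>, \<beta>] = 0"
      unfolding T(3)[OF ab(2,3)] by (simp add: l sharp_section[OF A K] ab)
    then show "eval_field ?T cs = eval_field 0 cs" using ab(1) by (simp add: eval_field_def fun_eq_iff)
  qed
  then show ?thesis using T(2) by simp
qed

text \<open>Only the powers 0 and 1 of ad contribute up to order t. As X_0 = 0, the linear part of
  ad is [[X_1, H]] = - [[H, X_1]].\<close>

lemma exp_ad_series_order_1:
  assumes X: "X 0 = 0" "X 1 \<in> sections A" and Ht: "Ht 0 = H" "Ht 1 \<in> Sym2 A"
  shows "exp_ad_series A X 1 Ht 0 = H"
    and "exp_ad_series A X 1 Ht 1 = Ht 1 - kv_bracket A 1 H 0 (vec_cochain A (X 1))"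
proof -
  show "exp_ad_series A X 1 Ht 0 = H" using Ht(1) by (simp add: exp_ad_series_def)
  have "exp_ad_series A X 1 Ht 1 = Ht 1 + ad_series A X 1 Ht 1"
    by (simp add: exp_ad_series_def)
  also have "ad_series A X 1 Ht 1 =
      kv_bracket A 0 (vec_cochain A 0) 1 (Ht 1) + kv_bracket A 0 (vec_cochain A (X 1)) 1 H"
    using X(1) Ht(1) by (simp add: ad_series_def)
  also have "\<dots> = - kv_bracket A 1 H 0 (vec_cochain A (X 1))"
    unfolding kv_bracket_zero_vec[OF Ht(2)] kv_bracket_Sym2_vec(2)[OF A KV_Sym2 X(2)] by simp
  finally show "exp_ad_series A X 1 Ht 1 = Ht 1 - kv_bracket A 1 H 0 (vec_cochain A (X 1))"
    by (simp only: diff_conv_add_uminus)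
qed

text \<open>Modulo t^2 only the coefficient X_1 of the series counts, so equivalence says that the
  linear terms differ by [[H, x]] for some section x.\<close>

lemma equivalent_iff_cohomologous:
  assumes "Ht \<in> deformations A H 1" "Ht' \<in> deformations A H 1"
  shows "(Ht, Ht') \<in> equivalent_deformations A H 1 \<longleftrightarrow> (Ht 1, Ht' 1) \<in> cohomologous A H 2"
proof -
  note d = assms[unfolded deformations_1_iff]
  have sym: "Ht 1 \<in> Sym2 A" "Ht' 1 \<in> Sym2 A"
    using d by (simp_all add: tilde_cocycles_def tilde_cochains_2)
  let ?B = "\<lambda>x. kv_bracket A 1 H 0 (vec_cochain A x)"
  have le1: "(\<forall>i\<le>1. P i) \<longleftrightarrow> P 0 \<and> P (1::nat)" for P
    by (metis le_0_eq le_Suc_eq One_nat_def)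
  have "(Ht, Ht') \<in> equivalent_deformations A H 1 \<longleftrightarrow>
      (\<exists>X :: nat \<Rightarrow> 'm \<Rightarrow> 'v. X 0 = 0 \<and> (\<forall>i. X i \<in> sections A) \<and> Ht 1 - ?B (X 1) = Ht' 1)"
  proof -
    have "(Ht, Ht') \<in> equivalent_deformations A H 1 \<longleftrightarrow>
        (\<exists>X. X 0 = 0 \<and> (\<forall>i. X i \<in> sections A) \<and>
          (exp_ad_series A X 1 Ht 0 = Ht' 0 \<and> exp_ad_series A X 1 Ht 1 = Ht' 1))"
      unfolding equivalent_deformations_def le1 using assms by blast
    also have "\<dots> \<longleftrightarrow> (\<exists>X :: nat \<Rightarrow> 'm \<Rightarrow> 'v. X 0 = 0 \<and> (\<forall>i. X i \<in> sections A) \<and> Ht 1 - ?B (X 1) = Ht' 1)"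
    proof -
      have "exp_ad_series A X 1 Ht 0 = Ht' 0 \<and> exp_ad_series A X 1 Ht 1 = Ht' 1 \<longleftrightarrow> Ht 1 - ?B (X 1) = Ht' 1"
        if "X 0 = 0" "\<forall>i. X i \<in> sections A" for X
        using exp_ad_series_order_1[of X Ht] that d sym(1) by simp
      then show ?thesis by blast
    qed
    finally show ?thesis .
  qed
  also have "\<dots> \<longleftrightarrow> (\<exists>x\<in>sections A. Ht 1 - ?B x = Ht' 1)"
  proof
    assume "\<exists>x\<in>sections A. Ht 1 - ?B x = Ht' 1"
    then obtain x where "x \<in> sections A" "Ht 1 - ?B x = Ht' 1" by blast
    then show "\<exists>X :: nat \<Rightarrow> 'm \<Rightarrow> 'v. X 0 = 0 \<and> (\<forall>i. X i \<in> sections A) \<and> Ht 1 - ?B (X 1) = Ht' 1"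
      \<comment> \<open>The series is x t; its other coefficients are the zero section.\<close>
      using zero_section[OF lsa_bundle[OF A]] by (intro exI[of _ "\<lambda>i. if i = 1 then x else 0"]) auto
  qed blast
  also have "\<dots> \<longleftrightarrow> (\<exists>x\<in>sections A. Ht 1 - Ht' 1 = ?B x)"
    by (intro bex_cong refl) (auto simp: algebra_simps)
  \<comment> \<open>Being equal to a bracket, the difference is a cochain; being a difference of
    symmetric fields, it is symmetric. Hence x satisfies the condition of the subcomplex.\<close>
  also have "\<dots> \<longleftrightarrow> Ht 1 - Ht' 1 \<in> tilde_coboundaries A H 2"
    unfolding tilde_coboundaries_2
    using Sym2_diff[OF sym] kv_bracket_Sym2_vec(1)[OF A KV_Sym2] by auto
  also have "\<dots> \<longleftrightarrow> (Ht 1, Ht' 1) \<in> cohomologous A H 2"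
    using d by (simp add: cohomologous_def)
  finally show ?thesis .
qed

end

theorem proposition6p20:
  fixes A :: "('m::{t2_space, second_countable_topology}, 'v::real_vector) lsalgebroid"
    and H :: "'m \<Rightarrow> ('v \<Rightarrow> real) list \<Rightarrow> real"
  assumes "left_symmetric_algebroid A"
    and "koszul_vinberg A H"
  shows "\<exists>f. bij_betw f (deformations A H 1 // equivalent_deformations A H 1) (tilde_cohomology A H 2) \<and>
    (\<forall>Ht\<in>deformations A H 1.
       f (equivalent_deformations A H 1 `` {Ht}) = cohomologous A H 2 `` {Ht 1})"
proof -
  have "equivalent_deformations A H 1 \<subseteq> deformations A H 1 \<times> deformations A H 1"
    by (auto simp: equivalent_deformations_def)
  moreover have "cohomologous A H 2 \<subseteq> tilde_cocycles A H 2 \<times> tilde_cocycles A H 2"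
    by (auto simp: cohomologous_def)
  ultimately have "bij_betw (\<lambda>X. (\<lambda>Ht. Ht 1) ` X) (deformations A H 1 // equivalent_deformations A H 1)
      (tilde_cocycles A H 2 // cohomologous A H 2)"
    and "\<forall>Ht\<in>deformations A H 1.
      (\<lambda>Ht. Ht 1) ` (equivalent_deformations A H 1 `` {Ht}) = cohomologous A H 2 `` {Ht 1}"
    using bij_betw_quotients[OF bij_betw_deformations_cocycles[OF assms] _ _
        equivalent_iff_cohomologous[OF assms]] by auto
  then show ?thesis unfolding tilde_cohomology_def by blast
qed

end
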